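(* Let $\mathbb{X}$ be a countable nonempty reflexive or irreflexive ultrahomogeneous binary structure which is not biconnected, and let $\mathbb{Y}$ be an ultrahomogeneous digraph and $\kappa>1$ a cardinal such that $\mathbb{X}$ is isomorphic to $\bigcup_\kappa\mathbb{Y}_e$, $(\bigcup_\kappa\mathbb{Y}_e)_{re}$, $(\bigcup_\kappa\mathbb{Y}_e)^c$ or $((\bigcup_\kappa\mathbb{Y}_e)_{re})^c$ (such $\mathbb{Y}$ and $\kappa$ exist). Then (i) If $\kappa<\omega$ and $\mathbb{Y}$ has finitely many components, then $\mathbb{P}(\mathbb{X})\cong\mathbb{P}(\mathbb{Z})^n$ for some biconnected ultrahomogeneous digraph $\mathbb{Z}$ and some natural number $n\geq2$. (ii) If $\kappa=\omega$ or $\mathbb{Y}$ has infinitely many components, then $\operatorname{sq}\mathbb{P}(\mathbb{X})$ is an atomless and $\omega_1$-closed poset and, under the Continuum Hypothesis, it is forcing equivalent to the poset $(P(\omega)/\mathrm{Fin})^+$.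
   Context: A binary structure is a pair $\mathbb{X}=\langle X,\rho\rangle$ with $\rho$ a binary relation on the set $X$; it is called reflexive (irreflexive) if $\rho$ is. It is ultrahomogeneous iff every isomorphism between finite substructures of $\mathbb{X}$ extends to an automorphism of $\mathbb{X}$. Let $\Delta_X$ be the diagonal of $X$ and $\rho_{rst}$ the transitive closure of $\Delta_X\cup\rho\cup\rho^{-1}$ (the smallest equivalence relation containing $\rho$). The components of $\mathbb{X}$ are the $\rho_{rst}$-classes (with the induced structure), and $\mathbb{X}$ is connected iff $|X/\rho_{rst}|=1$. The complement is $\mathbb{X}^c=\langle X,X^2\setminus\rho\rangle$ and the reflexification is $\mathbb{X}_{re}=\langle X,\rho\cup\Delta_X\rangle$. $\mathbb{X}$ is biconnected iff both $\mathbb{X}$ and $\mathbb{X}^c$ are connected. A digraph is a binary structure whose relation is irreflexive and asymmetric. The enlargement of $\mathbb{X}$ is $\mathbb{X}_e=\langle X,\rho_e\rangle$, where $x\,\rho_e\,y$ iff $x\rho y$ or ($x\neq y$ and $\neg x\rho y$ and $\neg y\rho x$). $\bigcup_\kappa\mathbb{Z}$ denotes the disjoint union of $\kappa$ copies of $\mathbb{Z}$ (with no relations between different copies). $\mathbb{P}(\mathbb{X})$ is the set of all $A\subset X$ such that the substructure $\langle A,\rho\cap(A\times A)\rangle$ is isomorphic to $\mathbb{X}$, regarded as a poset under inclusion. Powers of posets carry the coordinatewise order. For a partial order $\mathbb{P}=\langle P,\leq\rangle$ let $p\leq^*q$ iff for every $r\leq p$ there is $s\leq r$ with $s\leq q$,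 and let $p=^*q$ iff $p\leq^*q$ and $q\leq^*p$. The separative quotient $\operatorname{sq}\mathbb{P}$ is the poset $P/{=^*}$ ordered by $[p]\trianglelefteq[q]\Leftrightarrow p\leq^*q$. An element $p$ is an atom iff any $q,r\leq p$ have a common lower bound; a poset is atomless iff it has no atoms. A poset is $\omega_1$-closed iff for every $\gamma<\omega_1$ each decreasing sequence $\langle p_\alpha:\alpha<\gamma\rangle$ has a lower bound. Two posets are forcing equivalent iff they produce the same generic extensions, equivalently iff they have isomorphic Boolean completions. $\mathrm{Fin}$ is the ideal of finite subsets of $\omega$, and for a Boolean algebra $B$, $B^+$ denotes the poset of its nonzero elements. *)

theory Defs
  imports "HOL-Library.FuncSet" "HOL-Library.Countable_Set" "HOL-Analysis.Abstract_Topology"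
begin

unbundle cardinal_syntax

section \<open>Binary structures\<close>

text \<open>A pair of a carrier and a relation on it; partial orders are represented in the same way,
  with the non-strict order as the relation.\<close>

type_synonym 'a bstruct = "'a set \<times> 'a rel"

abbreviation carr :: "'a bstruct \<Rightarrow> 'a set" where "carr X \<equiv> fst X"
abbreviation brel :: "'a bstruct \<Rightarrow> 'a rel" where "brel X \<equiv> snd X"

definition binary_structure :: "'a bstruct \<Rightarrow> bool" where
  "binary_structure X \<longleftrightarrow> brel X \<subseteq> carr X \<times> carr X"

definition reflexive_bs :: "'a bstruct \<Rightarrow> bool" where
  "reflexive_bs X \<longleftrightarrow> refl_on (carr X) (brel X)"

definition irreflexive_bs :: "'a bstruct \<Rightarrow> bool" where
  "irreflexive_bs X \<longleftrightarrow> irrefl (brel X)"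

definition substructure :: "'a bstruct \<Rightarrow> 'a set \<Rightarrow> 'a bstruct" where
  "substructure X A = (A, brel X \<inter> (A \<times> A))"

definition bs_iso :: "('a \<Rightarrow> 'b) \<Rightarrow> 'a bstruct \<Rightarrow> 'b bstruct \<Rightarrow> bool" where
  "bs_iso f X Y \<longleftrightarrow> bij_betw f (carr X) (carr Y) \<and>
     (\<forall>x\<in>carr X. \<forall>y\<in>carr X. (x, y) \<in> brel X \<longleftrightarrow> (f x, f y) \<in> brel Y)"

definition isomorphic :: "'a bstruct \<Rightarrow> 'b bstruct \<Rightarrow> bool"  (infix \<open>\<cong>\<^sub>b\<close> 50) where
  "X \<cong>\<^sub>b Y \<longleftrightarrow> (\<exists>f. bs_iso f X Y)"

definition ultrahomogeneous :: "'a bstruct \<Rightarrow> bool" where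
  "ultrahomogeneous X \<longleftrightarrow>
     (\<forall>A B f. A \<subseteq> carr X \<and> finite A \<and> B \<subseteq> carr X \<and> finite B \<and>
        bs_iso f (substructure X A) (substructure X B) \<longrightarrow>
        (\<exists>g. bs_iso g X X \<and> (\<forall>x\<in>A. g x = f x)))"

definition rst :: "'a bstruct \<Rightarrow> 'a rel" where
  "rst X = (Id_on (carr X) \<union> brel X \<union> (brel X)\<inverse>)\<^sup>+"

definition bs_components :: "'a bstruct \<Rightarrow> 'a set set" where
  "bs_components X = carr X // rst X"

definition bs_connected :: "'a bstruct \<Rightarrow> bool" where
  "bs_connected X \<longleftrightarrow> card (bs_components X) = 1"

definition bs_compl :: "'a bstruct \<Rightarrow> 'a bstruct" where
  "bs_compl X = (carr X, carr X \<times> carr X - brel X)"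

definition reflexification :: "'a bstruct \<Rightarrow> 'a bstruct" where
  "reflexification X = (carr X, brel X \<union> Id_on (carr X))"

definition biconnected :: "'a bstruct \<Rightarrow> bool" where
  "biconnected X \<longleftrightarrow> bs_connected X \<and> bs_connected (bs_compl X)"

definition digraph :: "'a bstruct \<Rightarrow> bool" where
  "digraph X \<longleftrightarrow> binary_structure X \<and> irrefl (brel X) \<and> asym (brel X)"

definition enlargement :: "'a bstruct \<Rightarrow> 'a bstruct" where
  "enlargement X = (carr X, {(x, y). x \<in> carr X \<and> y \<in> carr X \<and>
     ((x, y) \<in> brel X \<or> (x \<noteq> y \<and> (x, y) \<notin> brel X \<and> (y, x) \<notin> brel X))})"

text \<open>Cardinals are represented, as in the library, by well-orders satisfying \<^const>\<open>Card_order\<close>;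
  the copies in the disjoint union of \<open>\<kappa>\<close> copies are indexed by the elements of \<open>\<kappa>\<close>, that is,
  by \<open>Field \<kappa>\<close>.\<close>

definition copies_union :: "'i rel \<Rightarrow> 'a bstruct \<Rightarrow> ('i \<times> 'a) bstruct" where
  "copies_union \<kappa> Y =
     (Field \<kappa> \<times> carr Y, {((i, x), (i, y)) | i x y. i \<in> Field \<kappa> \<and> (x, y) \<in> brel Y})"

definition represents :: "'b bstruct \<Rightarrow> 'i rel \<Rightarrow> 'a bstruct \<Rightarrow> bool" where
  "represents Y \<kappa> X \<longleftrightarrow>
     digraph Y \<and> ultrahomogeneous Y \<and> Card_order \<kappa> \<and> cone <o \<kappa> \<and>
     (let U = copies_union \<kappa> (enlargement Y) in
        X \<cong>\<^sub>b U \<or> X \<cong>\<^sub>b reflexification U \<or> X \<cong>\<^sub>b bs_compl U \<or> X \<cong>\<^sub>b bs_compl (reflexification U))"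

section \<open>Posets\<close>

definition poset :: "'p bstruct \<Rightarrow> bool" where
  "poset P \<longleftrightarrow> binary_structure P \<and> partial_order_on (carr P) (brel P)"

definition by_inclusion :: "'a set set \<Rightarrow> 'a set bstruct" where
  "by_inclusion F = (F, {(A, B). A \<in> F \<and> B \<in> F \<and> A \<subseteq> B})"

definition copies_poset :: "'a bstruct \<Rightarrow> 'a set bstruct"  (\<open>\<P>\<close>) where
  "\<P> X = by_inclusion {A. A \<subseteq> carr X \<and> substructure X A \<cong>\<^sub>b X}"

definition poset_power :: "'p bstruct \<Rightarrow> nat \<Rightarrow> (nat \<Rightarrow> 'p) bstruct" where
  "poset_power P n =
     (let C = {..<n} \<rightarrow>\<^sub>E carr P in
        (C, {(f, g). f \<in> C \<and> g \<in> C \<and> (\<forall>i<n. (f i, g i) \<in> brel P)}))"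

definition le_star :: "'p bstruct \<Rightarrow> 'p rel" where
  "le_star P = {(p, q). p \<in> carr P \<and> q \<in> carr P \<and>
     (\<forall>r. (r, p) \<in> brel P \<longrightarrow> (\<exists>s. (s, r) \<in> brel P \<and> (s, q) \<in> brel P))}"

definition eq_star :: "'p bstruct \<Rightarrow> 'p rel" where
  "eq_star P = le_star P \<inter> (le_star P)\<inverse>"

definition sq :: "'p bstruct \<Rightarrow> 'p set bstruct" where
  "sq P = (carr P // eq_star P,
     {(eq_star P `` {p}, eq_star P `` {q}) | p q. (p, q) \<in> le_star P})"

definition poset_atom :: "'p bstruct \<Rightarrow> 'p \<Rightarrow> bool" where
  "poset_atom P p \<longleftrightarrow> p \<in> carr P \<and>
     (\<forall>q r. (q, p) \<in> brel P \<and> (r, p) \<in> brel P \<longrightarrow> (\<exists>s. (s, q) \<in> brel P \<and> (s, r) \<in> brel P))"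

definition atomless :: "'p bstruct \<Rightarrow> bool" where
  "atomless P \<longleftrightarrow> (\<nexists>p. poset_atom P p)"

text \<open>The elements of \<open>Field omega1\<close> are the ordinals below \<open>\<omega>\<^sub>1\<close>, and
  \<open>underS omega1 \<gamma>\<close> consists of the ordinals \<open>\<alpha> < \<gamma>\<close>.\<close>

definition omega1 :: "nat set rel" where
  "omega1 = cardSuc natLeq"

definition omega1_closed :: "'p bstruct \<Rightarrow> bool" where
  "omega1_closed P \<longleftrightarrow>
     (\<forall>\<gamma>\<in>Field omega1. \<forall>p.
        (\<forall>\<alpha>\<in>underS omega1 \<gamma>. p \<alpha> \<in> carr P) \<and>
        (\<forall>\<beta>\<in>underS omega1 \<gamma>. \<forall>\<alpha>\<in>underS omega1 \<beta>. (p \<beta>, p \<alpha>) \<in> brel P) \<longrightarrow>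
        (\<exists>q\<in>carr P. \<forall>\<alpha>\<in>underS omega1 \<gamma>. (q, p \<alpha>) \<in> brel P))"

definition continuum_hypothesis :: bool where
  "continuum_hypothesis \<longleftrightarrow> |UNIV :: nat set set| =o omega1"

text \<open>The Boolean completion of a poset is the algebra of regular open sets of the topology whose
  open sets are the downward closed sets. An order isomorphism of Boolean algebras is a Boolean
  isomorphism, so the algebra is given by its order.\<close>

definition down_topology :: "'p bstruct \<Rightarrow> 'p topology" where
  "down_topology P = topology (\<lambda>U. U \<subseteq> carr P \<and> (\<forall>p\<in>U. \<forall>q. (q, p) \<in> brel P \<longrightarrow> q \<in> U))"

lemma openin_down_topology:
  assumes "binary_structure P"
  shows "openin (down_topology P) U \<longleftrightarrow>
    U \<subseteq> carr P \<and> (\<forall>p\<in>U. \<forall>q. (q, p) \<in> brel P \<longrightarrow> q \<in> U)"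
proof -
  have "istopology (\<lambda>U. U \<subseteq> carr P \<and> (\<forall>p\<in>U. \<forall>q. (q, p) \<in> brel P \<longrightarrow> q \<in> U))"
    unfolding istopology_def by blast
  then show ?thesis by (simp add: down_topology_def topology_inverse')
qed

definition boolean_completion :: "'p bstruct \<Rightarrow> 'p set bstruct" where
  "boolean_completion P = by_inclusion
     {A. A \<subseteq> carr P \<and> down_topology P interior_of (down_topology P closure_of A) = A}"

definition forcing_equivalent :: "'p bstruct \<Rightarrow> 'q bstruct \<Rightarrow> bool" where
  "forcing_equivalent P Q \<longleftrightarrow> boolean_completion P \<cong>\<^sub>b boolean_completion Q"

definition eq_mod_fin :: "nat set rel" where
  "eq_mod_fin = {(A, B). finite ((A - B) \<union> (B - A))}"

definition Pomega_Fin_plus :: "nat set set bstruct" where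
  "Pomega_Fin_plus =
     (let C = UNIV // eq_mod_fin - {eq_mod_fin `` {{}}} in
        (C, {(a, b). a \<in> C \<and> b \<in> C \<and> (\<exists>A\<in>a. \<exists>B\<in>b. finite (A - B))}))"

end

theory Submission
  imports Defs
begin

text \<open>Passing to the complement and to the irreflexive part, which changes neither automorphisms nor
  copies, one may assume that \<open>X\<close> is irreflexive and disconnected. Automorphisms move any point to
  any other, so all components are isomorphic; and two distinct points \<open>x, y\<close> of one component are
  always related, because otherwise \<open>(x, y)\<close> looks like a pair \<open>(x, z)\<close> with \<open>z\<close> in another component
  although no automorphism separates \<open>y\<close> from the component of \<open>x\<close>. So a component is the enlargement
  of its asymmetric part \<open>Y\<close>, and \<open>X\<close> is a union of copies of that enlargement
  (\<open>representation_exists\<close>). The same argument applied to an ultrahomogeneous digraph \<open>Y\<close> shows that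
  \<open>Y\<close> is a union of copies of one component \<open>Z\<close>, which is a tournament unless \<open>Y = Z\<close>
  (\<open>decomposition\<close>). A connected nonempty digraph is automatically biconnected.

  When the parts of such a union are semicomplete, an embedding of the union into itself respects the
  division into parts. Hence a copy of the union consists of copies of the part, placed in a set of
  parts of full cardinality (\<open>copies_copies_union\<close>). Used for both levels of the structure, this
  describes the copies of \<open>X\<close> by their traces on the blocks \<open>(i, C)\<close>, with \<open>i\<close> in \<open>\<kappa>\<close> and \<open>C\<close> a
  component of \<open>Y\<close> (\<open>copies_two_level\<close>). With finitely many blocks every block must be met, the traces
  are arbitrary copies of \<open>Z\<close>, and the poset of copies is a power with one factor for each block.

  With infinitely many blocks, the blocks can be arranged in rows of type \<open>\<omega>\<close> so that a set is a copy
  exactly if it meets infinitely many blocks of each row and each nonempty trace is a permitted one. In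
  such a family \<open>A \<le>\<^sup>* B\<close> holds iff, in each row, the trace of \<open>A\<close> is blockwise below the trace of
  \<open>B\<close> with finitely many exceptions. So the separative quotient is a reduced product modulo \<open>Fin\<close>:
  splitting the blocks of each row into two infinite sets shows that it is atomless, and a diagonal
  choice of blocks gives lower bounds of decreasing sequences (locale \<open>blocks\<close>).

  Under the Continuum Hypothesis there is, up to forcing equivalence, just one atomless poset of size
  at most \<open>\<omega>\<^sub>1\<close> in which countable chains are bounded: each has a dense subset that is order isomorphic,
  up to repetitions, to one and the same tree (\<open>dense_tree\<close>), and a common dense set gives isomorphic
  algebras of regular open sets (\<open>forcing_equivalent_if_common_dense\<close>). Both the separative quotient
  and \<open>(P(\<omega>)/Fin)\<^sup>+\<close> are of this kind, the latter being the quotient of the family of infinite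
  subsets of \<open>\<omega>\<close> with the points as blocks.\<close>

section \<open>Isomorphisms, copies and pointwise definable structures\<close>

lemma substructure_simps [simp]:
  "carr (substructure X A) = A"
  "(x, y) \<in> brel (substructure X A) \<longleftrightarrow> (x, y) \<in> brel X \<and> x \<in> A \<and> y \<in> A"
  by (auto simp: substructure_def)

lemma bs_iso_substructure_iff:
  "bs_iso f X (substructure Y A) \<longleftrightarrow> bij_betw f (carr X) A \<and>
     (\<forall>x\<in>carr X. \<forall>y\<in>carr X. (x, y) \<in> brel X \<longleftrightarrow> (f x, f y) \<in> brel Y)"
  unfolding bs_iso_def by (auto dest: bij_betwE)

lemma bs_iso_id: "bs_iso id X X" by (simp add: bs_iso_def)

lemma bs_iso_comp: "bs_iso f X Y \<Longrightarrow> bs_iso g Y Z \<Longrightarrow> bs_iso (g \<circ> f) X Z"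
  unfolding bs_iso_def by (auto intro: bij_betw_trans dest: bij_betwE)

lemma bs_iso_inv:
  assumes "bs_iso f X Y"
  shows "bs_iso (inv_into (carr X) f) Y X"
  unfolding bs_iso_def
proof (intro conjI ballI)
  have b: "bij_betw f (carr X) (carr Y)" using assms by (simp add: bs_iso_def)
  then show b': "bij_betw (inv_into (carr X) f) (carr Y) (carr X)" by (rule bij_betw_inv_into)
  fix x y assume xy: "x \<in> carr Y" "y \<in> carr Y"
  then have "inv_into (carr X) f x \<in> carr X" "inv_into (carr X) f y \<in> carr X"
    using bij_betwE[OF b'] by simp_all
  moreover have "f (inv_into (carr X) f x) = x" "f (inv_into (carr X) f y) = y"
    using bij_betw_inv_into_right[OF b] xy by simp_all
  ultimately show "(x, y) \<in> brel Y \<longleftrightarrow>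
      (inv_into (carr X) f x, inv_into (carr X) f y) \<in> brel X"
    using assms unfolding bs_iso_def by metis
qed

lemma isomorphic_sym: "X \<cong>\<^sub>b Y \<Longrightarrow> Y \<cong>\<^sub>b X"
  using bs_iso_inv unfolding isomorphic_def by metis

lemma isomorphic_trans: "X \<cong>\<^sub>b Y \<Longrightarrow> Y \<cong>\<^sub>b Z \<Longrightarrow> X \<cong>\<^sub>b Z"
  using bs_iso_comp unfolding isomorphic_def by metis

lemma bs_iso_substructure:
  assumes "bs_iso f X Y" "A \<subseteq> carr X"
  shows "bs_iso f (substructure X A) (substructure Y (f ` A))"
  unfolding bs_iso_def
proof (intro conjI ballI)
  show "bij_betw f (carr (substructure X A)) (carr (substructure Y (f ` A)))"
    using assms unfolding bs_iso_def by (auto intro: bij_betw_subset)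
  fix x y assume "x \<in> carr (substructure X A)" "y \<in> carr (substructure X A)"
  then show "(x, y) \<in> brel (substructure X A) \<longleftrightarrow> (f x, f y) \<in> brel (substructure Y (f ` A))"
    using assms unfolding bs_iso_def by auto
qed

lemma poset_by_inclusion: "poset (by_inclusion F)"
  unfolding poset_def by_inclusion_def binary_structure_def partial_order_on_def preorder_on_def
    refl_on_def trans_def antisym_def
  by auto

lemma by_inclusion_simps [simp]:
  "carr (by_inclusion F) = F" "(A, B) \<in> brel (by_inclusion F) \<longleftrightarrow> A \<in> F \<and> B \<in> F \<and> A \<subseteq> B"
  by (auto simp: by_inclusion_def)

definition copies :: "'a bstruct \<Rightarrow> 'a set set" where
  "copies X = {A. A \<subseteq> carr X \<and> substructure X A \<cong>\<^sub>b X}"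

lemma copies_poset_eq: "\<P> X = by_inclusion (copies X)"
  by (simp add: copies_poset_def copies_def)

lemma in_copies_iff: "A \<in> copies X \<longleftrightarrow> A \<subseteq> carr X \<and> (\<exists>f. bs_iso f X (substructure X A))"
proof -
  have "substructure X A \<cong>\<^sub>b X \<longleftrightarrow> X \<cong>\<^sub>b substructure X A"
    by (rule iffI; rule isomorphic_sym)
  then show ?thesis unfolding copies_def by (simp add: isomorphic_def[of X])
qed

lemma carr_in_copies: "carr X \<in> copies X"
proof -
  have "bs_iso id X (substructure X (carr X))"
    by (simp add: bs_iso_substructure_iff)
  then show ?thesis unfolding in_copies_iff by (metis subset_refl)
qed

lemma copies_iso:
  assumes f: "bs_iso f X Y" and A: "A \<subseteq> carr X"
  shows "A \<in> copies X \<longleftrightarrow> f ` A \<in> copies Y"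
proof -
  have *: "substructure X A \<cong>\<^sub>b substructure Y (f ` A)" "X \<cong>\<^sub>b Y"
    using bs_iso_substructure[OF f A] f unfolding isomorphic_def by metis+
  have "f ` A \<subseteq> carr Y" using f A unfolding bs_iso_def by (auto dest: bij_betwE)
  with A * show ?thesis
    unfolding copies_def mem_Collect_eq using isomorphic_trans isomorphic_sym by metis
qed

text \<open>Adjacency in \<open>X'\<close> of an ordered pair is a Boolean combination of equality and of the two adjacencies
  in \<open>X\<close>. Complements, reflexifications and enlargements all arise in this way, and if \<open>X\<close> is in turn
  derived from \<open>X'\<close>, then both have the same finite partial isomorphisms, automorphisms and copies.\<close>

definition derived :: "(bool \<Rightarrow> bool \<Rightarrow> bool \<Rightarrow> bool) \<Rightarrow> 'a bstruct \<Rightarrow> 'a bstruct \<Rightarrow> bool" where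
  "derived \<Phi> X X' \<longleftrightarrow> carr X' = carr X \<and> (\<forall>x\<in>carr X. \<forall>y\<in>carr X.
     (x, y) \<in> brel X' \<longleftrightarrow> \<Phi> (x = y) ((x, y) \<in> brel X) ((y, x) \<in> brel X))"

lemma derived_iso:
  assumes X: "derived \<Phi> X X'" and Y: "derived \<Phi> Y Y'" and f: "bs_iso f X Y"
  shows "bs_iso f X' Y'"
  unfolding bs_iso_def
proof (intro conjI ballI)
  have c: "carr X' = carr X" "carr Y' = carr Y" using X Y by (simp_all add: derived_def)
  have b: "bij_betw f (carr X) (carr Y)" using f by (simp add: bs_iso_def)
  then show "bij_betw f (carr X') (carr Y')" by (simp add: c)
  fix x y assume "x \<in> carr X'" "y \<in> carr X'"
  then have xy: "x \<in> carr X" "y \<in> carr X" by (simp_all add: c)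
  then have fxy: "f x \<in> carr Y" "f y \<in> carr Y" using bij_betwE[OF b] by simp_all
  have "f x = f y \<longleftrightarrow> x = y" using b xy by (metis bij_betw_inv_into_left)
  moreover have "(f x, f y) \<in> brel Y \<longleftrightarrow> (x, y) \<in> brel X" "(f y, f x) \<in> brel Y \<longleftrightarrow> (y, x) \<in> brel X"
    using f xy by (simp_all add: bs_iso_def)
  ultimately show "(x, y) \<in> brel X' \<longleftrightarrow> (f x, f y) \<in> brel Y'"
    using X Y xy fxy by (simp add: derived_def)
qed

lemma derived_substructure:
  "derived \<Phi> X X' \<Longrightarrow> A \<subseteq> carr X \<Longrightarrow> derived \<Phi> (substructure X A) (substructure X' A)"
  unfolding derived_def by (simp add: subset_iff)

lemma copies_derived:
  assumes X: "derived \<Phi> X X'" and X': "derived \<Psi> X' X"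
  shows "copies X' = copies X"
proof -
  have c: "carr X' = carr X" using X by (simp add: derived_def)
  have "bs_iso f X (substructure X A) \<longleftrightarrow> bs_iso f X' (substructure X' A)" if A: "A \<subseteq> carr X" for A f
    using derived_iso[OF X derived_substructure[OF X A]] A
      derived_iso[OF X' derived_substructure[OF X', of A]] by (auto simp: c)
  then show ?thesis by (simp add: set_eq_iff in_copies_iff c) metis
qed

lemma ultrahomogeneous_derived:
  assumes X: "derived \<Phi> X X'" and X': "derived \<Psi> X' X" and u: "ultrahomogeneous X"
  shows "ultrahomogeneous X'"
  unfolding ultrahomogeneous_def
proof (intro allI impI, elim conjE)
  have c: "carr X' = carr X" using X by (simp add: derived_def)
  fix A B f assume A: "A \<subseteq> carr X'" "finite A" and B: "B \<subseteq> carr X'" "finite B"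
    and f: "bs_iso f (substructure X' A) (substructure X' B)"
  have "bs_iso f (substructure X A) (substructure X B)"
    by (rule derived_iso[OF derived_substructure[OF X' A(1)] derived_substructure[OF X' B(1)] f])
  then obtain g where g: "bs_iso g X X" "\<forall>x\<in>A. g x = f x"
    using u A B unfolding ultrahomogeneous_def c by metis
  show "\<exists>g. bs_iso g X' X' \<and> (\<forall>x\<in>A. g x = f x)"
    using derived_iso[OF X X g(1)] g(2) by metis
qed

lemma derived_bs_compl: "derived (\<lambda>e r s. \<not> r) X (bs_compl X)" "derived (\<lambda>e r s. \<not> r) (bs_compl X) X"
  by (auto simp: derived_def bs_compl_def)

lemma derived_reflexification:
  assumes "irrefl (brel X)"
  shows "derived (\<lambda>e r s. r \<or> e) X (reflexification X)" "derived (\<lambda>e r s. r \<and> \<not> e) (reflexification X) X"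
  using assms by (auto simp: derived_def reflexification_def irrefl_def)

lemma derived_enlargement: "derived (\<lambda>e r s. r \<or> (\<not> e \<and> \<not> r \<and> \<not> s)) X (enlargement X)"
  by (auto simp: derived_def enlargement_def)

text \<open>Asymmetry makes the enlargement reversible: the pairs added by it are related in both directions, and
  the original ones in one direction only.\<close>

lemma derived_from_enlargement:
  assumes "digraph X"
  shows "derived (\<lambda>e r s. r \<and> \<not> s) (enlargement X) X"
proof -
  have "\<not> ((x, y) \<in> brel X \<and> (y, x) \<in> brel X)" for x y
    using assms unfolding digraph_def by (auto dest: asymD)
  moreover have "(x, x) \<notin> brel X" for x using assms unfolding digraph_def irrefl_def by auto
  ultimately show ?thesis unfolding derived_def enlargement_def by auto
qed

lemma copies_enlargement: "digraph Y \<Longrightarrow> copies (enlargement Y) = copies Y"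
  by (rule copies_derived[OF derived_enlargement derived_from_enlargement])

section \<open>Disjoint unions of copies\<close>

definition semicomplete :: "'a bstruct \<Rightarrow> bool" where
  "semicomplete X \<longleftrightarrow> (\<forall>x\<in>carr X. \<forall>y\<in>carr X. x \<noteq> y \<longrightarrow> (x, y) \<in> brel X \<or> (y, x) \<in> brel X)"

lemma semicomplete_enlargement: "semicomplete (enlargement X)"
  by (auto simp: semicomplete_def enlargement_def)

lemma copies_union_simps [simp]:
  "carr (copies_union \<kappa> T) = Field \<kappa> \<times> carr T"
  "((i, x), (j, y)) \<in> brel (copies_union \<kappa> T) \<longleftrightarrow> i = j \<and> i \<in> Field \<kappa> \<and> (x, y) \<in> brel T"
  by (auto simp: copies_union_def)

lemma copies_union_reindex:
  assumes s: "bij_betw \<sigma> (Field \<kappa>) (Field \<mu>)" and f: "bs_iso f T T'"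
  shows "bs_iso (\<lambda>(i, x). (\<sigma> i, f x)) (copies_union \<kappa> T) (copies_union \<mu> T')"
proof -
  have f': "bij_betw f (carr T) (carr T')" using f by (simp add: bs_iso_def)
  have "bij_betw (\<lambda>(i, x). (\<sigma> i, f x)) (Field \<kappa> \<times> carr T) (Field \<mu> \<times> carr T')"
    using bij_betw_map_prod[OF s f'] by (simp add: map_prod_def)
  moreover have "\<sigma> i = \<sigma> j \<longleftrightarrow> i = j" if "i \<in> Field \<kappa>" "j \<in> Field \<kappa>" for i j
    using s that by (metis bij_betw_inv_into_left)
  ultimately show ?thesis
    using f bij_betwE[OF s] unfolding bs_iso_def by auto
qed

text \<open>In a union of semicomplete parts, lying in the same part can be read off from the relation. This is
  what forces self-embeddings to respect the parts.\<close>

lemma adjacent_iff_same_copy: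
  assumes "semicomplete T" "p \<in> Field \<kappa> \<times> carr T" "q \<in> Field \<kappa> \<times> carr T"
  shows "fst p = fst q \<longleftrightarrow>
    p = q \<or> (p, q) \<in> brel (copies_union \<kappa> T) \<or> (q, p) \<in> brel (copies_union \<kappa> T)"
  using assms by (cases p, cases q) (auto simp: semicomplete_def)

text \<open>A self-embedding of the union induces an injection of the index set, whose range is the domain of the
  image, and restricts on each part to an embedding of that part. Conversely, a bijection between the
  index sets and isomorphisms between the parts can be glued together. With a single index nothing has
  to be respected, so that \<open>T\<close> may be arbitrary then.\<close>

lemma copies_copies_union:
  assumes T: "carr T \<noteq> {}" and conn: "(\<exists>i. Field \<kappa> = {i}) \<or> semicomplete T"
  shows "A \<in> copies (copies_union \<kappa> T) \<longleftrightarrow> A \<subseteq> Field \<kappa> \<times> carr T \<and>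
    |Domain A| =o |Field \<kappa>| \<and> (\<forall>i\<in>Domain A. A `` {i} \<in> copies T)"
proof (cases "A \<subseteq> Field \<kappa> \<times> carr T")
  case False
  then show ?thesis by (simp add: in_copies_iff)
next
  case A: True
  let ?U = "copies_union \<kappa> T"
  have slice: "A `` {i} \<subseteq> carr T" for i using A by auto
  show ?thesis
  proof
    assume "A \<in> copies ?U"
    then obtain g where g: "bs_iso g ?U (substructure ?U A)" unfolding in_copies_iff by auto
    then have g': "bij_betw g (Field \<kappa> \<times> carr T) A \<and> (\<forall>p\<in>Field \<kappa> \<times> carr T. \<forall>q\<in>Field \<kappa> \<times> carr T.
        (p, q) \<in> brel ?U \<longleftrightarrow> (g p, g q) \<in> brel ?U)"
      unfolding bs_iso_substructure_iff copies_union_simps(1) .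
    have bij: "bij_betw g (Field \<kappa> \<times> carr T) A" by (rule conjunct1[OF g'])
    have rel: "(g p, g q) \<in> brel ?U \<longleftrightarrow> (p, q) \<in> brel ?U"
      if "p \<in> Field \<kappa> \<times> carr T" "q \<in> Field \<kappa> \<times> carr T" for p q
      by (rule bspec[OF bspec[OF conjunct2[OF g'] that(1)] that(2), symmetric])
    have gU: "g p \<in> Field \<kappa> \<times> carr T" if "p \<in> Field \<kappa> \<times> carr T" for p
      using bij_betwE[OF bij] A that by auto
    have inj: "g p = g q \<longleftrightarrow> p = q" if "p \<in> Field \<kappa> \<times> carr T" "q \<in> Field \<kappa> \<times> carr T" for p q
      using bij that by (metis bij_betw_inv_into_left)
    have same: "fst (g p) = fst (g q) \<longleftrightarrow> fst p = fst q"
      if pq: "p \<in> Field \<kappa> \<times> carr T" "q \<in> Field \<kappa> \<times> carr T" for p q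
      using conn
    proof
      assume "\<exists>i. Field \<kappa> = {i}"
      then show ?thesis using pq gU[OF pq(1)] gU[OF pq(2)] by auto
    next
      assume s: "semicomplete T"
      show ?thesis
        using adjacent_iff_same_copy[OF s pq] adjacent_iff_same_copy[OF s gU[OF pq(1)] gU[OF pq(2)]]
          rel[OF pq] rel[OF pq(2,1)] inj[OF pq] by simp
    qed
    obtain t where t: "t \<in> carr T" using T by auto
    \<comment> \<open>The induced map on indices; by \<open>same\<close> it does not depend on the point \<open>t\<close>.\<close>
    define \<sigma> where "\<sigma> i = fst (g (i, t))" for i
    have fg: "fst (g (i, x)) = \<sigma> i" if "i \<in> Field \<kappa>" "x \<in> carr T" for i x
      using same[of "(i, x)" "(i, t)"] that t by (simp add: \<sigma>_def)
    have s_inj: "inj_on \<sigma> (Field \<kappa>)"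
    proof (rule inj_onI)
      fix i j assume "i \<in> Field \<kappa>" "j \<in> Field \<kappa>" "\<sigma> i = \<sigma> j"
      then show "i = j" using same[of "(i, t)" "(j, t)"] t by (simp add: \<sigma>_def)
    qed
    have A_eq: "A = g ` (Field \<kappa> \<times> carr T)" using bij by (simp add: bij_betw_def)
    have "\<sigma> ` Field \<kappa> = Domain A"
    proof
      have "g (i, t) \<in> A" if "i \<in> Field \<kappa>" for i using A_eq that t by simp
      then show "\<sigma> ` Field \<kappa> \<subseteq> Domain A" unfolding \<sigma>_def by (auto simp: Domain_fst)
      show "Domain A \<subseteq> \<sigma> ` Field \<kappa>"
        unfolding Domain_fst A_eq using fg by auto
    qed
    with s_inj have "bij_betw \<sigma> (Field \<kappa>) (Domain A)" by (simp add: bij_betw_def)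
    then have "|Domain A| =o |Field \<kappa>|" using card_of_ordIso ordIso_symmetric by blast
    moreover have "A `` {j} \<in> copies T" if j: "j \<in> Domain A" for j
    proof -
      have "j \<in> \<sigma> ` Field \<kappa>" using j \<open>\<sigma> ` Field \<kappa> = Domain A\<close> by simp
      then obtain i where i: "i \<in> Field \<kappa>" "j = \<sigma> i" by auto
      define h where "h x = snd (g (i, x))" for x
      have gh: "g (i, x) = (j, h x)" if "x \<in> carr T" for x
        using fg[OF i(1) that] i(2) by (metis h_def prod.collapse)
      have "bs_iso h T (substructure T (A `` {j}))"
        unfolding bs_iso_substructure_iff
      proof (intro conjI ballI)
        show "bij_betw h (carr T) (A `` {j})"
        proof (rule bij_betw_imageI)
          show "inj_on h (carr T)"
          proof (rule inj_onI)
            fix x y assume xy: "x \<in> carr T" "y \<in> carr T" "h x = h y"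
            then have "g (i, x) = g (i, y)" using gh by simp
            then show "x = y" using inj[of "(i, x)" "(i, y)"] xy i(1) by simp
          qed
          show "h ` carr T = A `` {j}"
          proof (intro set_eqI iffI)
            fix y assume "y \<in> h ` carr T"
            then obtain x where "x \<in> carr T" "y = h x" by auto
            then have "(j, y) \<in> A" using gh[of x] A_eq i(1) by (metis image_eqI mem_Sigma_iff)
            then show "y \<in> A `` {j}" by simp
          next
            fix y assume "y \<in> A `` {j}"
            then obtain k x where kx: "k \<in> Field \<kappa>" "x \<in> carr T" "g (k, x) = (j, y)"
              unfolding A_eq by auto
            then have "\<sigma> k = \<sigma> i" using fg[OF kx(1,2)] i(2) by simp
            then have "k = i" using s_inj kx(1) i(1) by (simp add: inj_on_eq_iff)
            then show "y \<in> h ` carr T" using gh[OF kx(2)] kx(2,3) by (auto intro: rev_image_eqI)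
          qed
        qed
        fix x y assume xy: "x \<in> carr T" "y \<in> carr T"
        show "(x, y) \<in> brel T \<longleftrightarrow> (h x, h y) \<in> brel T"
          using rel[of "(i, x)" "(i, y)"] xy i(1) gh gU[of "(i, x)"] by simp
      qed
      then show ?thesis using slice[of j] unfolding in_copies_iff by auto
    qed
    ultimately show "A \<subseteq> Field \<kappa> \<times> carr T \<and> |Domain A| =o |Field \<kappa>| \<and>
        (\<forall>i\<in>Domain A. A `` {i} \<in> copies T)" using A by simp
  next
    assume *: "A \<subseteq> Field \<kappa> \<times> carr T \<and> |Domain A| =o |Field \<kappa>| \<and>
        (\<forall>i\<in>Domain A. A `` {i} \<in> copies T)"
    then have "|Field \<kappa>| =o |Domain A|" by (simp add: ordIso_symmetric)
    then obtain \<sigma> where s: "bij_betw \<sigma> (Field \<kappa>) (Domain A)" unfolding card_of_ordIso[symmetric] by auto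
    have "\<forall>j\<in>Domain A. \<exists>h. bs_iso h T (substructure T (A `` {j}))"
      using * unfolding in_copies_iff by simp
    then obtain h where h: "\<And>j. j \<in> Domain A \<Longrightarrow> bs_iso (h j) T (substructure T (A `` {j}))"
      by metis
    then have hb: "bij_betw (h j) (carr T) (A `` {j})"
      and hr: "x \<in> carr T \<Longrightarrow> y \<in> carr T \<Longrightarrow> (h j x, h j y) \<in> brel T \<longleftrightarrow> (x, y) \<in> brel T"
      if "j \<in> Domain A" for j x y
      using that unfolding bs_iso_substructure_iff by simp_all
    have sD: "\<sigma> i \<in> Domain A" if "i \<in> Field \<kappa>" for i using bij_betwE[OF s] that by simp
    have s_inj: "\<sigma> i = \<sigma> j \<longleftrightarrow> i = j" if "i \<in> Field \<kappa>" "j \<in> Field \<kappa>" for i j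
      using s that by (metis bij_betw_inv_into_left)
    define g where "g p = (\<sigma> (fst p), h (\<sigma> (fst p)) (snd p))" for p
    have "bs_iso g ?U (substructure ?U A)"
      unfolding bs_iso_substructure_iff copies_union_simps(1)
    proof (intro conjI ballI)
      show "bij_betw g (Field \<kappa> \<times> carr T) A"
      proof (rule bij_betw_imageI)
        show "inj_on g (Field \<kappa> \<times> carr T)"
        proof (rule inj_onI, clarify)
          fix i x j y assume ij: "i \<in> Field \<kappa>" "x \<in> carr T" "j \<in> Field \<kappa>" "y \<in> carr T"
            and eq: "g (i, x) = g (j, y)"
          then have "i = j" using s_inj by (simp add: g_def)
          moreover from this have "h (\<sigma> i) x = h (\<sigma> i) y" using eq by (simp add: g_def)
          then have "x = y" using hb[OF sD[OF ij(1)]] ij unfolding bij_betw_def inj_on_def by simp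
          ultimately show "i = j \<and> x = y" by simp
        qed
        show "g ` (Field \<kappa> \<times> carr T) = A"
        proof (intro set_eqI iffI)
          fix p assume "p \<in> g ` (Field \<kappa> \<times> carr T)"
          then obtain i x where ix: "i \<in> Field \<kappa>" "x \<in> carr T" "p = g (i, x)" by auto
          then have "h (\<sigma> i) x \<in> A `` {\<sigma> i}" using bij_betwE[OF hb[OF sD[OF ix(1)]]] by simp
          then show "p \<in> A" using ix(3) by (simp add: g_def)
        next
          fix p assume p: "p \<in> A"
          obtain j y where jy: "p = (j, y)" by (cases p)
          then have j: "j \<in> Domain A" and y: "y \<in> A `` {j}" using p by auto
          have "j \<in> \<sigma> ` Field \<kappa>" using s j by (simp add: bij_betw_def)
          then obtain i where i: "i \<in> Field \<kappa>" "j = \<sigma> i" by auto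
          have "y \<in> h j ` carr T" using hb[OF j] y by (simp add: bij_betw_def)
          then obtain x where x: "x \<in> carr T" "y = h j x" by auto
          have "p = g (i, x)" using jy i x by (simp add: g_def)
          then show "p \<in> g ` (Field \<kappa> \<times> carr T)" using i(1) x(1) by simp
        qed
      qed
      fix p q assume "p \<in> Field \<kappa> \<times> carr T" "q \<in> Field \<kappa> \<times> carr T"
      then obtain i x j y where pq: "p = (i, x)" "q = (j, y)"
        and ij: "i \<in> Field \<kappa>" "x \<in> carr T" "j \<in> Field \<kappa>" "y \<in> carr T" by auto
      have "\<sigma> i \<in> Field \<kappa>" using sD[OF ij(1)] A by auto
      then show "(p, q) \<in> brel ?U \<longleftrightarrow> (g p, g q) \<in> brel ?U"
        using ij s_inj hr[OF sD[OF ij(1)]] by (auto simp: pq g_def)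
    qed
    then show "A \<in> copies ?U" using A unfolding in_copies_iff by auto
  qed
qed

section \<open>Components of ultrahomogeneous structures\<close>

lemma rst_basic:
  shows rst_refl: "x \<in> carr X \<Longrightarrow> (x, x) \<in> rst X"
    and rst_sym: "(x, y) \<in> rst X \<Longrightarrow> (y, x) \<in> rst X"
    and rst_trans: "(x, y) \<in> rst X \<Longrightarrow> (y, z) \<in> rst X \<Longrightarrow> (x, z) \<in> rst X"
    and rst_brel: "(x, y) \<in> brel X \<Longrightarrow> (x, y) \<in> rst X"
proof -
  let ?R = "Id_on (carr X) \<union> brel X \<union> (brel X)\<inverse>"
  show "x \<in> carr X \<Longrightarrow> (x, x) \<in> rst X" "(x, y) \<in> brel X \<Longrightarrow> (x, y) \<in> rst X"
    unfolding rst_def by (simp_all add: Id_onI r_into_trancl')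
  have "sym ?R" by (auto simp: sym_def)
  then have "sym (rst X)" unfolding rst_def by (rule sym_trancl)
  then show "(x, y) \<in> rst X \<Longrightarrow> (y, x) \<in> rst X" by (rule symD)
  show "(x, y) \<in> rst X \<Longrightarrow> (y, z) \<in> rst X \<Longrightarrow> (x, z) \<in> rst X"
    unfolding rst_def by (rule trancl_trans)
qed

lemma rst_carr:
  assumes X: "binary_structure X" and xy: "(x, y) \<in> rst X"
  shows "x \<in> carr X" "y \<in> carr X"
proof -
  have "Id_on (carr X) \<union> brel X \<union> (brel X)\<inverse> \<subseteq> carr X \<times> carr X"
    using X by (auto simp: binary_structure_def)
  then have "rst X \<subseteq> carr X \<times> carr X" unfolding rst_def by (rule trancl_subset_Sigma)
  then show "x \<in> carr X" "y \<in> carr X" using xy by auto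
qed

lemma rst_induct [consumes 1, case_names carr refl step]:
  assumes "(x, y) \<in> rst X" and "x \<in> carr X" and "P x"
    and step: "\<And>y z. (x, y) \<in> rst X \<Longrightarrow> P y \<Longrightarrow> (y, z) \<in> brel X \<or> (z, y) \<in> brel X \<Longrightarrow> P z"
  shows "P y"
  using assms(1) unfolding rst_def
proof (induction rule: trancl_induct)
  case (base y)
  then consider "y = x" | "(x, y) \<in> brel X \<or> (y, x) \<in> brel X" by auto
  then show ?case
    using assms(3) step[OF rst_refl[OF assms(2)] assms(3), of y] by cases simp_all
next
  case (step y z)
  then consider "z = y" | "(y, z) \<in> brel X \<or> (z, y) \<in> brel X" by auto
  then show ?case
    using step(3) assms(4)[of y z] step(1) unfolding rst_def by cases simp_all
qed

lemma in_bs_components: "C \<in> bs_components X \<longleftrightarrow> (\<exists>z\<in>carr X. C = rst X `` {z})"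
  unfolding bs_components_def quotient_def by simp

lemma component_eq:
  assumes "C \<in> bs_components X" "x \<in> C"
  shows "C = rst X `` {x}"
proof -
  obtain z where z: "C = rst X `` {z}" using assms(1) by (auto simp: in_bs_components)
  then have "(z, x) \<in> rst X" using assms(2) by simp
  then have "(z, y) \<in> rst X \<longleftrightarrow> (x, y) \<in> rst X" for y using rst_sym rst_trans by metis
  then show ?thesis unfolding z by (simp add: set_eq_iff)
qed

lemma component_of: "x \<in> carr X \<Longrightarrow> rst X `` {x} \<in> bs_components X \<and> x \<in> rst X `` {x}"
  using rst_refl[of x X] by (auto simp: in_bs_components)

lemma component_nonempty: "C \<in> bs_components X \<Longrightarrow> \<exists>x\<in>carr X. x \<in> C"
  using rst_refl[of _ X] unfolding in_bs_components by auto

lemma component_subset: "binary_structure X \<Longrightarrow> C \<in> bs_components X \<Longrightarrow> C \<subseteq> carr X"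
  using rst_carr(2)[of X] unfolding in_bs_components by auto

lemma component_rst:
  assumes "C \<in> bs_components X" "x \<in> C"
  shows "y \<in> C \<longleftrightarrow> (x, y) \<in> rst X"
  using component_eq[OF assms] by auto

lemma components_eqI:
  assumes "C \<in> bs_components X" "D \<in> bs_components X" "x \<in> C" "x \<in> D"
  shows "C = D"
  using component_eq[OF assms(1,3)] component_eq[OF assms(2,4)] by simp

text \<open>It suffices to reach all points from one of them.\<close>

lemma bs_connectedI:
  assumes X: "binary_structure X" and x: "x \<in> carr X"
    and conn: "\<And>y. y \<in> carr X \<Longrightarrow> (x, y) \<in> rst X"
  shows "bs_connected X"
proof -
  have "C = rst X `` {x}" if C: "C \<in> bs_components X" for C
  proof -
    obtain y where y: "y \<in> carr X" "y \<in> C" using component_nonempty[OF C] by auto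
    then have "x \<in> C" using component_rst[OF C y(2)] rst_sym[OF conn[OF y(1)]] by simp
    then show ?thesis by (rule component_eq[OF C])
  qed
  then have "bs_components X = {rst X `` {x}}" using component_of[OF x] by auto
  then show ?thesis by (simp add: bs_connected_def)
qed

text \<open>Asymmetry leaves one of the pairs \<open>(x, y)\<close> and \<open>(y, x)\<close> to the complement, so the complement of a
  digraph is always connected once there is a point.\<close>

lemma biconnected_if_connected_digraph:
  assumes X: "digraph X" and c: "bs_connected X"
  shows "biconnected X"
proof -
  have ne: "bs_components X \<noteq> {}" using c by (auto simp: bs_connected_def)
  then obtain C where "C \<in> bs_components X" by auto
  from component_nonempty[OF this] obtain x where x: "x \<in> carr X" by auto
  have "bs_connected (bs_compl X)"
  proof (rule bs_connectedI)
    show "binary_structure (bs_compl X)" by (auto simp: binary_structure_def bs_compl_def)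
    show "x \<in> carr (bs_compl X)" using x by (simp add: bs_compl_def)
    fix y assume "y \<in> carr (bs_compl X)"
    then have y: "y \<in> carr X" by (simp add: bs_compl_def)
    have "(x, y) \<notin> brel X \<or> (y, x) \<notin> brel X" using X unfolding digraph_def by (auto dest: asymD)
    then have "(x, y) \<in> brel (bs_compl X) \<or> (y, x) \<in> brel (bs_compl X)"
      using x y by (auto simp: bs_compl_def)
    then show "(x, y) \<in> rst (bs_compl X)" using rst_brel rst_sym by metis
  qed
  with c show ?thesis by (simp add: biconnected_def)
qed

lemma rst_iso:
  assumes g: "bs_iso g X Y" and X: "binary_structure X" and xy: "(x, y) \<in> rst X"
  shows "(g x, g y) \<in> rst Y"
  using xy
proof (induction rule: rst_induct)
  show x: "x \<in> carr X" by (rule rst_carr[OF X xy])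
  have "g x \<in> carr Y" using g x unfolding bs_iso_def by (metis bij_betwE)
  then show "(g x, g x) \<in> rst Y" by (rule rst_refl)
next
  case (step y z)
  then have "y \<in> carr X" "z \<in> carr X" using X by (auto simp: binary_structure_def)
  then have "(g y, g z) \<in> brel Y \<or> (g z, g y) \<in> brel Y" using step g by (simp add: bs_iso_def)
  then show ?case using step rst_brel rst_sym rst_trans by metis
qed

lemma rst_iso_iff:
  assumes g: "bs_iso g X Y" and X: "binary_structure X" and Y: "binary_structure Y"
    and xy: "x \<in> carr X" "y \<in> carr X"
  shows "(g x, g y) \<in> rst Y \<longleftrightarrow> (x, y) \<in> rst X"
proof
  assume "(g x, g y) \<in> rst Y"
  from rst_iso[OF bs_iso_inv[OF g] Y this] show "(x, y) \<in> rst X"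
    using bij_betw_inv_into_left[OF conjunct1[OF g[unfolded bs_iso_def]]] xy by simp
qed (rule rst_iso[OF g X])

lemma image_component:
  assumes g: "bs_iso g X X" and X: "binary_structure X"
    and C: "C \<in> bs_components X" "x \<in> C" and D: "D \<in> bs_components X" "g x \<in> D"
  shows "g ` C = D"
proof (intro set_eqI iffI)
  have Cs: "C \<subseteq> carr X" by (rule component_subset[OF X C(1)])
  fix y
  {
    assume "y \<in> g ` C"
    then obtain z where z: "z \<in> C" "y = g z" by auto
    then have "(x, z) \<in> rst X" using component_rst[OF C] by simp
    then have "(g x, y) \<in> rst X" unfolding z(2) by (rule rst_iso[OF g X])
    then show "y \<in> D" using component_rst[OF D] by simp
  next
    assume y: "y \<in> D"
    then have "y \<in> carr X" using component_subset[OF X D(1)] by auto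
    then have "y \<in> g ` carr X" using g by (simp add: bs_iso_def bij_betw_def)
    then obtain z where z: "z \<in> carr X" "y = g z" by auto
    have "(g x, g z) \<in> rst X" using component_rst[OF D] y z(2) by simp
    then have "(x, z) \<in> rst X" using rst_iso_iff[OF g X X, of x z] C(2) Cs z(1) by auto
    then have "z \<in> C" using component_rst[OF C] by simp
    then show "y \<in> g ` C" using z(2) by simp
  }
qed

context
  fixes V :: "'a bstruct"
  assumes V: "binary_structure V" and irr: "irrefl (brel V)" and uh: "ultrahomogeneous V"
begin

text \<open>Since there are no loops, any two one-point substructures are isomorphic.\<close>

lemma moves_point:
  assumes "x \<in> carr V" "y \<in> carr V"
  shows "\<exists>g. bs_iso g V V \<and> g x = y"
proof -
  have "bs_iso (\<lambda>_. y) (substructure V {x}) (substructure V {y})"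
    using irr by (simp add: bs_iso_def irrefl_def)
  moreover have "{x} \<subseteq> carr V" "{y} \<subseteq> carr V" using assms by simp_all
  ultimately obtain g where "bs_iso g V V" "\<forall>z\<in>{x}. g z = y"
    using uh[unfolded ultrahomogeneous_def, rule_format, of "{x}" "{y}" "\<lambda>_. y"] by auto
  then show ?thesis by auto
qed

lemma components_isomorphic:
  assumes C: "C \<in> bs_components V" and D: "D \<in> bs_components V"
  shows "substructure V C \<cong>\<^sub>b substructure V D"
proof -
  obtain x y where x: "x \<in> C" "x \<in> carr V" and y: "y \<in> D" "y \<in> carr V"
    using component_nonempty[OF C] component_nonempty[OF D] by auto
  obtain g where g: "bs_iso g V V" "g x = y" using moves_point[OF x(2) y(2)] by auto
  have "g ` C = D" using image_component[OF g(1) V C x(1) D] g(2) y(1) by simp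
  then have "bs_iso g (substructure V C) (substructure V D)"
    using bs_iso_substructure[OF g(1) component_subset[OF V C]] by simp
  then show ?thesis unfolding isomorphic_def by metis
qed

text \<open>Unrelated points \<open>x, y\<close> of a component span the same structure as \<open>x\<close> and a point \<open>z\<close> of another
  component. An automorphism fixing \<open>x\<close> and moving \<open>y\<close> to \<open>z\<close> would not preserve connectedness.\<close>

lemma component_semicomplete:
  assumes C: "C \<in> bs_components V" and D: "D \<in> bs_components V" "D \<noteq> C"
  shows "semicomplete (substructure V C)"
  unfolding semicomplete_def
proof (intro ballI impI, rule ccontr)
  fix x y assume "x \<in> carr (substructure V C)" "y \<in> carr (substructure V C)" and ne: "x \<noteq> y"
  then have xC: "x \<in> C" and yC: "y \<in> C" by simp_all
  assume "\<not> ((x, y) \<in> brel (substructure V C) \<or> (y, x) \<in> brel (substructure V C))"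
  then have n: "(x, y) \<notin> brel V" "(y, x) \<notin> brel V" using xC yC by simp_all
  have xy: "x \<in> carr V" "y \<in> carr V" using component_subset[OF V C] xC yC by auto
  obtain z where z: "z \<in> D" "z \<in> carr V" using component_nonempty[OF D(1)] by auto
  have "(x, z) \<notin> rst V"
    using component_rst[OF C xC, of z] components_eqI[OF C D(1), of z] z(1) D(2) by auto
  then have nz: "(x, z) \<notin> brel V" "(z, x) \<notin> brel V" "x \<noteq> z"
    using rst_brel rst_sym rst_refl[OF xy(1)] by metis+
  let ?f = "\<lambda>v. if v = x then x else z"
  have "bs_iso ?f (substructure V {x, y}) (substructure V {x, z})"
    using irr ne n nz by (auto simp: bs_iso_def irrefl_def bij_betw_def inj_on_def)
  then obtain g where g: "bs_iso g V V" "\<forall>v\<in>{x, y}. g v = ?f v"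
    using uh[unfolded ultrahomogeneous_def, rule_format, of "{x, y}" "{x, z}" ?f] xy z(2) by auto
  have "(x, y) \<in> rst V" using component_rst[OF C xC] yC by simp
  then have "(g x, g y) \<in> rst V" by (rule rst_iso[OF g(1) V])
  then show False using g(2) ne \<open>(x, z) \<notin> rst V\<close> by simp
qed

text \<open>An automorphism that maps some point of a component into that component maps the component onto
  itself. The empty partial map has to be treated separately, because its extension to the whole
  structure may move the component away.\<close>

lemma component_ultrahomogeneous:
  assumes C: "C \<in> bs_components V"
  shows "ultrahomogeneous (substructure V C)"
  unfolding ultrahomogeneous_def
proof (intro allI impI, elim conjE)
  let ?Z = "substructure V C"
  have Cs: "C \<subseteq> carr V" by (rule component_subset[OF V C])
  fix A B f assume A: "A \<subseteq> carr ?Z" "finite A" and B: "B \<subseteq> carr ?Z" "finite B"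
    and f: "bs_iso f (substructure ?Z A) (substructure ?Z B)"
  have AC: "A \<subseteq> C" "B \<subseteq> C" using A B by simp_all
  have s: "substructure ?Z A = substructure V A" "substructure ?Z B = substructure V B"
    using AC by (auto simp: substructure_def)
  show "\<exists>g. bs_iso g ?Z ?Z \<and> (\<forall>x\<in>A. g x = f x)"
  proof (cases "A = {}")
    case True
    then show ?thesis using bs_iso_id[of ?Z] by (intro exI[of _ id]) simp
  next
    case False
    then obtain x where x: "x \<in> A" by auto
    have "f x \<in> B" using f x unfolding bs_iso_def by (auto dest: bij_betwE)
    obtain g where g: "bs_iso g V V" "\<forall>x\<in>A. g x = f x"
      using uh[unfolded ultrahomogeneous_def, rule_format, of A B f] A(2) B(2) AC Cs f s by auto
    have "g x \<in> C" using g(2) x \<open>f x \<in> B\<close> AC by auto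
    then have "g ` C = C" using image_component[OF g(1) V C subsetD[OF AC(1) x] C] by simp
    then have "bs_iso g ?Z ?Z" using bs_iso_substructure[OF g(1) Cs] by simp
    then show ?thesis using g(2) by metis
  qed
qed

lemma component_connected:
  assumes C: "C \<in> bs_components V"
  shows "bs_connected (substructure V C)"
proof -
  let ?Z = "substructure V C"
  obtain x where x: "x \<in> C" "x \<in> carr V" using component_nonempty[OF C] by auto
  show ?thesis
  proof (rule bs_connectedI)
    show "binary_structure ?Z" by (auto simp: binary_structure_def substructure_def)
    show xZ: "x \<in> carr ?Z" using x by simp
    fix y assume "y \<in> carr ?Z"
    then have "(x, y) \<in> rst V" using component_rst[OF C x(1)] by simp
    then show "(x, y) \<in> rst ?Z"
    proof (induction rule: rst_induct)
      show "x \<in> carr V" by (rule x(2))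
      show "(x, x) \<in> rst ?Z" using rst_refl[OF xZ] .
    next
      case (step y z)
      then have y: "y \<in> C" using component_rst[OF C x(1)] by simp
      have "(y, z) \<in> rst V" using step(2) rst_brel rst_sym by metis
      then have z: "z \<in> C" using component_rst[OF C y] by simp
      have "(y, z) \<in> brel ?Z \<or> (z, y) \<in> brel ?Z" using step(2) y z by simp
      then have "(y, z) \<in> rst ?Z" using rst_brel rst_sym by metis
      then show ?case using step(3) rst_trans by metis
    qed
  qed
qed

lemma decomposition:
  assumes C0: "C0 \<in> bs_components V"
  shows "V \<cong>\<^sub>b copies_union |bs_components V| (substructure V C0)"
proof -
  let ?K = "bs_components V" and ?Z = "substructure V C0"
  have "\<forall>C\<in>?K. \<exists>h. bs_iso h ?Z (substructure V C)"
    using components_isomorphic[OF C0] unfolding isomorphic_def by simp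
  then obtain h where h: "\<And>C. C \<in> ?K \<Longrightarrow> bs_iso (h C) ?Z (substructure V C)" by metis
  then have hb: "bij_betw (h C) C0 C" if "C \<in> ?K" for C
    using that unfolding bs_iso_def by simp
  have hr: "(h C x, h C y) \<in> brel V \<longleftrightarrow> (x, y) \<in> brel V" if "C \<in> ?K" "x \<in> C0" "y \<in> C0" for C x y
    using h[OF that(1)] that(2,3) bij_betwE[OF hb[OF that(1)]] unfolding bs_iso_def by simp
  have hC: "h C x \<in> C" if "C \<in> ?K" "x \<in> C0" for C x using bij_betwE[OF hb[OF that(1)]] that(2) by simp
  define g where "g p = h (fst p) (snd p)" for p
  have "bs_iso g (copies_union |?K| ?Z) V"
    unfolding bs_iso_def
  proof (intro conjI ballI)
    show "bij_betw g (carr (copies_union |?K| ?Z)) (carr V)"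
    proof (rule bij_betw_imageI)
      show "inj_on g (carr (copies_union |?K| ?Z))"
      proof (rule inj_onI)
        fix p q assume "p \<in> carr (copies_union |?K| ?Z)" "q \<in> carr (copies_union |?K| ?Z)"
        then obtain C x D y where pq: "p = (C, x)" "q = (D, y)" "C \<in> ?K" "x \<in> C0" "D \<in> ?K" "y \<in> C0"
          by (cases p, cases q) (simp add: Field_card_of)
        assume "g p = g q"
        then have eq: "h C x = h D y" by (simp add: g_def pq)
        then have "C = D" using components_eqI[OF pq(3,5)] hC[OF pq(3,4)] hC[OF pq(5,6)] by simp
        moreover from this have "x = y"
          using eq hb[OF pq(3)] pq(4,6) unfolding bij_betw_def inj_on_def by simp
        ultimately show "p = q" by (simp add: pq)
      qed
      show "g ` carr (copies_union |?K| ?Z) = carr V"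
      proof (intro set_eqI iffI)
        fix v assume "v \<in> g ` carr (copies_union |?K| ?Z)"
        then obtain C x where "C \<in> ?K" "x \<in> C0" "v = h C x" by (auto simp: g_def Field_card_of)
        then show "v \<in> carr V" using hC component_subset[OF V] by auto
      next
        fix v assume v: "v \<in> carr V"
        let ?C = "rst V `` {v}"
        have C: "?C \<in> ?K" "v \<in> ?C" using component_of[OF v] by simp_all
        have "v \<in> h ?C ` C0" using hb[OF C(1)] C(2) by (simp only: bij_betw_def)
        then obtain x where x: "x \<in> C0" "v = h ?C x" by auto
        then have "v = g (?C, x)" by (simp add: g_def)
        moreover have "(?C, x) \<in> carr (copies_union |?K| ?Z)" using C(1) x(1) by (simp add: Field_card_of)
        ultimately show "v \<in> g ` carr (copies_union |?K| ?Z)" by (rule image_eqI)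
      qed
    qed
    fix p q assume "p \<in> carr (copies_union |?K| ?Z)" "q \<in> carr (copies_union |?K| ?Z)"
    then obtain C x D y where pq: "p = (C, x)" "q = (D, y)" "C \<in> ?K" "x \<in> C0" "D \<in> ?K" "y \<in> C0"
      by (cases p, cases q) (simp add: Field_card_of)
    show "(p, q) \<in> brel (copies_union |?K| ?Z) \<longleftrightarrow> (g p, g q) \<in> brel V"
    proof (cases "C = D")
      case True
      then show ?thesis using hr[OF pq(3), of x y] pq by (simp add: g_def Field_card_of)
    next
      case False
      have "(h C x, h D y) \<notin> brel V"
      proof
        assume "(h C x, h D y) \<in> brel V"
        then have "(h C x, h D y) \<in> rst V" by (rule rst_brel)
        then have "h D y \<in> C" using component_rst[OF pq(3) hC[OF pq(3,4)]] by simp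
        then show False using components_eqI[OF pq(3,5)] hC[OF pq(5,6)] False by simp
      qed
      then show ?thesis using False by (simp add: g_def pq)
    qed
  qed
  then have "copies_union |?K| ?Z \<cong>\<^sub>b V" unfolding isomorphic_def by metis
  then show ?thesis by (rule isomorphic_sym)
qed

end

section \<open>Existence of a representation\<close>

text \<open>Between two distinct points of a semicomplete structure there are either one or both arrows. Keeping
  only the single arrows loses nothing, as the enlargement puts the double arrows back.\<close>

lemma digraph_asymmetric_part:
  fixes V :: "'a bstruct"
  assumes V: "binary_structure V" "irrefl (brel V)" and sc: "semicomplete V"
  defines "Y \<equiv> (carr V, brel V - (brel V)\<inverse>)"
  shows "digraph Y" "enlargement Y = V" "derived (\<lambda>e r s. r \<and> \<not> s) V Y"
proof -
  show "digraph Y"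
    using V unfolding digraph_def Y_def binary_structure_def
    by (auto intro!: irreflI asymI dest: irreflD)
  show "derived (\<lambda>e r s. r \<and> \<not> s) V Y" by (simp add: derived_def Y_def)
  have "brel (enlargement Y) = brel V"
  proof (rule set_eqI)
    fix p :: "'a \<times> 'a"
    obtain x y where p: "p = (x, y)" by (cases p)
    have "(x, y) \<in> brel V \<Longrightarrow> x \<in> carr V \<and> y \<in> carr V \<and> x \<noteq> y"
      using V unfolding binary_structure_def irrefl_def by auto
    then show "p \<in> brel (enlargement Y) \<longleftrightarrow> p \<in> brel V"
      unfolding p using sc by (auto simp: enlargement_def Y_def semicomplete_def)
  qed
  then show "enlargement Y = V"
    by (intro prod_eqI) (simp_all add: enlargement_def Y_def)
qed

lemma cone_ordLess_card_of: "x \<in> A \<Longrightarrow> y \<in> A \<Longrightarrow> x \<noteq> y \<Longrightarrow> cone <o |A|"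
  unfolding cone_def card_of_ordLess[symmetric] inj_on_def by auto

lemma disconnected_irreflexive_representation:
  fixes V :: "'a bstruct"
  assumes V: "binary_structure V" "irrefl (brel V)" "ultrahomogeneous V"
    and cnt: "countable (carr V)" and ne: "carr V \<noteq> {}" and dis: "\<not> bs_connected V"
  shows "\<exists>(Y :: 'a bstruct) (\<kappa> :: nat rel). digraph Y \<and> ultrahomogeneous Y \<and> Card_order \<kappa> \<and>
    cone <o \<kappa> \<and> V \<cong>\<^sub>b copies_union \<kappa> (enlargement Y)"
proof -
  let ?K = "bs_components V"
  obtain x where "x \<in> carr V" using ne by auto
  then obtain C0 where C0: "C0 \<in> ?K" using component_of[of x V] by auto
  obtain D where D: "D \<in> ?K" "D \<noteq> C0"
  proof (rule ccontr)
    assume "\<not> thesis"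
    then have "?K = {C0}" using that C0 by auto
    then show False using dis by (simp add: bs_connected_def)
  qed
  let ?Z = "substructure V C0"
  define Y where "Y = (carr ?Z, brel ?Z - (brel ?Z)\<inverse>)"
  have Z: "binary_structure ?Z" "irrefl (brel ?Z)"
    using V(2) by (auto simp: binary_structure_def substructure_def irrefl_def)
  have sc: "semicomplete ?Z" by (rule component_semicomplete[OF V C0 D])
  note Y = digraph_asymmetric_part[OF Z sc, folded Y_def]
  have "derived (\<lambda>e r s. r \<or> (\<not> e \<and> \<not> r \<and> \<not> s)) Y ?Z"
    using derived_enlargement[of Y] unfolding Y(2) .
  then have uh: "ultrahomogeneous Y"
    by (rule ultrahomogeneous_derived[OF Y(3) _ component_ultrahomogeneous[OF V C0]])
  have "?K \<subseteq> (\<lambda>x. rst V `` {x}) ` carr V" by (auto simp: in_bs_components)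
  then have "countable ?K" using cnt by (meson countable_image countable_subset)
  then obtain e :: "'a set \<Rightarrow> nat" where e: "inj_on e ?K" by (rule countableE)
  then have bij: "bij_betw e (Field |?K| ) (Field |e ` ?K| )" by (simp add: Field_card_of bij_betw_def)
  have "copies_union |?K| ?Z \<cong>\<^sub>b copies_union |e ` ?K| ?Z"
    using copies_union_reindex[OF bij bs_iso_id[of ?Z]] unfolding isomorphic_def by metis
  then have "V \<cong>\<^sub>b copies_union |e ` ?K| (enlargement Y)"
    using isomorphic_trans[OF decomposition[OF V C0]] unfolding Y(2) by metis
  moreover have "e C0 \<noteq> e D" using e C0 D by (auto simp: inj_on_eq_iff)
  then have "cone <o |e ` ?K|" using C0 D(1) by (intro cone_ordLess_card_of[of "e C0" _ "e D"]) auto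
  moreover have "Card_order |e ` ?K|" by (rule card_of_Card_order)
  ultimately show ?thesis using Y(1) uh by metis
qed

text \<open>The irreflexive part \<open>V\<close> of \<open>W\<close> has the same components, and \<open>W\<close> is either \<open>V\<close> or its
  reflexification.\<close>

lemma disconnected_representation:
  fixes W :: "'a bstruct"
  assumes W: "binary_structure W" "ultrahomogeneous W" and rf: "reflexive_bs W \<or> irreflexive_bs W"
    and cnt: "countable (carr W)" and ne: "carr W \<noteq> {}" and dis: "\<not> bs_connected W"
  shows "\<exists>(Y :: 'a bstruct) (\<kappa> :: nat rel). digraph Y \<and> ultrahomogeneous Y \<and> Card_order \<kappa> \<and>
    cone <o \<kappa> \<and> (irreflexive_bs W \<longrightarrow> W \<cong>\<^sub>b copies_union \<kappa> (enlargement Y)) \<and>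
    (\<not> irreflexive_bs W \<longrightarrow> W \<cong>\<^sub>b reflexification (copies_union \<kappa> (enlargement Y)))"
proof -
  define V where "V = (carr W, brel W - Id)"
  have c: "carr V = carr W" by (simp add: V_def)
  have irr: "irrefl (brel V)" by (auto simp: V_def irrefl_def)
  have bin: "binary_structure V" using W(1) by (auto simp: V_def binary_structure_def)
  have WV: "derived (\<lambda>e r s. r \<and> \<not> e) W V" by (simp add: derived_def V_def)
  have VW: "derived (\<lambda>e r s. if irreflexive_bs W then r else r \<or> e) V W"
    using rf unfolding derived_def V_def reflexive_bs_def irreflexive_bs_def
    by (auto simp: refl_on_def irrefl_def)
  have uh: "ultrahomogeneous V" by (rule ultrahomogeneous_derived[OF WV VW W(2)])
  have "Id_on (carr V) \<union> brel V \<union> (brel V)\<inverse> = Id_on (carr W) \<union> brel W \<union> (brel W)\<inverse>"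
    using W(1) by (auto simp: V_def binary_structure_def)
  then have "rst V = rst W" by (simp add: rst_def)
  then have "\<not> bs_connected V" using dis by (simp add: bs_connected_def bs_components_def c)
  with disconnected_irreflexive_representation[OF bin irr uh] cnt ne
  obtain Y :: "'a bstruct" and \<kappa> :: "nat rel" where
    Y: "digraph Y" "ultrahomogeneous Y" "Card_order \<kappa>" "cone <o \<kappa>"
    and iso: "V \<cong>\<^sub>b copies_union \<kappa> (enlargement Y)" unfolding c by metis
  let ?U = "copies_union \<kappa> (enlargement Y)"
  obtain f where f: "bs_iso f V ?U" using iso unfolding isomorphic_def by auto
  have "W \<cong>\<^sub>b ?U" if i: "irreflexive_bs W"
  proof -
    have U: "derived (\<lambda>e r s. r) ?U ?U" by (simp add: derived_def)
    have "derived (\<lambda>e r s. r) V W" using VW i by simp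
    then have "bs_iso f W ?U" by (rule derived_iso[OF _ U f])
    then show ?thesis unfolding isomorphic_def by metis
  qed
  moreover have "W \<cong>\<^sub>b reflexification ?U" if i: "\<not> irreflexive_bs W"
  proof -
    have U: "derived (\<lambda>e r s. r \<or> e) ?U (reflexification ?U)"
      by (auto simp: derived_def reflexification_def)
    have "derived (\<lambda>e r s. r \<or> e) V W" using VW i by simp
    then have "bs_iso f W (reflexification ?U)" by (rule derived_iso[OF _ U f])
    then show ?thesis unfolding isomorphic_def by metis
  qed
  ultimately show ?thesis using Y by metis
qed

lemma representation_exists:
  fixes X :: "'a bstruct"
  assumes X: "binary_structure X" "countable (carr X)" "carr X \<noteq> {}"
    and rf: "reflexive_bs X \<or> irreflexive_bs X" and uh: "ultrahomogeneous X"
    and nb: "\<not> biconnected X"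
  shows "\<exists>(Y :: 'a bstruct) (\<kappa> :: nat rel). represents Y \<kappa> X"
proof (cases "bs_connected X")
  case False
  from disconnected_representation[OF X(1) uh rf X(2,3) False]
  show ?thesis unfolding represents_def Let_def by metis
next
  case True
  let ?W = "bs_compl X"
  have c: "carr ?W = carr X" by (simp add: bs_compl_def)
  have dis: "\<not> bs_connected ?W" using True nb by (simp add: biconnected_def)
  have bin: "binary_structure ?W" by (auto simp: binary_structure_def bs_compl_def)
  have uhW: "ultrahomogeneous ?W" by (rule ultrahomogeneous_derived[OF derived_bs_compl uh])
  have rfW: "reflexive_bs ?W \<or> irreflexive_bs ?W"
    using rf X(1) unfolding reflexive_bs_def irreflexive_bs_def bs_compl_def
    by (auto simp: refl_on_def irrefl_def)
  obtain Y :: "'a bstruct" and \<kappa> :: "nat rel" where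
    Y: "digraph Y" "ultrahomogeneous Y" "Card_order \<kappa>" "cone <o \<kappa>"
    and iso: "?W \<cong>\<^sub>b copies_union \<kappa> (enlargement Y) \<or>
      ?W \<cong>\<^sub>b reflexification (copies_union \<kappa> (enlargement Y))"
    using disconnected_representation[OF bin uhW rfW _ _ dis] X(2,3) unfolding c by metis
  have compl: "X \<cong>\<^sub>b bs_compl T" if "?W \<cong>\<^sub>b T" for T :: "(nat \<times> 'a) bstruct"
    using that derived_iso[OF derived_bs_compl(2)[of X] derived_bs_compl(1)[of T]]
    unfolding isomorphic_def by metis
  show ?thesis using Y iso compl unfolding represents_def Let_def by metis
qed

section \<open>Copies in represented structures\<close>

text \<open>The four structures in the definition of a representation have the same copies, since each of them
  and the disjoint union can be derived from each other.\<close>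

lemma represents_copies:
  fixes Y :: "'b bstruct" and \<kappa> :: "'i rel"
  assumes "represents Y \<kappa> X"
  shows "\<exists>f. bij_betw f (carr X) (Field \<kappa> \<times> carr Y) \<and>
    (\<forall>A\<subseteq>carr X. A \<in> copies X \<longleftrightarrow> f ` A \<in> copies (copies_union \<kappa> (enlargement Y)))"
proof -
  let ?U = "copies_union \<kappa> (enlargement Y)"
  have Y: "digraph Y" using assms by (simp add: represents_def)
  have cU: "carr ?U = Field \<kappa> \<times> carr Y" by (simp add: enlargement_def)
  have "irrefl (brel Y)" using Y by (simp add: digraph_def)
  then have irr: "irrefl (brel ?U)" by (auto simp: irrefl_def copies_union_def enlargement_def)
  have re: "copies (reflexification ?U) = copies ?U"
    by (rule copies_derived[OF derived_reflexification[OF irr]])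
  have co: "copies (bs_compl T) = copies T" for T :: "('i \<times> 'b) bstruct"
    by (rule copies_derived[OF derived_bs_compl])
  have cs: "carr (reflexification T) = carr T" "carr (bs_compl T) = carr T" for T :: "('i \<times> 'b) bstruct"
    by (simp_all add: reflexification_def bs_compl_def)
  obtain T where T: "X \<cong>\<^sub>b T" "copies T = copies ?U" "carr T = carr ?U"
  proof -
    have "X \<cong>\<^sub>b ?U \<or> X \<cong>\<^sub>b reflexification ?U \<or> X \<cong>\<^sub>b bs_compl ?U \<or> X \<cong>\<^sub>b bs_compl (reflexification ?U)"
      using assms by (simp add: represents_def Let_def)
    then show thesis
      using that re co cs by metis
  qed
  then obtain f where f: "bs_iso f X T" unfolding isomorphic_def by auto
  then have "bij_betw f (carr X) (Field \<kappa> \<times> carr Y)" unfolding bs_iso_def T(3) cU by simp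
  moreover have "\<forall>A\<subseteq>carr X. A \<in> copies X \<longleftrightarrow> f ` A \<in> copies ?U"
    using copies_iso[OF f] T(2) by simp
  ultimately show ?thesis by auto
qed

lemma copy_nonempty:
  assumes "carr Y \<noteq> {}" "B \<in> copies Y"
  shows "B \<noteq> {}"
proof -
  obtain f where "bs_iso f Y (substructure Y B)" using assms(2) unfolding in_copies_iff by auto
  then have "bij_betw f (carr Y) B" by (simp add: bs_iso_def)
  then show ?thesis using assms(1) by (auto simp: bij_betw_def)
qed

lemma copies_enlargement_union:
  assumes Y: "digraph Y" "carr Y \<noteq> {}"
  shows "A \<in> copies (copies_union \<kappa> (enlargement Y)) \<longleftrightarrow> A \<subseteq> Field \<kappa> \<times> carr Y \<and>
    |Domain A| =o |Field \<kappa>| \<and> (\<forall>i\<in>Domain A. A `` {i} \<in> copies Y)"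
proof -
  have c: "carr (enlargement Y) = carr Y" by (simp add: enlargement_def)
  show ?thesis
    using copies_copies_union[of "enlargement Y" \<kappa> A] Y(2) semicomplete_enlargement[of Y]
    unfolding c copies_enlargement[OF Y(1)] by simp
qed

text \<open>The digraph \<open>Y\<close> is replaced by the isomorphic union of copies of its component \<open>C0\<close>, and the
  description of copies in a union is applied on both levels. On the outer level the parts are
  enlargements and hence semicomplete; on the inner one they are semicomplete unless \<open>Y\<close> is
  connected.\<close>

lemma copies_two_level:
  fixes Y :: "'b bstruct" and \<kappa> :: "'i rel"
  assumes X: "represents Y \<kappa> X" and Y: "carr Y \<noteq> {}" and C0: "C0 \<in> bs_components Y"
  shows "\<exists>f. bij_betw f (carr X) (Field \<kappa> \<times> (bs_components Y \<times> C0)) \<and>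
    (\<forall>A\<subseteq>carr X. A \<in> copies X \<longleftrightarrow> |Domain (f ` A)| =o |Field \<kappa>| \<and>
      (\<forall>i\<in>Domain (f ` A). |Domain ((f ` A) `` {i})| =o |bs_components Y| \<and>
        (\<forall>C\<in>Domain ((f ` A) `` {i}). ((f ` A) `` {i}) `` {C} \<in> copies (substructure Y C0))))"
proof -
  let ?K = "bs_components Y" and ?Z = "substructure Y C0"
  let ?Y' = "copies_union |?K| ?Z"
  have dY: "digraph Y" and uY: "ultrahomogeneous Y" using X by (simp_all add: represents_def)
  then have Y3: "binary_structure Y" "irrefl (brel Y)" "ultrahomogeneous Y"
    by (simp_all add: digraph_def)
  obtain g where g: "bs_iso g Y ?Y'"
    using decomposition[OF Y3 C0] unfolding isomorphic_def by auto
  have dY': "digraph ?Y'"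
    using dY unfolding digraph_def
    by (auto simp: binary_structure_def irrefl_def copies_union_def substructure_def
        intro!: asymI dest: asymD)
  have cY': "carr ?Y' = ?K \<times> C0" by (simp add: Field_card_of)
  have ne: "C0 \<noteq> {}" using component_nonempty[OF C0] by auto
  have conn: "(\<exists>C. Field |?K| = {C}) \<or> semicomplete ?Z"
  proof (cases "?K = {C0}")
    case True
    then show ?thesis by (simp add: Field_card_of)
  next
    case False
    then obtain D where "D \<in> ?K" "D \<noteq> C0" using C0 by auto
    then show ?thesis using component_semicomplete[OF Y3 C0] by simp
  qed
  have Y'ne: "carr ?Y' \<noteq> {}" unfolding cY' using C0 ne by auto
  have ge: "bs_iso g (enlargement Y) (enlargement ?Y')"
    by (rule derived_iso[OF derived_enlargement derived_enlargement g])
  obtain f where f: "bij_betw f (carr X) (Field \<kappa> \<times> carr Y)"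
    "\<And>A. A \<subseteq> carr X \<Longrightarrow> A \<in> copies X \<longleftrightarrow> f ` A \<in> copies (copies_union \<kappa> (enlargement Y))"
    using represents_copies[OF X] by auto
  define G :: "'i \<times> 'b \<Rightarrow> _" where "G = (\<lambda>(i, x). (id i, g x))"
  have G: "bs_iso G (copies_union \<kappa> (enlargement Y)) (copies_union \<kappa> (enlargement ?Y'))"
    unfolding G_def by (rule copies_union_reindex[OF bij_betw_id ge])
  have cU: "carr (copies_union \<kappa> (enlargement Y)) = Field \<kappa> \<times> carr Y"
    "carr (copies_union \<kappa> (enlargement ?Y')) = Field \<kappa> \<times> carr ?Y'"
    by (simp_all add: enlargement_def)
  have bij: "bij_betw (G \<circ> f) (carr X) (Field \<kappa> \<times> carr ?Y')"
    by (rule bij_betw_trans[OF f(1) conjunct1[OF G[unfolded bs_iso_def cU]]])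
  have "A \<in> copies X \<longleftrightarrow> |Domain ((G \<circ> f) ` A)| =o |Field \<kappa>| \<and>
      (\<forall>i\<in>Domain ((G \<circ> f) ` A). |Domain (((G \<circ> f) ` A) `` {i})| =o |?K| \<and>
        (\<forall>C\<in>Domain (((G \<circ> f) ` A) `` {i}). (((G \<circ> f) ` A) `` {i}) `` {C} \<in> copies ?Z))"
    if A: "A \<subseteq> carr X" for A
  proof -
    let ?B = "(G \<circ> f) ` A"
    have fA: "f ` A \<subseteq> Field \<kappa> \<times> carr Y" using f(1) A unfolding bij_betw_def by auto
    have B: "?B \<subseteq> Field \<kappa> \<times> carr ?Y'" using bij A unfolding bij_betw_def by auto
    have "A \<in> copies X \<longleftrightarrow> ?B \<in> copies (copies_union \<kappa> (enlargement ?Y'))"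
      using f(2)[OF A] copies_iso[OF G, of "f ` A"] fA unfolding cU by (simp add: image_comp)
    also have "\<dots> \<longleftrightarrow> |Domain ?B| =o |Field \<kappa>| \<and> (\<forall>i\<in>Domain ?B. ?B `` {i} \<in> copies ?Y')"
      using copies_enlargement_union[OF dY' Y'ne, of ?B \<kappa>] B by simp
    also have "\<dots> \<longleftrightarrow> |Domain ?B| =o |Field \<kappa>| \<and>
      (\<forall>i\<in>Domain ?B. |Domain (?B `` {i})| =o |?K| \<and>
        (\<forall>C\<in>Domain (?B `` {i}). (?B `` {i}) `` {C} \<in> copies ?Z))"
    proof -
      have "?B `` {i} \<in> copies ?Y' \<longleftrightarrow> |Domain (?B `` {i})| =o |?K| \<and>
        (\<forall>C\<in>Domain (?B `` {i}). (?B `` {i}) `` {C} \<in> copies ?Z)" for i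
      proof -
        have "?B `` {i} \<subseteq> Field |?K| \<times> carr ?Z" using B by auto
        then show ?thesis using copies_copies_union[of ?Z "|?K|" "?B `` {i}"] ne conn
          by (simp add: Field_card_of)
      qed
      then show ?thesis by simp
    qed
    finally show ?thesis .
  qed
  then show ?thesis using bij unfolding cY' by (intro exI[of _ "G \<circ> f"] conjI allI impI)
qed

section \<open>Finitely many blocks\<close>

text \<open>If \<open>X\<close> is divided into \<open>n\<close> blocks, each in bijection with \<open>Z\<close>, and being a copy means having a copy
  of \<open>Z\<close> as the trace on each block, then a copy is the same as the tuple of its traces.\<close>

lemma copies_poset_power:
  assumes f: "bij_betw f (carr X) ({..<n} \<times> carr Z)"
    and cop: "\<And>A. A \<subseteq> carr X \<Longrightarrow> A \<in> copies X \<longleftrightarrow> (\<forall>k<n. (f ` A) `` {k} \<in> copies Z)"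
  shows "\<P> X \<cong>\<^sub>b poset_power (\<P> Z) n"
proof -
  define \<Phi> where "\<Phi> A = (\<lambda>k\<in>{..<n}. (f ` A) `` {k})" for A
  \<comment> \<open>\<open>\<Phi>\<close> takes the traces on the blocks, \<open>\<Psi>\<close> glues a tuple of traces together.\<close>
  define \<Psi> where "\<Psi> G = {x \<in> carr X. snd (f x) \<in> G (fst (f x))}" for G
  let ?C = "{..<n} \<rightarrow>\<^sub>E copies Z"
  have fX: "f x \<in> {..<n} \<times> carr Z" if "x \<in> carr X" for x using bij_betwE[OF f] that by simp
  have sub: "A \<subseteq> carr X" if "A \<in> copies X" for A using that by (simp add: copies_def)
  have inj: "f x = f y \<longleftrightarrow> x = y" if "x \<in> carr X" "y \<in> carr X" for x y
    using f that by (metis bij_betw_inv_into_left)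
  have mem: "x \<in> A \<longleftrightarrow> snd (f x) \<in> (f ` A) `` {fst (f x)}" if A: "A \<subseteq> carr X" and x: "x \<in> carr X" for A x
  proof -
    have "snd (f x) \<in> (f ` A) `` {fst (f x)} \<longleftrightarrow> f x \<in> f ` A" by simp
    also have "\<dots> \<longleftrightarrow> x \<in> A" using inj A x by (auto simp: image_iff subset_iff)
    finally show ?thesis by simp
  qed
  have \<Phi>C: "\<Phi> A \<in> ?C" if "A \<in> copies X" for A
    using cop[OF sub[OF that]] that by (simp add: \<Phi>_def)
  have \<Psi>\<Phi>: "\<Psi> (\<Phi> A) = A" if A: "A \<in> copies X" for A
  proof (rule set_eqI)
    fix x
    show "x \<in> \<Psi> (\<Phi> A) \<longleftrightarrow> x \<in> A"
    proof (cases "x \<in> carr X")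
      case True
      then have "fst (f x) < n" using fX[OF True] by (simp add: mem_Times_iff)
      then show ?thesis using mem[OF sub[OF A] True] True by (simp add: \<Psi>_def \<Phi>_def)
    next
      case False
      then show ?thesis using sub[OF A] by (auto simp: \<Psi>_def)
    qed
  qed
  have slice: "(f ` \<Psi> G) `` {k} = G k" if G: "G \<in> ?C" and k: "k < n" for G k
  proof (rule set_eqI)
    fix z
    have Gk: "G k \<subseteq> carr Z" using G k by (auto simp: PiE_iff copies_def)
    have "z \<in> (f ` \<Psi> G) `` {k} \<longleftrightarrow> (\<exists>x\<in>carr X. snd (f x) \<in> G (fst (f x)) \<and> f x = (k, z))"
      by (auto simp: \<Psi>_def image_iff)
    also have "\<dots> \<longleftrightarrow> z \<in> G k"
    proof
      assume z: "z \<in> G k"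
      then have "(k, z) \<in> f ` carr X" using f k Gk by (auto simp: bij_betw_def)
      then obtain x where "x \<in> carr X" "f x = (k, z)" by auto
      then show "\<exists>x\<in>carr X. snd (f x) \<in> G (fst (f x)) \<and> f x = (k, z)" using z by (intro bexI[of _ x]) simp_all
    qed auto
    finally show "z \<in> (f ` \<Psi> G) `` {k} \<longleftrightarrow> z \<in> G k" .
  qed
  have \<Psi>C: "\<Psi> G \<in> copies X" if G: "G \<in> ?C" for G
  proof -
    have "\<Psi> G \<subseteq> carr X" by (auto simp: \<Psi>_def)
    moreover have "G k \<in> copies Z" if "k < n" for k using G that by (simp add: PiE_iff)
    ultimately show ?thesis using cop[of "\<Psi> G"] slice[OF G] by simp
  qed
  have \<Phi>\<Psi>: "\<Phi> (\<Psi> G) = G" if G: "G \<in> ?C" for G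
  proof (rule PiE_ext[OF \<Phi>C[OF \<Psi>C[OF G]] G])
    fix k assume "k \<in> {..<n}"
    then show "\<Phi> (\<Psi> G) k = G k" using slice[OF G, of k] by (simp add: \<Phi>_def)
  qed
  have ord: "A \<subseteq> B \<longleftrightarrow> (\<forall>k<n. \<Phi> A k \<subseteq> \<Phi> B k)" if AB: "A \<in> copies X" "B \<in> copies X" for A B
  proof
    assume "A \<subseteq> B"
    then show "\<forall>k<n. \<Phi> A k \<subseteq> \<Phi> B k" by (auto simp: \<Phi>_def)
  next
    assume *: "\<forall>k<n. \<Phi> A k \<subseteq> \<Phi> B k"
    show "A \<subseteq> B"
    proof
      fix x assume x: "x \<in> A"
      then have xX: "x \<in> carr X" using sub[OF AB(1)] by auto
      then have "fst (f x) < n" using fX[OF xX] by (simp add: mem_Times_iff)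
      then have "(f ` A) `` {fst (f x)} \<subseteq> (f ` B) `` {fst (f x)}" using * by (simp add: \<Phi>_def)
      from subsetD[OF this iffD1[OF mem[OF sub[OF AB(1)] xX] x]]
      show "x \<in> B" by (rule iffD2[OF mem[OF sub[OF AB(2)] xX]])
    qed
  qed
  have "bij_betw \<Phi> (copies X) ?C"
    by (rule bij_betw_byWitness[where f' = \<Psi>])
      (intro ballI image_subsetI \<Psi>\<Phi> \<Phi>\<Psi> \<Phi>C \<Psi>C; assumption)+
  moreover have "\<Phi> A k \<in> copies Z" if "A \<in> copies X" "k < n" for A k
    using \<Phi>C[OF that(1)] that(2) by (simp add: PiE_iff)
  ultimately have "bs_iso \<Phi> (\<P> X) (poset_power (\<P> Z) n)"
    unfolding bs_iso_def copies_poset_eq poset_power_def Let_def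
    using ord \<Phi>C by simp
  then show ?thesis unfolding isomorphic_def by auto
qed

lemma card_of_Domain_finite:
  assumes "finite I" "D \<subseteq> I"
  shows "|D| =o |I| \<longleftrightarrow> D = I"
proof
  assume "|D| =o |I|"
  then have "card D = card I" unfolding card_of_ordIso[symmetric] by (auto dest: bij_betw_same_card)
  then show "D = I" using card_subset_eq[OF assms] by simp
qed (simp add: card_of_refl)

text \<open>In a finite set only the whole set has full cardinality. So a copy meets all blocks \<open>(i, C)\<close>, and
  these are numbered by \<open>e\<close>. There are at least two of them as \<open>\<kappa> > 1\<close>.\<close>

lemma copies_poset_finite_case:
  fixes Y :: "'b bstruct" and \<kappa> :: "'i rel"
  assumes X: "represents Y \<kappa> X" and Y: "carr Y \<noteq> {}"
    and fk: "finite (Field \<kappa>)" and fc: "finite (bs_components Y)"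
  shows "\<exists>(Z :: 'b bstruct) n. digraph Z \<and> ultrahomogeneous Z \<and> biconnected Z \<and> n \<ge> 2 \<and>
    \<P> X \<cong>\<^sub>b poset_power (\<P> Z) n"
proof -
  let ?K = "bs_components Y"
  have dY: "digraph Y" and uY: "ultrahomogeneous Y" and ck: "Card_order \<kappa>" and k1: "cone <o \<kappa>"
    using X by (simp_all add: represents_def)
  have Y3: "binary_structure Y" "irrefl (brel Y)" "ultrahomogeneous Y"
    using dY uY by (simp_all add: digraph_def)
  obtain y where "y \<in> carr Y" using Y by auto
  then obtain C0 where C0: "C0 \<in> ?K" using component_of[of y Y] by auto
  let ?Z = "substructure Y C0"
  have Z: "digraph ?Z" "ultrahomogeneous ?Z" "biconnected ?Z"
  proof -
    show dZ: "digraph ?Z"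
      using dY unfolding digraph_def
      by (auto simp: binary_structure_def irrefl_def substructure_def intro!: asymI dest: asymD)
    show "ultrahomogeneous ?Z" by (rule component_ultrahomogeneous[OF Y3 C0])
    show "biconnected ?Z"
      by (rule biconnected_if_connected_digraph[OF dZ component_connected[OF Y3 C0]])
  qed
  obtain f where f: "bij_betw f (carr X) (Field \<kappa> \<times> (?K \<times> C0))"
    and cop: "\<And>A. A \<subseteq> carr X \<Longrightarrow> A \<in> copies X \<longleftrightarrow> |Domain (f ` A)| =o |Field \<kappa>| \<and>
      (\<forall>i\<in>Domain (f ` A). |Domain ((f ` A) `` {i})| =o |?K| \<and>
        (\<forall>C\<in>Domain ((f ` A) `` {i}). ((f ` A) `` {i}) `` {C} \<in> copies ?Z))"
    using copies_two_level[OF X Y C0] by auto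
  let ?J = "Field \<kappa> \<times> ?K"
  define n where "n = card ?J"
  have fJ: "finite ?J" using fk fc by simp
  obtain e where "bij_betw e ?J {0..<card ?J}" using ex_bij_betw_finite_nat[OF fJ] by (rule exE)
  then have e: "bij_betw e ?J {..<n}" by (simp add: n_def atLeast0LessThan)
  have e_inj: "e p = e q \<longleftrightarrow> p = q" if "p \<in> ?J" "q \<in> ?J" for p q
    using e that by (metis bij_betw_inv_into_left)
  define h :: "'i \<times> 'b set \<times> 'b \<Rightarrow> nat \<times> 'b"
    where "h p = (e (fst p, fst (snd p)), snd (snd p))" for p
  have h: "bij_betw h (Field \<kappa> \<times> (?K \<times> C0)) ({..<n} \<times> C0)"
  proof (rule bij_betw_imageI)
    show "inj_on h (Field \<kappa> \<times> (?K \<times> C0))"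
      by (rule inj_onI) (auto simp: h_def e_inj)
    show "h ` (Field \<kappa> \<times> (?K \<times> C0)) = {..<n} \<times> C0"
    proof (intro set_eqI iffI)
      fix p assume "p \<in> h ` (Field \<kappa> \<times> (?K \<times> C0))"
      then show "p \<in> {..<n} \<times> C0" using bij_betwE[OF e] by (auto simp: h_def)
    next
      fix p assume "p \<in> {..<n} \<times> C0"
      then obtain k z where p: "p = (k, z)" "k < n" "z \<in> C0" by auto
      then have "k \<in> e ` ?J" using e by (simp add: bij_betw_def)
      then obtain i C where "k = e (i, C)" "i \<in> Field \<kappa>" "C \<in> ?K" by auto
      then have "p = h (i, (C, z))" "(i, (C, z)) \<in> Field \<kappa> \<times> (?K \<times> C0)" using p by (simp_all add: h_def)
      then show "p \<in> h ` (Field \<kappa> \<times> (?K \<times> C0))" by (rule image_eqI)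
    qed
  qed
  have ne: "C0 \<noteq> {}" using component_nonempty[OF C0] by auto
  have "\<P> X \<cong>\<^sub>b poset_power (\<P> ?Z) n"
  proof (rule copies_poset_power)
    show "bij_betw (h \<circ> f) (carr X) ({..<n} \<times> carr ?Z)"
      using bij_betw_trans[OF f h] by simp
    fix A assume A: "A \<subseteq> carr X"
    let ?B = "f ` A"
    have B: "?B \<subseteq> Field \<kappa> \<times> (?K \<times> C0)" using A f by (auto simp: bij_betw_def)
    have slice: "((h \<circ> f) ` A) `` {e (i, C)} = (?B `` {i}) `` {C}" if iC: "i \<in> Field \<kappa>" "C \<in> ?K" for i C
    proof (rule set_eqI)
      fix z
      have "z \<in> ((h \<circ> f) ` A) `` {e (i, C)} \<longleftrightarrow> (e (i, C), z) \<in> h ` ?B" by (simp add: image_comp)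
      also have "\<dots> \<longleftrightarrow> (i, (C, z)) \<in> ?B"
      proof
        assume "(e (i, C), z) \<in> h ` ?B"
        then obtain p where p: "p \<in> ?B" "(e (i, C), z) = h p" by (rule imageE) simp
        obtain j D w where q: "p = (j, (D, w))" by (cases p) auto
        then have "(j, D) \<in> ?J" using p(1) B by auto
        then have "(i, C) = (j, D)" "z = w" using p(2) q iC e_inj[of "(i, C)" "(j, D)"] by (simp_all add: h_def)
        then show "(i, (C, z)) \<in> ?B" using p(1) q by simp
      next
        assume "(i, (C, z)) \<in> ?B"
        then have "h (i, (C, z)) \<in> h ` ?B" by (rule imageI)
        then show "(e (i, C), z) \<in> h ` ?B" by (simp add: h_def)
      qed
      finally show "z \<in> ((h \<circ> f) ` A) `` {e (i, C)} \<longleftrightarrow> z \<in> (?B `` {i}) `` {C}" by simp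
    qed
    have D1: "|Domain ?B| =o |Field \<kappa>| \<longleftrightarrow> Domain ?B = Field \<kappa>"
      by (rule card_of_Domain_finite[OF fk]) (use B in auto)
    have D2: "|Domain (?B `` {i})| =o |?K| \<longleftrightarrow> Domain (?B `` {i}) = ?K" for i
      by (rule card_of_Domain_finite[OF fc]) (use B in auto)
    have nonempty: "S \<noteq> {}" if "S \<in> copies ?Z" for S
      using copy_nonempty[OF _ that] ne by simp
    have "A \<in> copies X \<longleftrightarrow> (\<forall>i\<in>Field \<kappa>. \<forall>C\<in>?K. (?B `` {i}) `` {C} \<in> copies ?Z)"
    proof
      assume "A \<in> copies X"
      then show "\<forall>i\<in>Field \<kappa>. \<forall>C\<in>?K. (?B `` {i}) `` {C} \<in> copies ?Z"
        unfolding cop[OF A] D1 D2 by simp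
    next
      assume *: "\<forall>i\<in>Field \<kappa>. \<forall>C\<in>?K. (?B `` {i}) `` {C} \<in> copies ?Z"
      have **: "\<exists>z. (i, (C, z)) \<in> ?B" if "i \<in> Field \<kappa>" "C \<in> ?K" for i C
      proof -
        have "(?B `` {i}) `` {C} \<noteq> {}" using * that nonempty by simp
        then show ?thesis by auto
      qed
      have DB: "Domain ?B = Field \<kappa>"
      proof
        show "Domain ?B \<subseteq> Field \<kappa>" using B by auto
        show "Field \<kappa> \<subseteq> Domain ?B" using **[OF _ C0] by (meson DomainI subsetI)
      qed
      moreover have "Domain (?B `` {i}) = ?K" if "i \<in> Field \<kappa>" for i
      proof
        show "Domain (?B `` {i}) \<subseteq> ?K" using B by auto
        show "?K \<subseteq> Domain (?B `` {i})" using **[OF that] by (meson DomainI Image_singleton_iff subsetI)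
      qed
      ultimately show "A \<in> copies X" unfolding cop[OF A] D1 D2 using * by simp
    qed
    also have "\<dots> \<longleftrightarrow> (\<forall>p\<in>?J. ((h \<circ> f) ` A) `` {e p} \<in> copies ?Z)" using slice by auto
    also have "\<dots> \<longleftrightarrow> (\<forall>k\<in>e ` ?J. ((h \<circ> f) ` A) `` {k} \<in> copies ?Z)" by simp
    also have "\<dots> \<longleftrightarrow> (\<forall>k<n. ((h \<circ> f) ` A) `` {k} \<in> copies ?Z)"
      unfolding bij_betw_imp_surj_on[OF e] by (simp only: Ball_def lessThan_iff)
    finally show "A \<in> copies X \<longleftrightarrow> (\<forall>k<n. ((h \<circ> f) ` A) `` {k} \<in> copies ?Z)" .
  qed
  moreover have "n \<ge> 2"
  proof -
    have "\<not> |Field \<kappa>| \<le>o cone"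
      using ordLess_ordIso_trans[OF k1 ordIso_symmetric[OF card_of_Field_ordIso[OF ck]]]
        not_ordLess_ordLeq by blast
    then have "\<not> (\<exists>g. inj_on g (Field \<kappa>) \<and> g ` Field \<kappa> \<subseteq> {()})"
      unfolding cone_def card_of_ordLeq[symmetric] by simp
    then have "\<not> inj_on (\<lambda>_. ()) (Field \<kappa>)" by auto
    then obtain i j where "i \<in> Field \<kappa>" "j \<in> Field \<kappa>" "i \<noteq> j" by (auto simp: inj_on_def)
    then have "{i, j} \<times> {C0} \<subseteq> ?J" using C0 by simp
    then have "card ({i, j} \<times> {C0}) \<le> n" unfolding n_def by (rule card_mono[OF fJ])
    then show ?thesis using \<open>i \<noteq> j\<close> by (simp add: card_cartesian_product)
  qed
  ultimately show ?thesis using Z by metis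
qed

section \<open>Regular open sets and common dense families\<close>

lemma posetD:
  assumes "poset P"
  shows poset_refl: "p \<in> carr P \<Longrightarrow> (p, p) \<in> brel P"
    and poset_trans: "(p, q) \<in> brel P \<Longrightarrow> (q, r) \<in> brel P \<Longrightarrow> (p, r) \<in> brel P"
    and poset_carr1: "(p, q) \<in> brel P \<Longrightarrow> p \<in> carr P"
    and poset_carr2: "(p, q) \<in> brel P \<Longrightarrow> q \<in> carr P"
  using assms
  unfolding poset_def partial_order_on_def preorder_on_def binary_structure_def
  by (auto dest: refl_onD transD antisymD)

text \<open>The interior of the closure of \<open>U\<close>, in the topology of downward closed sets, consists of the points
  below which \<open>U\<close> is dense.\<close>

definition regular_open :: "'p bstruct \<Rightarrow> 'p set \<Rightarrow> bool" where
  "regular_open P U \<longleftrightarrow> U \<subseteq> carr P \<and> (\<forall>p\<in>U. \<forall>q. (q, p) \<in> brel P \<longrightarrow> q \<in> U) \<and>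
     (\<forall>p\<in>carr P. (\<forall>q. (q, p) \<in> brel P \<longrightarrow> (\<exists>r\<in>U. (r, q) \<in> brel P)) \<longrightarrow> p \<in> U)"

lemma boolean_completion_eq:
  assumes P: "poset P"
  shows "boolean_completion P = by_inclusion {U. regular_open P U}"
proof -
  have bin: "binary_structure P" using P by (simp add: poset_def)
  note op = openin_down_topology[OF bin]
  have top: "topspace (down_topology P) = carr P"
  proof
    show "topspace (down_topology P) \<subseteq> carr P"
      using op openin_topspace by blast
    have "openin (down_topology P) (carr P)"
      using op poset_carr1[OF P] by blast
    then show "carr P \<subseteq> topspace (down_topology P)" by (rule openin_subset)
  qed
  have cone_open: "openin (down_topology P) {q. (q, p) \<in> brel P}" for p
    using op poset_carr1[OF P] poset_trans[OF P] by auto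
  have cl: "down_topology P closure_of A = {p \<in> carr P. \<exists>r\<in>A. (r, p) \<in> brel P}" for A
  proof (rule set_eqI, rule iffI)
    fix p assume p: "p \<in> down_topology P closure_of A"
    then have pc: "p \<in> carr P" using top by (simp add: in_closure_of)
    then have "p \<in> {q. (q, p) \<in> brel P}" using poset_refl[OF P] by simp
    moreover have "\<exists>y\<in>A. y \<in> T" if "p \<in> T" "openin (down_topology P) T" for T
      using p that unfolding closure_of_def by simp
    ultimately have "\<exists>y\<in>A. y \<in> {q. (q, p) \<in> brel P}" using cone_open by metis
    with pc show "p \<in> {p \<in> carr P. \<exists>r\<in>A. (r, p) \<in> brel P}" by simp
  next
    fix p assume p: "p \<in> {p \<in> carr P. \<exists>r\<in>A. (r, p) \<in> brel P}"
    then have "\<exists>y\<in>A. y \<in> T" if "p \<in> T" "openin (down_topology P) T" for T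
      using that op[of T] by blast
    with p show "p \<in> down_topology P closure_of A"
      unfolding closure_of_def top by simp
  qed
  have int: "down_topology P interior_of B = {p \<in> carr P. \<forall>q. (q, p) \<in> brel P \<longrightarrow> q \<in> B}" for B
  proof (rule set_eqI, rule iffI)
    fix p assume "p \<in> down_topology P interior_of B"
    then obtain T where "openin (down_topology P) T" "p \<in> T" "T \<subseteq> B"
      unfolding interior_of_def by auto
    then show "p \<in> {p \<in> carr P. \<forall>q. (q, p) \<in> brel P \<longrightarrow> q \<in> B}"
      using op[of T] by blast
  next
    fix p assume p: "p \<in> {p \<in> carr P. \<forall>q. (q, p) \<in> brel P \<longrightarrow> q \<in> B}"
    then have "p \<in> {q. (q, p) \<in> brel P}" "{q. (q, p) \<in> brel P} \<subseteq> B"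
      using poset_refl[OF P] by auto
    then show "p \<in> down_topology P interior_of B"
      using cone_open[of p] unfolding interior_of_def by blast
  qed
  have int_cl: "p \<in> down_topology P interior_of (down_topology P closure_of A) \<longleftrightarrow>
      p \<in> carr P \<and> (\<forall>q. (q, p) \<in> brel P \<longrightarrow> (\<exists>r\<in>A. (r, q) \<in> brel P))" for A p
    unfolding cl int using poset_carr1[OF P] by blast
  have "A \<subseteq> carr P \<and> down_topology P interior_of (down_topology P closure_of A) = A
      \<longleftrightarrow> regular_open P A" (is "?L \<longleftrightarrow> ?R") for A
  proof
    assume A: ?L
    then have memA: "p \<in> A \<longleftrightarrow> p \<in> carr P \<and> (\<forall>q. (q, p) \<in> brel P \<longrightarrow> (\<exists>r\<in>A. (r, q) \<in> brel P))" for p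
      using int_cl[of p A] by simp
    have "q \<in> A" if "p \<in> A" "(q, p) \<in> brel P" for p q
      using that memA[of p] memA[of q] poset_carr1[OF P] poset_trans[OF P] by meson
    then show ?R unfolding regular_open_def using A memA by blast
  next
    assume R: ?R
    have "p \<in> A" if "p \<in> carr P \<and> (\<forall>q. (q, p) \<in> brel P \<longrightarrow> (\<exists>r\<in>A. (r, q) \<in> brel P))" for p
      using R that unfolding regular_open_def by simp
    moreover have "p \<in> carr P \<and> (\<forall>q. (q, p) \<in> brel P \<longrightarrow> (\<exists>r\<in>A. (r, q) \<in> brel P))"
      if "p \<in> A" for p
    proof (intro conjI allI impI)
      show "p \<in> carr P" using R that unfolding regular_open_def by (elim conjE subsetD)
      fix q assume "(q, p) \<in> brel P"
      then have "q \<in> A" "(q, q) \<in> brel P"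
        using R that poset_refl[OF P] poset_carr1[OF P] unfolding regular_open_def by auto
      then show "\<exists>r\<in>A. (r, q) \<in> brel P" by blast
    qed
    ultimately have "p \<in> down_topology P interior_of (down_topology P closure_of A) \<longleftrightarrow> p \<in> A" for p
      unfolding int_cl by (intro iffI)
    with R show ?L unfolding regular_open_def by (intro conjI set_eqI) (elim conjE)
  qed
  then show ?thesis unfolding boolean_completion_def by simp
qed

text \<open>Here \<open>d\<close> and \<open>e\<close> enumerate dense sets of two posets along the same index set \<open>N\<close>. A regular open set
  is determined by the indices of the points of the dense set that it contains, and \<open>transport\<close> forms
  the regular open set of the second poset with the same indices.\<close>

definition transport :: "'n set \<Rightarrow> ('n \<Rightarrow> 'p) \<Rightarrow> ('n \<Rightarrow> 'q) \<Rightarrow> 'q bstruct \<Rightarrow> 'p set \<Rightarrow> 'q set" where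
  "transport N d e Q U =
     {q \<in> carr Q. \<forall>q'. (q', q) \<in> brel Q \<longrightarrow> (\<exists>x\<in>N. (e x, q') \<in> brel Q \<and> d x \<in> U)}"

lemma transport:
  assumes P: "poset P" and Q: "poset Q"
    and dN: "d ` N \<subseteq> carr P" and eN: "e ` N \<subseteq> carr Q"
    and dense_d: "\<And>p. p \<in> carr P \<Longrightarrow> \<exists>x\<in>N. (d x, p) \<in> brel P"
    and dense_e: "\<And>q. q \<in> carr Q \<Longrightarrow> \<exists>x\<in>N. (e x, q) \<in> brel Q"
    and ord: "\<And>x y. x \<in> N \<Longrightarrow> y \<in> N \<Longrightarrow> (d x, d y) \<in> brel P \<longleftrightarrow> (e x, e y) \<in> brel Q"
    and U: "regular_open P U"
  shows regular_open_transport: "regular_open Q (transport N d e Q U)"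
    and transport_transport: "transport N e d P (transport N d e Q U) = U"
proof -
  let ?V = "transport N d e Q U"
  show "regular_open Q ?V"
    unfolding regular_open_def
  proof (intro conjI ballI allI impI)
    show "?V \<subseteq> carr Q" by (auto simp: transport_def)
  next
    fix p q assume "p \<in> ?V" "(q, p) \<in> brel Q"
    then show "q \<in> ?V" using poset_trans[OF Q] poset_carr1[OF Q] unfolding transport_def by blast
  next
    fix q assume q: "q \<in> carr Q" and *: "\<forall>q'. (q', q) \<in> brel Q \<longrightarrow> (\<exists>r\<in>?V. (r, q') \<in> brel Q)"
    show "q \<in> ?V" unfolding transport_def
    proof (intro CollectI conjI q allI impI)
      fix q' assume "(q', q) \<in> brel Q"
      then obtain r where r: "r \<in> ?V" "(r, q') \<in> brel Q" using * by blast
      moreover have "(r, r) \<in> brel Q" using r poset_refl[OF Q] poset_carr1[OF Q] by blast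
      ultimately obtain x where "x \<in> N" "(e x, r) \<in> brel Q" "d x \<in> U"
        unfolding transport_def by blast
      then show "\<exists>x\<in>N. (e x, q') \<in> brel Q \<and> d x \<in> U" using r poset_trans[OF Q] by blast
    qed
  qed
  have Udown: "(p, q) \<in> brel P \<Longrightarrow> q \<in> U \<Longrightarrow> p \<in> U" for p q
    using U unfolding regular_open_def by blast
  have Ureg: "p \<in> carr P \<Longrightarrow> (\<And>q. (q, p) \<in> brel P \<Longrightarrow> \<exists>r\<in>U. (r, q) \<in> brel P) \<Longrightarrow> p \<in> U" for p
    using U unfolding regular_open_def by blast
  \<comment> \<open>\<open>U\<close> and \<open>?V\<close> have the same indices, so that transporting back restores \<open>U\<close>.\<close>
  have trace: "e x \<in> ?V \<longleftrightarrow> d x \<in> U" if x: "x \<in> N" for x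
  proof
    assume dx: "d x \<in> U"
    show "e x \<in> ?V" unfolding transport_def
    proof (intro CollectI conjI allI impI)
      show "e x \<in> carr Q" using eN x by blast
      fix q' assume q': "(q', e x) \<in> brel Q"
      then obtain y where y: "y \<in> N" "(e y, q') \<in> brel Q" using dense_e poset_carr1[OF Q] by blast
      then have "(d y, d x) \<in> brel P" using ord[OF y(1) x] poset_trans[OF Q y(2) q'] by blast
      then show "\<exists>x\<in>N. (e x, q') \<in> brel Q \<and> d x \<in> U" using y Udown dx by blast
    qed
  next
    assume ex: "e x \<in> ?V"
    show "d x \<in> U"
    proof (rule Ureg)
      show "d x \<in> carr P" using dN x by blast
      fix p' assume p': "(p', d x) \<in> brel P"
      then obtain y where y: "y \<in> N" "(d y, p') \<in> brel P" using dense_d poset_carr1[OF P] by blast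
      then have "(e y, e x) \<in> brel Q" using ord[OF y(1) x] poset_trans[OF P y(2) p'] by blast
      then obtain z where z: "z \<in> N" "(e z, e y) \<in> brel Q" "d z \<in> U"
        using ex unfolding transport_def by blast
      then have "(d z, d y) \<in> brel P" using ord y by blast
      then show "\<exists>r\<in>U. (r, p') \<in> brel P" using z y poset_trans[OF P] by blast
    qed
  qed
  show "transport N e d P ?V = U"
  proof (rule set_eqI, rule iffI)
    fix p assume "p \<in> transport N e d P ?V"
    then have "p \<in> carr P"
      and *: "\<And>p'. (p', p) \<in> brel P \<Longrightarrow> \<exists>x\<in>N. (d x, p') \<in> brel P \<and> e x \<in> ?V"
      unfolding transport_def[of N e d P] by blast+
    show "p \<in> U"
    proof (rule Ureg[OF \<open>p \<in> carr P\<close>])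
      fix q assume "(q, p) \<in> brel P"
      then show "\<exists>r\<in>U. (r, q) \<in> brel P" using * trace by blast
    qed
  next
    fix p assume p: "p \<in> U"
    show "p \<in> transport N e d P ?V" unfolding transport_def[of N e d P]
    proof (intro CollectI conjI allI impI)
      show "p \<in> carr P" using U p unfolding regular_open_def by blast
      fix p' assume p': "(p', p) \<in> brel P"
      then obtain y where y: "y \<in> N" "(d y, p') \<in> brel P" using dense_d poset_carr1[OF P] by blast
      then have "d y \<in> U" using Udown[OF _ Udown[OF p' p]] by blast
      then have "e y \<in> ?V" using trace[OF y(1)] by simp
      with y show "\<exists>x\<in>N. (d x, p') \<in> brel P \<and> e x \<in> ?V" by (intro bexI[of _ y] conjI)
    qed
  qed
qed

lemma forcing_equivalent_if_common_dense:
  assumes P: "poset P" and Q: "poset Q"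
    and dN: "d ` N \<subseteq> carr P" and eN: "e ` N \<subseteq> carr Q"
    and dense_d: "\<And>p. p \<in> carr P \<Longrightarrow> \<exists>x\<in>N. (d x, p) \<in> brel P"
    and dense_e: "\<And>q. q \<in> carr Q \<Longrightarrow> \<exists>x\<in>N. (e x, q) \<in> brel Q"
    and ord: "\<And>x y. x \<in> N \<Longrightarrow> y \<in> N \<Longrightarrow> (d x, d y) \<in> brel P \<longleftrightarrow> (e x, e y) \<in> brel Q"
  shows "forcing_equivalent P Q"
proof -
  let ?f = "transport N d e Q" and ?g = "transport N e d P"
  have f: "regular_open Q (?f U)" "?g (?f U) = U" if "regular_open P U" for U
    by (rule regular_open_transport[OF P Q dN eN dense_d dense_e ord that]; assumption)
      (rule transport_transport[OF P Q dN eN dense_d dense_e ord that]; assumption)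
  have g: "regular_open P (?g V)" "?f (?g V) = V" if "regular_open Q V" for V
    by (rule regular_open_transport[OF Q P eN dN dense_e dense_d ord[symmetric] that]; assumption)
      (rule transport_transport[OF Q P eN dN dense_e dense_d ord[symmetric] that]; assumption)
  have mono_f: "?f U \<subseteq> ?f U'" if "U \<subseteq> U'" for U U'
    using that unfolding transport_def by blast
  have mono_g: "?g V \<subseteq> ?g V'" if "V \<subseteq> V'" for V V'
    using that unfolding transport_def by blast
  have bij: "bij_betw ?f {U. regular_open P U} {V. regular_open Q V}"
    by (rule bij_betw_byWitness[where f' = ?g]) (auto simp: f g)
  have ord_f: "U \<subseteq> U' \<longleftrightarrow> ?f U \<subseteq> ?f U'" if "regular_open P U" "regular_open P U'" for U U'
  proof
    assume "?f U \<subseteq> ?f U'"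
    then have "?g (?f U) \<subseteq> ?g (?f U')" by (rule mono_g)
    then show "U \<subseteq> U'" unfolding f(2)[OF that(1)] f(2)[OF that(2)] .
  qed (rule mono_f)
  have "bs_iso ?f (boolean_completion P) (boolean_completion Q)"
    unfolding bs_iso_def boolean_completion_eq[OF P] boolean_completion_eq[OF Q] by_inclusion_def
    using bij f(1) ord_f by simp
  then show ?thesis unfolding forcing_equivalent_def isomorphic_def by blast
qed

section \<open>Countably closed posets of size omega1\<close>

definition compatible :: "'p bstruct \<Rightarrow> 'p \<Rightarrow> 'p \<Rightarrow> bool" where
  "compatible P p q \<longleftrightarrow> (\<exists>r. (r, p) \<in> brel P \<and> (r, q) \<in> brel P)"

lemma compatible_sym: "compatible P p q \<longleftrightarrow> compatible P q p"
  by (auto simp: compatible_def)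

lemma compatible_mono:
  assumes "poset P" "(p', p) \<in> brel P" "(q', q) \<in> brel P" "compatible P p' q'"
  shows "compatible P p q"
proof -
  obtain r where "(r, p') \<in> brel P" "(r, q') \<in> brel P" using assms(4) by (auto simp: compatible_def)
  then show ?thesis
    using poset_trans[OF assms(1) _ assms(2)] poset_trans[OF assms(1) _ assms(3)]
    by (auto simp: compatible_def)
qed

definition splitting :: "'p bstruct \<Rightarrow> bool" where
  "splitting P \<longleftrightarrow>
     (\<forall>p\<in>carr P. \<exists>q r. (q, p) \<in> brel P \<and> (r, p) \<in> brel P \<and> \<not> compatible P q r)"

text \<open>Sequences of length \<open>\<omega>\<close> suffice: every countable chain has a coinitial such sequence.\<close>

definition countably_closed :: "'p bstruct \<Rightarrow> bool" where
  "countably_closed P \<longleftrightarrow>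
     (\<forall>p :: nat \<Rightarrow> 'p. (\<forall>n. p n \<in> carr P) \<longrightarrow> (\<forall>m n. m \<le> n \<longrightarrow> (p n, p m) \<in> brel P) \<longrightarrow>
       (\<exists>q\<in>carr P. \<forall>n. (q, p n) \<in> brel P))"

lemma countable_chain_bound:
  assumes P: "poset P" and "carr P \<noteq> {}" and cc: "countably_closed P"
    and C: "countable C" "C \<subseteq> carr P"
    and chain: "\<And>x y. x \<in> C \<Longrightarrow> y \<in> C \<Longrightarrow> (x, y) \<in> brel P \<or> (y, x) \<in> brel P"
  shows "\<exists>q\<in>carr P. \<forall>c\<in>C. (q, c) \<in> brel P"
proof (cases "C = {}")
  case True
  then show ?thesis using \<open>carr P \<noteq> {}\<close> by blast
next
  case False
  define c where "c = from_nat_into C"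
  have c: "c n \<in> C" for n unfolding c_def by (rule from_nat_into[OF False])
  \<comment> \<open>The running minimum of an enumeration of the chain.\<close>
  define p where "p = rec_nat (c 0) (\<lambda>n q. if (c (Suc n), q) \<in> brel P then c (Suc n) else q)"
  have pS: "p (Suc n) = (if (c (Suc n), p n) \<in> brel P then c (Suc n) else p n)" for n
    by (simp add: p_def)
  have pC: "p n \<in> C" for n
    by (induction n) (auto simp: pS c, simp add: p_def c)
  then have refl: "(p n, p n) \<in> brel P" for n using C poset_refl[OF P] by blast
  then have step: "(p (Suc n), p n) \<in> brel P" for n by (simp add: pS)
  have dec: "(p n, p m) \<in> brel P" if "m \<le> n" for m n
    using that
  proof (induction rule: dec_induct)
    case (step n)
    then show ?case using poset_trans[OF P \<open>\<And>n. (p (Suc n), p n) \<in> brel P\<close>] by blast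
  qed (rule refl)
  have pc: "(p n, c n) \<in> brel P" for n
  proof (cases n)
    case 0
    have "p 0 = c 0" by (simp add: p_def)
    then show ?thesis using 0 refl[of 0] by simp
  next
    case (Suc m)
    have "c n \<in> carr P" using c C by blast
    then show ?thesis
      using Suc chain[OF c[of n] pC[of m]] poset_refl[OF P] by (auto simp: pS)
  qed
  obtain q where q: "q \<in> carr P" "\<And>n. (q, p n) \<in> brel P"
    using cc pC C dec unfolding countably_closed_def by (metis subsetD)
  have "(q, x) \<in> brel P" if x: "x \<in> C" for x
  proof -
    obtain n where "x = c n" using from_nat_into_surj[OF C(1) x] c_def by metis
    then show ?thesis using poset_trans[OF P q(2) pc] by simp
  qed
  with q show ?thesis by blast
qed

lemma Card_order_omega1: "Card_order omega1"
  unfolding omega1_def by (rule cardSuc_Card_order[OF natLeq_Card_order])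

lemma Well_order_omega1: "Well_order omega1"
  using Card_order_omega1 by (rule card_order_on_well_order_on)

lemma countable_underS_omega1: "countable (underS omega1 \<gamma>)"
proof (cases "\<gamma> \<in> Field omega1")
  case True
  then have "|underS omega1 \<gamma>| <o omega1"
    by (rule card_of_underS[OF Card_order_omega1])
  then have "|underS omega1 \<gamma>| \<le>o natLeq"
    unfolding omega1_def
    using cardSuc_ordLeq_ordLess[OF natLeq_Card_order card_of_Card_order] by blast
  then have "|underS omega1 \<gamma>| \<le>o |UNIV :: nat set|"
    using ordLeq_ordIso_trans[OF _ ordIso_symmetric[OF card_of_nat]] by blast
  then show ?thesis
    unfolding card_of_ordLeq[symmetric] countable_def by blast
next
  case False
  then have "underS omega1 \<gamma> = {}" unfolding underS_def Field_def by blast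
  then show ?thesis by simp
qed

lemma omega1_closed_if_countably_closed:
  assumes P: "poset P" and ne: "carr P \<noteq> {}" and cc: "countably_closed P"
  shows "omega1_closed P"
  unfolding omega1_closed_def
proof (intro ballI allI impI, elim conjE)
  fix \<gamma> p
  let ?U = "underS omega1 \<gamma>"
  assume pP: "\<forall>\<alpha>\<in>?U. p \<alpha> \<in> carr P"
    and dec: "\<forall>\<beta>\<in>?U. \<forall>\<alpha>\<in>underS omega1 \<beta>. (p \<beta>, p \<alpha>) \<in> brel P"
  have "\<exists>q\<in>carr P. \<forall>c\<in>p ` ?U. (q, c) \<in> brel P"
  proof (rule countable_chain_bound[OF P ne cc])
    show "countable (p ` ?U)" by (intro countable_image countable_underS_omega1)
    show "p ` ?U \<subseteq> carr P" using pP by blast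
    fix x y assume "x \<in> p ` ?U" "y \<in> p ` ?U"
    then obtain \<alpha> \<beta> where x: "x = p \<alpha>" "\<alpha> \<in> ?U" and y: "y = p \<beta>" "\<beta> \<in> ?U" by blast
    then have F: "\<alpha> \<in> Field omega1" "\<beta> \<in> Field omega1" by (auto simp: underS_def Field_def)
    have "total_on (Field omega1) omega1"
      using Well_order_omega1 unfolding well_order_on_def linear_order_on_def by blast
    with F have "\<alpha> = \<beta> \<or> \<alpha> \<in> underS omega1 \<beta> \<or> \<beta> \<in> underS omega1 \<alpha>"
      unfolding total_on_def underS_def by blast
    then show "(x, y) \<in> brel P \<or> (y, x) \<in> brel P"
    proof (elim disjE)
      assume "\<alpha> = \<beta>" then show ?thesis using x y pP poset_refl[OF P] by simp
    next
      assume "\<alpha> \<in> underS omega1 \<beta>" then show ?thesis using x y dec by simp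
    next
      assume "\<beta> \<in> underS omega1 \<alpha>" then show ?thesis using x y dec by simp
    qed
  qed
  then show "\<exists>q\<in>carr P. \<forall>\<alpha>\<in>?U. (q, p \<alpha>) \<in> brel P" by blast
qed

text \<open>Splitting repeatedly gives a binary tree of height \<open>\<omega>\<close>, and lower bounds of its branches are
  incompatible, because two branches separate at some level.\<close>

lemma continuum_antichain:
  assumes P: "poset P" and cc: "countably_closed P" and split: "splitting P" and a: "a \<in> carr P"
  shows "\<exists>h :: (nat \<Rightarrow> bool) \<Rightarrow> 'p. (\<forall>x. (h x, a) \<in> brel P) \<and>
     (\<forall>x y. x \<noteq> y \<longrightarrow> \<not> compatible P (h x) (h y))"
proof -
  have "\<exists>v. p \<in> carr P \<longrightarrow> (\<forall>b. (v b, p) \<in> brel P) \<and> \<not> compatible P (v True) (v False)" for p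
  proof (cases "p \<in> carr P")
    case True
    then obtain q r where "(q, p) \<in> brel P" "(r, p) \<in> brel P" "\<not> compatible P q r"
      using split unfolding splitting_def by blast
    then show ?thesis by (intro exI[of _ "\<lambda>b. if b then q else r"]) auto
  qed auto
  then obtain v where v: "\<And>p b. p \<in> carr P \<Longrightarrow> (v p b, p) \<in> brel P"
    and v': "\<And>p. p \<in> carr P \<Longrightarrow> \<not> compatible P (v p True) (v p False)" by metis
  \<comment> \<open>\<open>t x n\<close> is the node reached after \<open>n\<close> steps on the branch \<open>x\<close>.\<close>
  define t where "t x = rec_nat a (\<lambda>n p. v p (x n))" for x :: "nat \<Rightarrow> bool"
  have tS: "t x (Suc n) = v (t x n) (x n)" and t0: "t x 0 = a" for x n by (simp_all add: t_def)
  have tP: "t x n \<in> carr P" for x n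
    by (induction n) (use a v poset_carr1[OF P] in \<open>auto simp: t0 tS\<close>)
  have step: "(t x (Suc n), t x n) \<in> brel P" for x n using v tP by (simp add: tS)
  have dec: "(t x n, t x m) \<in> brel P" if "m \<le> n" for m n x
    using that
  proof (induction rule: dec_induct)
    case (step n)
    then show ?case using poset_trans[OF P \<open>\<And>x n. (t x (Suc n), t x n) \<in> brel P\<close>] by blast
  qed (rule poset_refl[OF P tP])
  have "\<exists>q. \<forall>n. (q, t x n) \<in> brel P" for x
    using cc tP[of x] dec[of _ _ x] unfolding countably_closed_def by blast
  then obtain h where h: "\<And>x n. (h x, t x n) \<in> brel P" by metis
  have "\<not> compatible P (h x) (h y)" if "x \<noteq> y" for x y
  proof
    assume c: "compatible P (h x) (h y)"
    define n where "n = (LEAST n. x n \<noteq> y n)"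
    have "\<exists>n. x n \<noteq> y n" using that by blast
    then have n: "x n \<noteq> y n" unfolding n_def by (rule LeastI_ex)
    have below: "x m = y m" if "m < n" for m using not_less_Least that unfolding n_def by blast
    have "m \<le> n \<Longrightarrow> t x m = t y m" for m
      by (induction m) (auto simp: t0 tS below)
    then have eq: "t x n = t y n" by simp
    have "compatible P (t x (Suc n)) (t y (Suc n))"
      by (rule compatible_mono[OF P h h c])
    then have "compatible P (v (t x n) (x n)) (v (t x n) (y n))" by (simp add: tS eq)
    moreover have "(x n = True \<and> y n = False) \<or> (x n = False \<and> y n = True)" using n by auto
    ultimately show False using v'[OF tP] compatible_sym by metis
  qed
  moreover have "(h x, a) \<in> brel P" for x using h[of x 0] by (simp add: t0)
  ultimately show ?thesis by blast
qed

text \<open>A nonempty downward closed set \<open>A\<close> has a maximal antichain indexed exactly by \<open>\<omega>\<^sub>1\<close>, all of whose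
  elements lie below \<open>p\<close> or are incompatible with \<open>p\<close>. The elements of \<open>A\<close> with the latter property are
  dense in \<open>A\<close>; below an antichain of size \<open>2\<^sup>\<omega> = \<omega>\<^sub>1\<close> there is one inside this dense set, and it is
  extended by Zorn's lemma. The bound on the size of the poset keeps the extension at size \<open>\<omega>\<^sub>1\<close>.\<close>

lemma deciding_partition:
  assumes CH: continuum_hypothesis and P: "poset P" and cc: "countably_closed P"
    and split: "splitting P" and size: "|carr P| \<le>o omega1"
    and A: "A \<subseteq> carr P" "A \<noteq> {}" and down: "\<And>x y. x \<in> A \<Longrightarrow> (y, x) \<in> brel P \<Longrightarrow> y \<in> A"
  shows "\<exists>s. (\<forall>\<xi>\<in>Field omega1. s \<xi> \<in> A \<and> ((s \<xi>, p) \<in> brel P \<or> \<not> compatible P (s \<xi>) p)) \<and>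
     (\<forall>\<xi>\<in>Field omega1. \<forall>\<eta>\<in>Field omega1. \<xi> \<noteq> \<eta> \<longrightarrow> \<not> compatible P (s \<xi>) (s \<eta>)) \<and>
     (\<forall>q\<in>A. \<exists>\<xi>\<in>Field omega1. compatible P q (s \<xi>))"
proof -
  define D where "D = {x \<in> A. (x, p) \<in> brel P \<or> \<not> compatible P x p}"
  have dense: "\<exists>y\<in>D. (y, x) \<in> brel P" if x: "x \<in> A" for x
  proof (cases "compatible P x p")
    case True
    then obtain y where "(y, x) \<in> brel P" "(y, p) \<in> brel P" by (auto simp: compatible_def)
    then show ?thesis using down[OF x] by (auto simp: D_def)
  next
    case False
    then show ?thesis using x A(1) poset_refl[OF P] by (auto simp: D_def)
  qed
  define anti where "anti M \<longleftrightarrow> (\<forall>x\<in>M. \<forall>y\<in>M. x \<noteq> y \<longrightarrow> \<not> compatible P x y)" for M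
  have selfc: "compatible P x x" if "x \<in> A" for x
    using that A(1) poset_refl[OF P] unfolding compatible_def by blast
  obtain M0 where M0: "M0 \<subseteq> D" "anti M0" "omega1 \<le>o |M0|"
  proof -
    obtain a where a: "a \<in> A" using A(2) by blast
    obtain h :: "(nat \<Rightarrow> bool) \<Rightarrow> _" where h: "\<And>x. (h x, a) \<in> brel P"
      and hi: "\<And>x y. x \<noteq> y \<Longrightarrow> \<not> compatible P (h x) (h y)"
      using continuum_antichain[OF P cc split] a A(1) by blast
    have "\<exists>y. y \<in> D \<and> (y, h x) \<in> brel P" for x using dense[OF down[OF a h]] by blast
    then obtain k where k: "\<And>x. k x \<in> D" "\<And>x. (k x, h x) \<in> brel P" by metis
    have ki: "\<not> compatible P (k x) (k y)" if "x \<noteq> y" for x y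
      using compatible_mono[OF P k(2) k(2)] hi[OF that] by blast
    have "compatible P (k x) (k x)" for x using selfc k(1)[of x] by (simp add: D_def)
    then have "inj k" using ki by (metis injI)
    then have "|UNIV :: (nat \<Rightarrow> bool) set| \<le>o |range k|"
      unfolding card_of_ordLeq[symmetric] by (intro exI[of _ k]) simp
    moreover have "|UNIV :: nat set set| \<le>o |UNIV :: (nat \<Rightarrow> bool) set|"
      unfolding card_of_ordLeq[symmetric]
      by (intro exI[of _ "\<lambda>A x. x \<in> A"]) (auto simp: inj_def fun_eq_iff)
    moreover have "omega1 \<le>o |UNIV :: nat set set|"
      using CH unfolding continuum_hypothesis_def
      by (rule ordIso_imp_ordLeq[OF ordIso_symmetric])
    ultimately have "omega1 \<le>o |range k|" by (meson ordLeq_transitive)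
    moreover have "anti (range k)" unfolding anti_def using ki by (metis rangeE)
    moreover have "range k \<subseteq> D" using k(1) by auto
    ultimately show thesis by (intro that)
  qed
  define \<A> where "\<A> = {M. M0 \<subseteq> M \<and> M \<subseteq> D \<and> anti M}"
  have "\<exists>M\<in>\<A>. \<forall>X\<in>\<A>. M \<subseteq> X \<longrightarrow> X = M"
  proof (rule subset_Zorn_nonempty)
    show "\<A> \<noteq> {}" using M0 unfolding \<A>_def by blast
    fix \<C> assume \<C>: "\<C> \<noteq> {}" "subset.chain \<A> \<C>"
    have "anti (\<Union>\<C>)" unfolding anti_def
    proof (intro ballI impI)
      fix x y assume "x \<in> \<Union>\<C>" "y \<in> \<Union>\<C>" and ne: "x \<noteq> y"
      then obtain X Y where XY: "X \<in> \<C>" "x \<in> X" "Y \<in> \<C>" "y \<in> Y" by blast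
      then have "X \<subseteq> Y \<or> Y \<subseteq> X" using \<C>(2) unfolding subset_chain_def by simp
      then obtain Z where Z: "Z \<in> \<C>" "x \<in> Z" "y \<in> Z" using XY by (meson subsetD)
      have "\<C> \<subseteq> \<A>" using \<C>(2) unfolding subset_chain_def by (rule conjunct1)
      then have "anti Z" using Z(1) unfolding \<A>_def by auto
      then show "\<not> compatible P x y" using Z ne unfolding anti_def by simp
    qed
    moreover have "M0 \<subseteq> X \<and> X \<subseteq> D" if "X \<in> \<C>" for X
      using that \<C>(2) unfolding subset_chain_def \<A>_def by auto
    then have "M0 \<subseteq> \<Union>\<C>" "\<Union>\<C> \<subseteq> D" using \<C>(1) by (fastforce, fastforce)
    ultimately show "\<Union>\<C> \<in> \<A>" by (simp add: \<A>_def)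
  qed
  then obtain M where "M \<in> \<A>" and max: "\<And>X. X \<in> \<A> \<Longrightarrow> M \<subseteq> X \<Longrightarrow> X = M" by metis
  then have M: "M0 \<subseteq> M" "M \<subseteq> D" "anti M" by (simp_all add: \<A>_def)
  have predense: "\<exists>x\<in>M. compatible P q x" if q: "q \<in> A" for q
  proof (rule ccontr)
    assume no: "\<not> (\<exists>x\<in>M. compatible P q x)"
    obtain y where y: "y \<in> D" "(y, q) \<in> brel P" using dense[OF q] by blast
    have yM: "\<not> compatible P y x" if "x \<in> M" for x
    proof
      assume "compatible P y x"
      moreover have "x \<in> carr P" using that M(2) A(1) unfolding D_def by auto
      then have "(x, x) \<in> brel P" by (rule poset_refl[OF P])
      ultimately have "compatible P q x" using compatible_mono[OF P y(2)] by metis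
      then show False using no that by metis
    qed
    then have "anti (insert y M)" using M(3) compatible_sym unfolding anti_def by (metis insertE)
    then have "insert y M \<in> \<A>" using M y(1) by (auto simp: \<A>_def)
    from max[OF this] have "y \<in> M" by auto
    moreover have "compatible P y y" using selfc y(1) by (simp add: D_def)
    ultimately show False using yM[of y] by simp
  qed
  have "|M| \<le>o omega1"
    using ordLeq_transitive[OF card_of_mono1 size, of M] M(2) A(1) unfolding D_def by blast
  moreover have "omega1 \<le>o |M|"
    using ordLeq_transitive[OF M0(3) card_of_mono1[OF M(1)]] .
  ultimately have "|Field omega1| =o |M|"
    using ordIso_transitive[OF card_of_Field_ordIso[OF Card_order_omega1]] ordIso_iff_ordLeq by blast
  then obtain s where s: "bij_betw s (Field omega1) M"
    unfolding card_of_ordIso[symmetric] by blast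
  have sM: "s \<xi> \<in> M" if "\<xi> \<in> Field omega1" for \<xi> using s that by (rule bij_betwE[rule_format])
  show ?thesis
  proof (intro exI[of _ s] conjI ballI impI)
    fix \<xi> assume "\<xi> \<in> Field omega1"
    then have "s \<xi> \<in> D" using sM M(2) by blast
    then show "s \<xi> \<in> A" "(s \<xi>, p) \<in> brel P \<or> \<not> compatible P (s \<xi>) p" by (auto simp: D_def)
  next
    fix \<xi> \<eta> assume F: "\<xi> \<in> Field omega1" "\<eta> \<in> Field omega1" "\<xi> \<noteq> \<eta>"
    then have "s \<xi> \<noteq> s \<eta>" using s unfolding bij_betw_def inj_on_def by blast
    then show "\<not> compatible P (s \<xi>) (s \<eta>)" using F sM M(3) unfolding anti_def by blast
  next
    fix q assume "q \<in> A"
    then obtain x where "x \<in> M" "compatible P q x" using predense by blast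
    moreover from this obtain \<xi> where "\<xi> \<in> Field omega1" "x = s \<xi>"
      using s unfolding bij_betw_def by blast
    ultimately show "\<exists>\<xi>\<in>Field omega1. compatible P q (s \<xi>)" by blast
  qed
qed

text \<open>The tree of sequences of countable ordinals of successor length: the pair \<open>(\<alpha>, f)\<close> stands for the
  restriction of \<open>f\<close> to the ordinals \<open>\<le> \<alpha>\<close>, and different pairs may stand for the same node. Limit
  nodes are left out, since in the posets concerned decreasing sequences have lower bounds but need not
  have a greatest one. Values of \<open>f\<close> above \<open>\<alpha>\<close> are irrelevant for the order; requiring them to be
  countable ordinals as well saves case distinctions.\<close>

definition tree_nodes :: "(nat set \<times> (nat set \<Rightarrow> nat set)) set" where
  "tree_nodes = {(\<alpha>, f). \<alpha> \<in> Field omega1 \<and> (\<forall>\<beta>. f \<beta> \<in> Field omega1)}"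

text \<open>The node \<open>x\<close> extends the node \<open>y\<close>; as in forcing, longer sequences are smaller.\<close>

definition tree_le :: "nat set \<times> (nat set \<Rightarrow> nat set) \<Rightarrow> nat set \<times> (nat set \<Rightarrow> nat set) \<Rightarrow> bool" where
  "tree_le x y \<longleftrightarrow> (fst y, fst x) \<in> omega1 \<and> (\<forall>\<gamma>. (\<gamma>, fst y) \<in> omega1 \<longrightarrow> snd x \<gamma> = snd y \<gamma>)"

lemma omega1_facts:
  shows omega1_refl: "\<alpha> \<in> Field omega1 \<Longrightarrow> (\<alpha>, \<alpha>) \<in> omega1"
    and omega1_trans: "(\<alpha>, \<beta>) \<in> omega1 \<Longrightarrow> (\<beta>, \<gamma>) \<in> omega1 \<Longrightarrow> (\<alpha>, \<gamma>) \<in> omega1"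
    and omega1_antisym: "(\<alpha>, \<beta>) \<in> omega1 \<Longrightarrow> (\<beta>, \<alpha>) \<in> omega1 \<Longrightarrow> \<alpha> = \<beta>"
    and omega1_total: "\<alpha> \<in> Field omega1 \<Longrightarrow> \<beta> \<in> Field omega1 \<Longrightarrow>
      (\<alpha>, \<beta>) \<in> omega1 \<or> (\<beta>, \<alpha>) \<in> omega1"
    and omega1_wf: "wf (omega1 - Id)"
proof -
  have wo: "Well_order omega1" by (rule Well_order_omega1)
  then have r: "Refl omega1" and t: "trans omega1" and a: "antisym omega1"
    and tot: "Total omega1" and wf: "wf (omega1 - Id)"
    unfolding well_order_on_def linear_order_on_def partial_order_on_def preorder_on_def
    by auto
  show "\<alpha> \<in> Field omega1 \<Longrightarrow> (\<alpha>, \<alpha>) \<in> omega1" using r by (rule refl_onD)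
  then show "\<alpha> \<in> Field omega1 \<Longrightarrow> \<beta> \<in> Field omega1 \<Longrightarrow> (\<alpha>, \<beta>) \<in> omega1 \<or> (\<beta>, \<alpha>) \<in> omega1"
    using tot unfolding total_on_def by (cases "\<alpha> = \<beta>") auto
  show "(\<alpha>, \<beta>) \<in> omega1 \<Longrightarrow> (\<beta>, \<gamma>) \<in> omega1 \<Longrightarrow> (\<alpha>, \<gamma>) \<in> omega1" using t by (rule transD)
  show "(\<alpha>, \<beta>) \<in> omega1 \<Longrightarrow> (\<beta>, \<alpha>) \<in> omega1 \<Longrightarrow> \<alpha> = \<beta>" using a by (rule antisymD)
  show "wf (omega1 - Id)" by (rule wf)
qed

text \<open>The tree is mapped into the poset by recursion on the length. At a node \<open>(\<alpha>, f)\<close> the set \<open>E\<close> of all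
  lower bounds of the earlier values is divided by a maximal antichain that decides the \<open>\<alpha>\<close>-th element
  of the poset, and \<open>f \<alpha>\<close> selects an element of this antichain. No distinction between successor and
  limit stages is needed, and \<open>E\<close> is not empty because the earlier values form a countable chain.

  The order is reflected since different choices at the same stage are incompatible. For density,
  a point \<open>p\<close> is the \<open>\<alpha>\<close>-th one for some \<open>\<alpha>\<close>. A path through the tree is chosen together with a
  decreasing sequence below \<open>p\<close> and below the values on the path: at each stage a lower bound of
  what has been chosen is compatible with some element of the maximal antichain. The value at stage
  \<open>\<alpha>\<close> is then compatible with \<open>p\<close>, and as it decides \<open>p\<close>, it lies below \<open>p\<close>.\<close>

lemma dense_tree:
  assumes CH: continuum_hypothesis and P: "poset P" and ne: "carr P \<noteq> {}"
    and cc: "countably_closed P" and split: "splitting P" and size: "|carr P| \<le>o omega1"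
  shows "\<exists>d. d ` tree_nodes \<subseteq> carr P \<and>
    (\<forall>p\<in>carr P. \<exists>x\<in>tree_nodes. (d x, p) \<in> brel P) \<and>
    (\<forall>x\<in>tree_nodes. \<forall>y\<in>tree_nodes. (d x, d y) \<in> brel P \<longleftrightarrow> tree_le x y)"
proof -
  let ?\<Omega> = "Field omega1"
  note tr = poset_trans[OF P]
  have "|carr P| \<le>o |?\<Omega>|"
    using ordLeq_ordIso_trans[OF size] ordIso_symmetric[OF card_of_Field_ordIso[OF Card_order_omega1]]
    by blast
  then have "\<exists>en. en ` ?\<Omega> = carr P" unfolding card_of_ordLeq2[OF ne] .
  then obtain en where en: "en ` ?\<Omega> = carr P" by (rule exE)
  define good where "good A \<longleftrightarrow> A \<subseteq> carr P \<and> A \<noteq> {} \<and>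
    (\<forall>x\<in>A. \<forall>y. (y, x) \<in> brel P \<longrightarrow> y \<in> A)" for A
  define part where "part A p s \<longleftrightarrow>
     (\<forall>\<xi>\<in>?\<Omega>. s \<xi> \<in> A \<and> ((s \<xi>, p) \<in> brel P \<or> \<not> compatible P (s \<xi>) p)) \<and>
     (\<forall>\<xi>\<in>?\<Omega>. \<forall>\<eta>\<in>?\<Omega>. \<xi> \<noteq> \<eta> \<longrightarrow> \<not> compatible P (s \<xi>) (s \<eta>)) \<and>
     (\<forall>q\<in>A. \<exists>\<xi>\<in>?\<Omega>. compatible P q (s \<xi>))" for A p s
  have "\<exists>s. part A p s" if A: "good A" for A p
    unfolding part_def
    by (rule deciding_partition[OF CH P cc split size]) (use A in \<open>auto simp: good_def\<close>)
  then obtain S where S: "\<And>A p. good A \<Longrightarrow> part A p (S A p)" by metis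
  define into where "into f \<longleftrightarrow> (\<forall>\<beta>. f \<beta> \<in> ?\<Omega>)" for f :: "nat set \<Rightarrow> nat set"
  define E where "E d \<alpha> = {q \<in> carr P. \<forall>\<beta>\<in>underS omega1 \<alpha>. (q, d \<beta>) \<in> brel P}" for d \<alpha>
  \<comment> \<open>\<open>d f \<alpha>\<close> is the value at the node \<open>(\<alpha>, f)\<close>.\<close>
  define d where "d f = wfrec (omega1 - Id) (\<lambda>d \<alpha>. S (E d \<alpha>) (en \<alpha>) (f \<alpha>))" for f
  have Econg: "E d1 \<alpha> = E d2 \<alpha>" if "\<And>\<beta>. \<beta> \<in> underS omega1 \<alpha> \<Longrightarrow> d1 \<beta> = d2 \<beta>" for d1 d2 \<alpha>
    using that unfolding E_def by auto
  have d_rec: "d f \<alpha> = S (E (d f) \<alpha>) (en \<alpha>) (f \<alpha>)" for f \<alpha>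
  proof -
    have "adm_wf (omega1 - Id) (\<lambda>d \<alpha>. S (E d \<alpha>) (en \<alpha>) (f \<alpha>))"
      unfolding adm_wf_def
    proof (intro allI impI)
      fix d1 d2 :: "nat set \<Rightarrow> 'a" and x assume "\<forall>z. (z, x) \<in> omega1 - Id \<longrightarrow> d1 z = d2 z"
      then have "E d1 x = E d2 x" by (intro Econg) (auto simp: underS_def)
      then show "S (E d1 x) (en x) (f x) = S (E d2 x) (en x) (f x)" by simp
    qed
    from wfrec_fixpoint[OF omega1_wf this] show ?thesis unfolding d_def by (rule fun_cong)
  qed
  have Edown: "y \<in> E d' \<alpha>" if "x \<in> E d' \<alpha>" "(y, x) \<in> brel P" for d' \<alpha> x y
    using that tr poset_carr1[OF P] unfolding E_def by blast
  have under: "\<beta> \<in> ?\<Omega>" if "\<beta> \<in> underS omega1 \<alpha>" for \<alpha> \<beta>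
    using that unfolding underS_def Field_def by blast
  have dE: "good (E (d f) \<alpha>) \<and> d f \<alpha> \<in> E (d f) \<alpha>" if f: "into f" and "\<alpha> \<in> ?\<Omega>" for f \<alpha>
    using \<open>\<alpha> \<in> ?\<Omega>\<close>
  proof (induction \<alpha> rule: wf_induct_rule[OF omega1_wf])
    case (1 \<alpha>)
    have IH: "d f \<beta> \<in> E (d f) \<beta>" if "\<beta> \<in> underS omega1 \<alpha>" for \<beta>
      using 1(1)[of \<beta>] that under[OF that] unfolding underS_def by blast
    have "\<exists>q\<in>carr P. \<forall>c\<in>d f ` underS omega1 \<alpha>. (q, c) \<in> brel P"
    proof (rule countable_chain_bound[OF P ne cc])
      show "countable (d f ` underS omega1 \<alpha>)"
        by (intro countable_image countable_underS_omega1)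
      show "d f ` underS omega1 \<alpha> \<subseteq> carr P" using IH unfolding E_def by blast
      fix x y assume "x \<in> d f ` underS omega1 \<alpha>" "y \<in> d f ` underS omega1 \<alpha>"
      then obtain \<beta> \<gamma> where x: "x = d f \<beta>" "\<beta> \<in> underS omega1 \<alpha>"
        and y: "y = d f \<gamma>" "\<gamma> \<in> underS omega1 \<alpha>" by blast
      have "\<beta> = \<gamma> \<or> \<beta> \<in> underS omega1 \<gamma> \<or> \<gamma> \<in> underS omega1 \<beta>"
        using omega1_total[OF under[OF x(2)] under[OF y(2)]] unfolding underS_def by blast
      then show "(x, y) \<in> brel P \<or> (y, x) \<in> brel P"
      proof (elim disjE)
        assume "\<beta> = \<gamma>"
        then show ?thesis using x y IH[OF x(2)] poset_refl[OF P] unfolding E_def by simp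
      next
        assume "\<beta> \<in> underS omega1 \<gamma>"
        then show ?thesis using x y IH[OF y(2)] unfolding E_def by simp
      next
        assume "\<gamma> \<in> underS omega1 \<beta>"
        then show ?thesis using x y IH[OF x(2)] unfolding E_def by simp
      qed
    qed
    then have "E (d f) \<alpha> \<noteq> {}" unfolding E_def by blast
    then have g: "good (E (d f) \<alpha>)" unfolding good_def using Edown unfolding E_def by blast
    from S[OF this, of "en \<alpha>"] show ?case unfolding d_rec[of f \<alpha>] part_def using f g
      by (simp add: into_def)
  qed
  have dP: "d f \<alpha> \<in> carr P" if "into f" "\<alpha> \<in> ?\<Omega>" for f \<alpha>
    using dE[OF that] unfolding E_def by blast
  have d_dec: "(d f \<alpha>, d f \<beta>) \<in> brel P" if f: "into f" and \<beta>: "(\<beta>, \<alpha>) \<in> omega1" for f \<alpha> \<beta>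
  proof (cases "\<beta> = \<alpha>")
    case True
    then have "\<alpha> \<in> ?\<Omega>" using \<beta> by (auto simp: Field_def)
    then show ?thesis using True poset_refl[OF P dP[OF f]] by simp
  next
    case False
    then have "\<beta> \<in> underS omega1 \<alpha>" "\<alpha> \<in> ?\<Omega>"
      using \<beta> unfolding underS_def Field_def by auto
    then show ?thesis using dE[OF f, of \<alpha>] unfolding E_def by simp
  qed
  have d_cong: "d f \<alpha> = d g \<alpha>" if "\<forall>\<gamma>. (\<gamma>, \<alpha>) \<in> omega1 \<longrightarrow> f \<gamma> = g \<gamma>" "\<alpha> \<in> ?\<Omega>" for f g \<alpha>
    using that
  proof (induction \<alpha> rule: wf_induct_rule[OF omega1_wf])
    case (1 \<alpha>)
    have "d f \<beta> = d g \<beta>" if "\<beta> \<in> underS omega1 \<alpha>" for \<beta>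
      using 1(1)[of \<beta>] 1(2) that under[OF that] omega1_trans[of _ \<beta> \<alpha>]
      unfolding underS_def by blast
    then have "E (d f) \<alpha> = E (d g) \<alpha>" by (rule Econg)
    then show ?case using 1(2) omega1_refl[OF 1(3)] by (simp add: d_rec[of _ \<alpha>])
  qed
  have d_incomp: "\<not> compatible P (d f \<delta>) (d g \<delta>)"
    if f: "into f" and g: "into g" and \<delta>: "\<delta> \<in> ?\<Omega>"
      and eq: "\<And>\<gamma>. \<gamma> \<in> underS omega1 \<delta> \<Longrightarrow> f \<gamma> = g \<gamma>" and "f \<delta> \<noteq> g \<delta>" for f g \<delta>
  proof -
    have "d f \<beta> = d g \<beta>" if "\<beta> \<in> underS omega1 \<delta>" for \<beta>
    proof (rule d_cong[OF _ under[OF that]], intro allI impI)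
      fix \<gamma> assume "(\<gamma>, \<beta>) \<in> omega1"
      then have "\<gamma> \<in> underS omega1 \<delta>"
        using that omega1_trans omega1_antisym unfolding underS_def by blast
      then show "f \<gamma> = g \<gamma>" by (rule eq)
    qed
    then have "E (d f) \<delta> = E (d g) \<delta>" by (rule Econg)
    moreover have "part (E (d f) \<delta>) (en \<delta>) (S (E (d f) \<delta>) (en \<delta>))" using S dE[OF f \<delta>] by blast
    ultimately show ?thesis
      unfolding d_rec[of f \<delta>] d_rec[of g \<delta>] part_def into_def using f[unfolded into_def] g[unfolded into_def] \<open>f \<delta> \<noteq> g \<delta>\<close> by auto
  qed
  have order: "(d f \<alpha>, d g \<beta>) \<in> brel P \<longleftrightarrow> tree_le (\<alpha>, f) (\<beta>, g)"
    if f: "into f" and g: "into g" and \<alpha>: "\<alpha> \<in> ?\<Omega>" and \<beta>: "\<beta> \<in> ?\<Omega>" for f g \<alpha> \<beta>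
  proof
    assume "tree_le (\<alpha>, f) (\<beta>, g)"
    then have t: "(\<beta>, \<alpha>) \<in> omega1" "\<forall>\<gamma>. (\<gamma>, \<beta>) \<in> omega1 \<longrightarrow> f \<gamma> = g \<gamma>" by (auto simp: tree_le_def)
    from d_dec[OF f t(1)] d_cong[OF t(2) \<beta>] show "(d f \<alpha>, d g \<beta>) \<in> brel P" by simp
  next
    assume le: "(d f \<alpha>, d g \<beta>) \<in> brel P"
    have agree: "f \<gamma> = g \<gamma>" if "(\<gamma>, \<alpha>) \<in> omega1" "(\<gamma>, \<beta>) \<in> omega1" for \<gamma>
    proof -
      have "(\<gamma>, \<alpha>) \<in> omega1 \<longrightarrow> (\<gamma>, \<beta>) \<in> omega1 \<longrightarrow> f \<gamma> = g \<gamma>"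
      proof (induction \<gamma> rule: wf_induct_rule[OF omega1_wf])
        case (1 \<gamma>)
        show ?case
        proof (intro impI, rule ccontr)
          assume \<gamma>: "(\<gamma>, \<alpha>) \<in> omega1" "(\<gamma>, \<beta>) \<in> omega1" and neq: "f \<gamma> \<noteq> g \<gamma>"
          have "f \<delta> = g \<delta>" if "\<delta> \<in> underS omega1 \<gamma>" for \<delta>
            using 1[of \<delta>] that \<gamma> omega1_trans unfolding underS_def by blast
          then have "\<not> compatible P (d f \<gamma>) (d g \<gamma>)"
            using d_incomp[OF f g _ _ neq] \<gamma> unfolding Field_def by blast
          moreover have "(d f \<alpha>, d f \<gamma>) \<in> brel P" "(d g \<beta>, d g \<gamma>) \<in> brel P"
            using d_dec f g \<gamma> by blast+
          ultimately show False using le tr unfolding compatible_def by blast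
        qed
      qed
      then show ?thesis using that by blast
    qed
    have "(\<beta>, \<alpha>) \<in> omega1"
    proof (rule ccontr)
      assume n: "(\<beta>, \<alpha>) \<notin> omega1"
      then have \<alpha>\<beta>: "(\<alpha>, \<beta>) \<in> omega1" "\<alpha> \<noteq> \<beta>"
        using omega1_total[OF \<alpha> \<beta>] omega1_refl[OF \<alpha>] by auto
      obtain \<xi> where \<xi>: "\<xi> \<in> ?\<Omega>" "\<xi> \<noteq> g \<beta>" using \<alpha> \<beta> \<alpha>\<beta>(2) by metis
      \<comment> \<open>Changing \<open>g\<close> at \<open>\<beta>\<close> gives a node that lies below \<open>(\<alpha>, f)\<close> but is incompatible with \<open>(\<beta>, g)\<close>.\<close>
      define g' where "g' = g(\<beta> := \<xi>)"
      have g': "into g'" using g \<xi> by (simp add: g'_def into_def)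
      have "\<not> compatible P (d g' \<beta>) (d g \<beta>)"
        by (rule d_incomp[OF g' g \<beta>]) (use \<xi> in \<open>auto simp: g'_def underS_def\<close>)
      moreover have "d g' \<alpha> = d f \<alpha>"
      proof (rule d_cong[OF _ \<alpha>], intro allI impI)
        fix \<gamma> assume \<gamma>: "(\<gamma>, \<alpha>) \<in> omega1"
        then have "\<gamma> \<noteq> \<beta>" using n by blast
        then show "g' \<gamma> = f \<gamma>" using agree[OF \<gamma> omega1_trans[OF \<gamma> \<alpha>\<beta>(1)]] by (simp add: g'_def)
      qed
      moreover have "(d g' \<beta>, d g' \<alpha>) \<in> brel P" by (rule d_dec[OF g' \<alpha>\<beta>(1)])
      moreover have "(d g' \<beta>, d g' \<beta>) \<in> brel P" using poset_refl[OF P dP[OF g' \<beta>]] .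
      ultimately show False using le tr unfolding compatible_def by metis
    qed
    then show "tree_le (\<alpha>, f) (\<beta>, g)"
      using agree omega1_trans unfolding tree_le_def by auto
  qed
  have dense: "\<exists>x\<in>tree_nodes. (d (snd x) (fst x), p) \<in> brel P" if p: "p \<in> carr P" for p
  proof -
    have "p \<in> en ` ?\<Omega>" using en p by simp
    then obtain \<beta>0 where \<beta>0: "\<beta>0 \<in> ?\<Omega>" "en \<beta>0 = p" by (elim imageE) simp
    \<comment> \<open>Stage \<open>\<alpha>\<close> of the path: \<open>fst (h \<alpha>)\<close> is the point below \<open>p\<close>, and \<open>snd (h \<alpha>)\<close> the choice in the tree.\<close>
    define follows where "follows h \<alpha> v \<longleftrightarrow> snd v \<in> ?\<Omega> \<and> (\<alpha> \<in> ?\<Omega> \<longrightarrow>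
      (fst v, p) \<in> brel P \<and> (\<forall>\<beta>\<in>underS omega1 \<alpha>. (fst v, fst (h \<beta>)) \<in> brel P) \<and>
      (fst v, S (E (d (\<lambda>\<beta>. snd (h \<beta>))) \<alpha>) (en \<alpha>) (snd v)) \<in> brel P)"
      for h :: "nat set \<Rightarrow> _ \<times> nat set" and \<alpha> v
    have Eloc: "E (d f) \<alpha> = E (d g) \<alpha>" if eq: "\<And>\<beta>. \<beta> \<in> underS omega1 \<alpha> \<Longrightarrow> f \<beta> = g \<beta>" for f g \<alpha>
    proof (rule Econg)
      fix \<beta> assume \<beta>: "\<beta> \<in> underS omega1 \<alpha>"
      show "d f \<beta> = d g \<beta>"
      proof (rule d_cong[OF _ under[OF \<beta>]], intro allI impI)
        fix \<gamma> assume "(\<gamma>, \<beta>) \<in> omega1"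
        then have "\<gamma> \<in> underS omega1 \<alpha>"
          using \<beta> omega1_trans[of \<gamma> \<beta> \<alpha>] omega1_antisym[of \<gamma> \<beta>] unfolding underS_def by auto
        then show "f \<gamma> = g \<gamma>" by (rule eq)
      qed
    qed
    have "\<exists>h. \<forall>\<alpha>. follows h \<alpha> (h \<alpha>)"
    proof (rule dependent_wf_choice[OF omega1_wf])
      fix h h' :: "nat set \<Rightarrow> 'a \<times> nat set" and \<alpha> v
      assume eq: "\<And>\<beta>. (\<beta>, \<alpha>) \<in> omega1 - Id \<Longrightarrow> h \<beta> = h' \<beta>"
      have eq': "h \<beta> = h' \<beta>" if "\<beta> \<in> underS omega1 \<alpha>" for \<beta>
        using eq that by (simp add: underS_def)
      have "E (d (\<lambda>\<beta>. snd (h \<beta>))) \<alpha> = E (d (\<lambda>\<beta>. snd (h' \<beta>))) \<alpha>"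
        by (rule Eloc) (simp add: eq')
      then show "follows h \<alpha> v = follows h' \<alpha> v"
        unfolding follows_def using eq' by simp
    next
      fix \<alpha> and h :: "nat set \<Rightarrow> 'a \<times> nat set"
      assume IH: "\<And>\<beta>. (\<beta>, \<alpha>) \<in> omega1 - Id \<Longrightarrow> follows h \<beta> (h \<beta>)"
      show "\<exists>v. follows h \<alpha> v"
      proof (cases "\<alpha> \<in> ?\<Omega>")
        case False
        then show ?thesis using \<beta>0 by (intro exI[of _ "(p, \<beta>0)"]) (simp add: follows_def)
      next
        case True
        define F where "F = (\<lambda>\<beta>. snd (h \<beta>))"
        have dF: "d F \<beta> = S (E (d (\<lambda>\<beta>. snd (h \<beta>))) \<beta>) (en \<beta>) (snd (h \<beta>))" for \<beta>
          using d_rec[of F \<beta>] by (simp only: F_def)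
        \<comment> \<open>At this stage only the values of \<open>F\<close> below \<open>\<alpha>\<close> are known to be countable ordinals.\<close>
        define F' where "F' = (\<lambda>\<beta>. if \<beta> \<in> underS omega1 \<alpha> then F \<beta> else \<beta>0)"
        have IH': "snd (h \<beta>) \<in> ?\<Omega>" "(fst (h \<beta>), p) \<in> brel P" "(fst (h \<beta>), d F \<beta>) \<in> brel P"
          "\<And>\<gamma>. \<gamma> \<in> underS omega1 \<beta> \<Longrightarrow> (fst (h \<beta>), fst (h \<gamma>)) \<in> brel P"
          if "\<beta> \<in> underS omega1 \<alpha>" for \<beta>
        proof -
          have "(\<beta>, \<alpha>) \<in> omega1 - Id" using that by (simp add: underS_def)
          then show "snd (h \<beta>) \<in> ?\<Omega>" "(fst (h \<beta>), p) \<in> brel P" "(fst (h \<beta>), d F \<beta>) \<in> brel P"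
            "\<And>\<gamma>. \<gamma> \<in> underS omega1 \<beta> \<Longrightarrow> (fst (h \<beta>), fst (h \<gamma>)) \<in> brel P"
            using IH[of \<beta>] under[OF that] dF[of \<beta>] unfolding follows_def by simp_all
        qed
        have "into F'" using IH'(1) \<beta>0 by (simp add: into_def F'_def F_def)
        then have "good (E (d F') \<alpha>)" using dE True by blast
        moreover have "E (d F') \<alpha> = E (d F) \<alpha>" by (rule Eloc) (simp add: F'_def)
        ultimately have "part (E (d F) \<alpha>) (en \<alpha>) (S (E (d F) \<alpha>) (en \<alpha>))" using S by simp
        moreover obtain q where q: "(q, p) \<in> brel P"
          "\<And>\<beta>. \<beta> \<in> underS omega1 \<alpha> \<Longrightarrow> (q, fst (h \<beta>)) \<in> brel P"
        proof -
          let ?C = "insert p ((\<lambda>\<beta>. fst (h \<beta>)) ` underS omega1 \<alpha>)"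
          have "\<exists>q\<in>carr P. \<forall>c\<in>?C. (q, c) \<in> brel P"
          proof (rule countable_chain_bound[OF P ne cc])
            show "countable ?C" by (intro countable_insert countable_image countable_underS_omega1)
            show "?C \<subseteq> carr P" using p IH'(2) poset_carr1[OF P] by auto
            have pp: "(p, p) \<in> brel P" using poset_refl[OF P p] .
            have *: "(fst (h \<beta>), fst (h \<gamma>)) \<in> brel P \<or> (fst (h \<gamma>), fst (h \<beta>)) \<in> brel P"
              if \<beta>: "\<beta> \<in> underS omega1 \<alpha>" and \<gamma>: "\<gamma> \<in> underS omega1 \<alpha>" for \<beta> \<gamma>
            proof -
              have "\<beta> = \<gamma> \<or> \<beta> \<in> underS omega1 \<gamma> \<or> \<gamma> \<in> underS omega1 \<beta>"
                using omega1_total[OF under[OF \<beta>] under[OF \<gamma>]] unfolding underS_def by auto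
              then show ?thesis
                using IH'(4)[OF \<beta>] IH'(4)[OF \<gamma>] poset_refl[OF P poset_carr1[OF P IH'(2)[OF \<beta>]]]
                by auto
            qed
            fix x y assume "x \<in> ?C" "y \<in> ?C"
            then show "(x, y) \<in> brel P \<or> (y, x) \<in> brel P" using * pp IH'(2) by auto
          qed
          then show thesis by (auto intro: that)
        qed
        moreover have "q \<in> E (d F) \<alpha>"
          unfolding E_def using q poset_carr1[OF P q(1)] tr[OF q(2) IH'(3)] by simp
        ultimately obtain \<xi> where "\<xi> \<in> ?\<Omega>" "compatible P q (S (E (d F) \<alpha>) (en \<alpha>) \<xi>)"
          unfolding part_def by auto
        then obtain r where "(r, q) \<in> brel P" "(r, S (E (d F) \<alpha>) (en \<alpha>) \<xi>) \<in> brel P"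
          unfolding compatible_def by auto
        then have "follows h \<alpha> (r, \<xi>)"
          unfolding follows_def using \<open>\<xi> \<in> ?\<Omega>\<close> q tr F_def by auto
        then show ?thesis by (rule exI)
      qed
    qed
    then obtain h where h: "\<And>\<alpha>. follows h \<alpha> (h \<alpha>)" by blast
    define F where "F = (\<lambda>\<beta>. snd (h \<beta>))"
    have F: "into F" using h by (simp add: into_def F_def follows_def)
    have r: "(fst (h \<beta>0), p) \<in> brel P" "(fst (h \<beta>0), d F \<beta>0) \<in> brel P"
      using h[of \<beta>0] \<beta>0(1) d_rec[of F \<beta>0] unfolding follows_def by (simp_all add: F_def)
    have "part (E (d F) \<beta>0) (en \<beta>0) (S (E (d F) \<beta>0) (en \<beta>0))"
      using S dE[OF F \<beta>0(1)] by simp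
    then have "(d F \<beta>0, p) \<in> brel P \<or> \<not> compatible P (d F \<beta>0) p"
      unfolding d_rec[of F \<beta>0] part_def using F \<beta>0(2) by (auto simp: into_def)
    then have "(d F \<beta>0, p) \<in> brel P" using r unfolding compatible_def by auto
    moreover have "(\<beta>0, F) \<in> tree_nodes" using \<beta>0(1) F by (simp add: tree_nodes_def into_def)
    ultimately show ?thesis by (intro bexI[of _ "(\<beta>0, F)"]) simp_all
  qed
  have "d (snd x) (fst x) \<in> carr P" if "x \<in> tree_nodes" for x
    using that dP unfolding tree_nodes_def into_def by auto
  moreover have "(d (snd x) (fst x), d (snd y) (fst y)) \<in> brel P \<longleftrightarrow> tree_le x y"
    if "x \<in> tree_nodes" "y \<in> tree_nodes" for x y
    using that order[of "snd x" "snd y" "fst x" "fst y"] unfolding tree_nodes_def into_def by auto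
  ultimately show ?thesis
    using dense by (intro exI[of _ "\<lambda>x. d (snd x) (fst x)"]) auto
qed

lemma forcing_equivalent_if_countably_closed:
  assumes CH: continuum_hypothesis
    and P: "poset P" "carr P \<noteq> {}" "countably_closed P" "splitting P" "|carr P| \<le>o omega1"
    and Q: "poset Q" "carr Q \<noteq> {}" "countably_closed Q" "splitting Q" "|carr Q| \<le>o omega1"
  shows "forcing_equivalent P Q"
proof -
  obtain d where d: "d ` tree_nodes \<subseteq> carr P"
    "\<And>p. p \<in> carr P \<Longrightarrow> \<exists>x\<in>tree_nodes. (d x, p) \<in> brel P"
    "\<And>x y. x \<in> tree_nodes \<Longrightarrow> y \<in> tree_nodes \<Longrightarrow> (d x, d y) \<in> brel P \<longleftrightarrow> tree_le x y"
    using dense_tree[OF CH P] by metis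
  obtain e where e: "e ` tree_nodes \<subseteq> carr Q"
    "\<And>p. p \<in> carr Q \<Longrightarrow> \<exists>x\<in>tree_nodes. (e x, p) \<in> brel Q"
    "\<And>x y. x \<in> tree_nodes \<Longrightarrow> y \<in> tree_nodes \<Longrightarrow> (e x, e y) \<in> brel Q \<longleftrightarrow> tree_le x y"
    using dense_tree[OF CH Q] by metis
  show ?thesis
    by (rule forcing_equivalent_if_common_dense[OF P(1) Q(1) d(1) e(1) d(2) e(2)])
      (simp_all add: d(3) e(3))
qed

section \<open>Separative quotients\<close>

lemma le_star_refl: "poset P \<Longrightarrow> p \<in> carr P \<Longrightarrow> (p, p) \<in> le_star P"
  using poset_refl poset_carr1 unfolding le_star_def by fastforce

lemma le_star_if_le: "poset P \<Longrightarrow> (p, q) \<in> brel P \<Longrightarrow> (p, q) \<in> le_star P"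
proof -
  assume P: "poset P" and pq: "(p, q) \<in> brel P"
  have "\<exists>s. (s, r) \<in> brel P \<and> (s, q) \<in> brel P" if "(r, p) \<in> brel P" for r
    using poset_refl[OF P poset_carr1[OF P that]] poset_trans[OF P that pq] by blast
  then show ?thesis
    using poset_carr1[OF P pq] poset_carr2[OF P pq] unfolding le_star_def by simp
qed

lemma le_star_trans:
  assumes P: "poset P" and pq: "(p, q) \<in> le_star P" and qr: "(q, r) \<in> le_star P"
  shows "(p, r) \<in> le_star P"
proof -
  have "\<exists>v. (v, t) \<in> brel P \<and> (v, r) \<in> brel P" if t: "(t, p) \<in> brel P" for t
  proof -
    obtain u where u: "(u, t) \<in> brel P" "(u, q) \<in> brel P" using pq t unfolding le_star_def by auto
    then obtain v where "(v, u) \<in> brel P" "(v, r) \<in> brel P" using qr unfolding le_star_def by auto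
    then show ?thesis using poset_trans[OF P _ u(1)] by auto
  qed
  then show ?thesis using pq qr unfolding le_star_def by simp
qed

lemma sq:
  assumes P: "poset P"
  shows sq_carr: "carr (sq P) = (\<lambda>p. eq_star P `` {p}) ` carr P"
    and sq_le: "p \<in> carr P \<Longrightarrow> q \<in> carr P \<Longrightarrow>
      (eq_star P `` {p}, eq_star P `` {q}) \<in> brel (sq P) \<longleftrightarrow> (p, q) \<in> le_star P"
    and sq_poset: "poset (sq P)"
proof -
  let ?c = "\<lambda>p. eq_star P `` {p}"
  show car: "carr (sq P) = ?c ` carr P"
    unfolding sq_def quotient_def by auto
  have cls: "(p, q) \<in> le_star P \<and> (q, p) \<in> le_star P" if "?c p = ?c q" "p \<in> carr P" for p q
  proof -
    have "p \<in> ?c p" using le_star_refl[OF P that(2)] by (simp add: eq_star_def)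
    then have "(q, p) \<in> eq_star P" using that(1) by simp
    then show ?thesis by (simp add: eq_star_def)
  qed
  have eq: "?c p = ?c q" if "(p, q) \<in> le_star P" "(q, p) \<in> le_star P" for p q
    using that le_star_trans[OF P] unfolding eq_star_def by auto
  show le: "(?c p, ?c q) \<in> brel (sq P) \<longleftrightarrow> (p, q) \<in> le_star P" if pq: "p \<in> carr P" "q \<in> carr P" for p q
  proof
    assume "(?c p, ?c q) \<in> brel (sq P)"
    then obtain p' q' where "?c p = ?c p'" "?c q = ?c q'" and l: "(p', q') \<in> le_star P"
      unfolding sq_def by auto
    then have "(p, p') \<in> le_star P" "(q', q) \<in> le_star P" using cls pq by metis+
    then show "(p, q) \<in> le_star P" using l le_star_trans[OF P] by metis
  qed (auto simp: sq_def)
  show "poset (sq P)"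
    unfolding poset_def partial_order_on_def preorder_on_def
  proof (intro conjI)
    show sub: "binary_structure (sq P)"
      unfolding binary_structure_def car by (auto simp: sq_def le_star_def)
    then show "brel (sq P) \<subseteq> carr (sq P) \<times> carr (sq P)" by (simp add: binary_structure_def)
    show "refl_on (carr (sq P)) (brel (sq P))"
      unfolding refl_on_def car using le le_star_refl[OF P] by (intro ballI, elim imageE) metis
    show "trans (brel (sq P))"
    proof (rule transI)
      fix a b c assume ab: "(a, b) \<in> brel (sq P)" and bc: "(b, c) \<in> brel (sq P)"
      then have "a \<in> ?c ` carr P" "b \<in> ?c ` carr P" "c \<in> ?c ` carr P"
        using sub unfolding binary_structure_def car by auto
      then obtain p q r where pqr: "p \<in> carr P" "q \<in> carr P" "r \<in> carr P"
        and abc: "a = ?c p" "b = ?c q" "c = ?c r" by auto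
      have "(p, q) \<in> le_star P" "(q, r) \<in> le_star P"
        using ab bc le pqr unfolding abc by auto
      then show "(a, c) \<in> brel (sq P)" using le_star_trans[OF P] le pqr unfolding abc by metis
    qed
    show "antisym (brel (sq P))"
    proof (rule antisymI)
      fix a b assume ab: "(a, b) \<in> brel (sq P)" and ba: "(b, a) \<in> brel (sq P)"
      then have "a \<in> ?c ` carr P" "b \<in> ?c ` carr P"
        using sub unfolding binary_structure_def car by auto
      then obtain p q where pqr: "p \<in> carr P" "q \<in> carr P" and abc: "a = ?c p" "b = ?c q" by auto
      have "(p, q) \<in> le_star P" "(q, p) \<in> le_star P"
        using ab ba le[OF pqr] le[OF pqr(2,1)] unfolding abc by simp_all
      then show "a = b" unfolding abc by (rule eq)
    qed
  qed
qed

lemma atomless_if_splitting: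
  assumes "poset P" "splitting P"
  shows "atomless P"
  using assms(2) unfolding atomless_def poset_atom_def splitting_def compatible_def by blast

lemma splitting_sq:
  assumes P: "poset P" and split: "splitting P"
  shows "splitting (sq P)"
  unfolding splitting_def
proof
  let ?c = "\<lambda>p. eq_star P `` {p}"
  fix a assume "a \<in> carr (sq P)"
  then obtain p where p: "p \<in> carr P" "a = ?c p" using sq_carr[OF P] by auto
  then obtain q r where qr: "(q, p) \<in> brel P" "(r, p) \<in> brel P" "\<not> compatible P q r"
    using split unfolding splitting_def by auto
  have c: "q \<in> carr P" "r \<in> carr P" using qr poset_carr1[OF P] by auto
  have "\<not> compatible (sq P) (?c q) (?c r)"
  proof
    assume "compatible (sq P) (?c q) (?c r)"
    then obtain b where b: "(b, ?c q) \<in> brel (sq P)" "(b, ?c r) \<in> brel (sq P)"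
      unfolding compatible_def by auto
    then have "b \<in> carr (sq P)" using poset_carr1[OF sq_poset[OF P]] by auto
    then obtain s where s: "s \<in> carr P" "b = ?c s" using sq_carr[OF P] by auto
    then have sq: "(s, q) \<in> le_star P" and sr: "(s, r) \<in> le_star P"
      using b c sq_le[OF P] by auto
    obtain t where t: "(t, s) \<in> brel P" "(t, q) \<in> brel P"
      using sq poset_refl[OF P s(1)] unfolding le_star_def by auto
    then obtain u where "(u, t) \<in> brel P" "(u, r) \<in> brel P"
      using sr unfolding le_star_def by auto
    then have "compatible P q r" using poset_trans[OF P _ t(2)] unfolding compatible_def by auto
    then show False using qr(3) by simp
  qed
  moreover have "(?c q, a) \<in> brel (sq P)" "(?c r, a) \<in> brel (sq P)"
    using sq_le[OF P] c p le_star_if_le[OF P] qr by auto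
  ultimately show "\<exists>q r. (q, a) \<in> brel (sq P) \<and> (r, a) \<in> brel (sq P) \<and> \<not> compatible (sq P) q r"
    by auto
qed

text \<open>Decreasing sequences of the separative quotient, expressed by representatives.\<close>

definition star_closed :: "'p bstruct \<Rightarrow> bool" where
  "star_closed P \<longleftrightarrow>
     (\<forall>p :: nat \<Rightarrow> 'p. (\<forall>n. p n \<in> carr P) \<longrightarrow> (\<forall>m n. m \<le> n \<longrightarrow> (p n, p m) \<in> le_star P) \<longrightarrow>
       (\<exists>q\<in>carr P. \<forall>n. (q, p n) \<in> le_star P))"

lemma countably_closed_sq:
  assumes P: "poset P" and cl: "star_closed P"
  shows "countably_closed (sq P)"
  unfolding countably_closed_def
proof (intro allI impI)
  let ?c = "\<lambda>p. eq_star P `` {p}"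
  fix a :: "nat \<Rightarrow> 'a set"
  assume a: "\<forall>n. a n \<in> carr (sq P)" and dec: "\<forall>m n. m \<le> n \<longrightarrow> (a n, a m) \<in> brel (sq P)"
  have "\<forall>n. \<exists>p. p \<in> carr P \<and> a n = ?c p"
  proof
    fix n
    have "a n \<in> ?c ` carr P" using a[rule_format, of n] unfolding sq_carr[OF P] .
    then obtain p where "a n = ?c p" "p \<in> carr P" by (rule imageE)
    then show "\<exists>p. p \<in> carr P \<and> a n = ?c p" by (intro exI[of _ p] conjI)
  qed
  from choice[OF this] obtain p where "\<forall>n. p n \<in> carr P \<and> a n = ?c (p n)" by (rule exE)
  then have p: "p n \<in> carr P" "a n = ?c (p n)" for n by simp_all
  have "(p n, p m) \<in> le_star P" if "m \<le> n" for m n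
    using dec[rule_format, OF that] sq_le[OF P p(1)[of n] p(1)[of m]] by (simp add: p(2))
  then obtain q where "q \<in> carr P" "\<And>n. (q, p n) \<in> le_star P"
    using cl[unfolded star_closed_def, rule_format, of p] p(1) by auto
  then show "\<exists>q\<in>carr (sq P). \<forall>n. (q, a n) \<in> brel (sq P)"
    unfolding sq_carr[OF P] using p(1) by (intro bexI[of _ "?c q"] allI) (simp_all add: p(2) sq_le[OF P])
qed

section \<open>Families of sets described block by block\<close>

text \<open>The points of \<open>X\<close> are distributed over blocks, which are addressed by a row and the position \<open>col\<close> in
  the row; \<open>F l n\<close> contains the permitted traces on the block at position \<open>n\<close> of row \<open>l\<close>.\<close>

definition cell :: "('a \<Rightarrow> 'l) \<Rightarrow> ('a \<Rightarrow> nat) \<Rightarrow> 'a set \<Rightarrow> 'l \<Rightarrow> nat \<Rightarrow> 'a set" where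
  "cell row col A l n = {x \<in> A. row x = l \<and> col x = n}"

definition block_family ::
    "'a set \<Rightarrow> ('a \<Rightarrow> 'l) \<Rightarrow> ('a \<Rightarrow> nat) \<Rightarrow> 'l set \<Rightarrow> ('l \<Rightarrow> nat \<Rightarrow> 'a set set) \<Rightarrow> 'a set set" where
  "block_family X row col L F = {A. A \<subseteq> X \<and>
     (\<forall>l n. cell row col A l n = {} \<or> cell row col A l n \<in> F l n) \<and>
     (\<forall>l\<in>L. infinite {n. cell row col A l n \<noteq> {}})}"

lemma le_star_by_inclusion:
  "(A, B) \<in> le_star (by_inclusion F) \<longleftrightarrow> A \<in> F \<and> B \<in> F \<and>
     (\<forall>C\<in>F. C \<subseteq> A \<longrightarrow> (\<exists>D\<in>F. D \<subseteq> C \<and> D \<subseteq> B))"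
  unfolding le_star_def by (simp add: Bex_def) metis

lemma infinite_nat_split:
  assumes "infinite (S :: nat set)"
  shows "\<exists>M N. infinite M \<and> infinite N \<and> M \<subseteq> S \<and> N \<subseteq> S \<and> M \<inter> N = {}"
proof -
  have inj: "inj (enumerate S)" by (rule strict_mono_imp_inj_on[OF strict_mono_enumerate[OF assms]])
  have inf: "infinite (range (\<lambda>k. enumerate S (2 * k + i)))" for i
    by (intro range_inj_infinite injI) (drule injD[OF inj], simp)
  have "enumerate S (2 * k + 0) \<noteq> enumerate S (2 * m + 1)" for k m
  proof
    assume "enumerate S (2 * k + 0) = enumerate S (2 * m + 1)"
    then have "2 * k + 0 = 2 * m + 1" by (rule injD[OF inj])
    then show False by presburger
  qed
  then have "range (\<lambda>k. enumerate S (2 * k + 0)) \<inter> range (\<lambda>k. enumerate S (2 * k + 1)) = {}"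
    by auto
  then show ?thesis
    using inf[of 0] inf[of 1] enumerate_in_set[OF assms]
    by (intro exI[of _ "range (\<lambda>k. enumerate S (2 * k + 0))"] exI[of _ "range (\<lambda>k. enumerate S (2 * k + 1))"])
      auto
qed

lemma increasing_choice:
  fixes S :: "nat \<Rightarrow> nat set"
  assumes "\<And>k. infinite (S k)"
  shows "\<exists>i. strict_mono i \<and> (\<forall>k. i k \<in> S k)"
proof -
  have "\<exists>i. \<forall>k. i k \<in> S k \<and> i k < i (Suc k)"
  proof (rule dependent_nat_choice)
    show "\<exists>x. x \<in> S 0" using assms[of 0] by (metis all_not_in_conv finite.emptyI)
    fix x k
    obtain y where "x < y" "y \<in> S (Suc k)"
      using assms[of "Suc k"] unfolding infinite_nat_iff_unbounded by auto
    then show "\<exists>y. y \<in> S (Suc k) \<and> x < y" by auto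
  qed
  then show ?thesis by (auto simp: strict_mono_Suc_iff)
qed

lemma infinite_nonempty: "infinite N \<Longrightarrow> \<exists>n. n \<in> N"
  by (metis all_not_in_conv finite.emptyI)

locale blocks =
  fixes X :: "'a set" and row :: "'a \<Rightarrow> 'l" and col :: "'a \<Rightarrow> nat" and L :: "'l set"
    and F :: "'l \<Rightarrow> nat \<Rightarrow> 'a set set"
  assumes L: "L \<noteq> {}" and F: "\<And>l n. {} \<notin> F l n"
begin

abbreviation \<G> where "\<G> \<equiv> block_family X row col L F"
abbreviation blk where "blk \<equiv> cell row col"

definition supp :: "'a set \<Rightarrow> 'l \<Rightarrow> nat set" where "supp A l = {n. blk A l n \<noteq> {}}"

lemma in_\<G>:
  "A \<in> \<G> \<longleftrightarrow> A \<subseteq> X \<and> (\<forall>l n. blk A l n = {} \<or> blk A l n \<in> F l n) \<and> (\<forall>l\<in>L. infinite (supp A l))"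
  by (simp add: block_family_def supp_def)

lemma \<G>_cell: "A \<in> \<G> \<Longrightarrow> blk A l n \<noteq> {} \<Longrightarrow> blk A l n \<in> F l n"
  unfolding in_\<G> by metis

lemma \<G>_sub: "A \<in> \<G> \<Longrightarrow> A \<subseteq> X" by (simp add: in_\<G>)

lemma \<G>_cells: "A \<in> \<G> \<Longrightarrow> blk A l n = {} \<or> blk A l n \<in> F l n"
  unfolding in_\<G> by metis

lemma \<G>_infinite: "A \<in> \<G> \<Longrightarrow> l \<in> L \<Longrightarrow> infinite (supp A l)" by (simp add: in_\<G>)

lemma blk_mono: "A \<subseteq> B \<Longrightarrow> blk A l n \<subseteq> blk B l n" by (auto simp: cell_def)

text \<open>Traces can be prescribed independently of each other.\<close>

lemma assemble:
  assumes C: "\<And>l n. C l n = {} \<or> C l n \<in> F l n" and sub: "\<And>l n. C l n \<subseteq> blk X l n"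
    and inf: "\<And>l. l \<in> L \<Longrightarrow> infinite {n. C l n \<noteq> {}}"
  shows "(\<Union>l. \<Union>n. C l n) \<in> \<G>" and "blk (\<Union>l. \<Union>n. C l n) l n = C l n"
proof -
  have *: "x \<in> C l n \<Longrightarrow> x \<in> X \<and> row x = l \<and> col x = n" for x l n
    using sub[of l n] unfolding cell_def by auto
  have blk: "blk (\<Union>l. \<Union>n. C l n) l n = C l n" for l n
    using * unfolding cell_def by auto
  then show "blk (\<Union>l. \<Union>n. C l n) l n = C l n" .
  have "(\<Union>l. \<Union>n. C l n) \<subseteq> X" using * by auto
  then show "(\<Union>l. \<Union>n. C l n) \<in> \<G>" using C inf by (simp add: in_\<G> blk supp_def)
qed

text \<open>The blocks met by a given set are divided, in each row, into two infinite sets.\<close>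

lemma splitting_\<G>: "splitting (by_inclusion \<G>)"
  unfolding splitting_def
proof
  fix A assume "A \<in> carr (by_inclusion \<G>)"
  then have A: "A \<in> \<G>" by simp
  have "\<forall>l. \<exists>MN. l \<in> L \<longrightarrow> infinite (fst MN) \<and> infinite (snd MN) \<and> fst MN \<subseteq> supp A l \<and>
      snd MN \<subseteq> supp A l \<and> fst MN \<inter> snd MN = {}"
  proof
    fix l
    show "\<exists>MN. l \<in> L \<longrightarrow> infinite (fst MN) \<and> infinite (snd MN) \<and> fst MN \<subseteq> supp A l \<and>
        snd MN \<subseteq> supp A l \<and> fst MN \<inter> snd MN = {}"
      using infinite_nat_split[OF \<G>_infinite[OF A], of l] by (cases "l \<in> L") (metis fst_conv snd_conv, simp)
  qed
  from choice[OF this] obtain MN where "\<forall>l. l \<in> L \<longrightarrow> infinite (fst (MN l)) \<and>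
      infinite (snd (MN l)) \<and> fst (MN l) \<subseteq> supp A l \<and>
      snd (MN l) \<subseteq> supp A l \<and> fst (MN l) \<inter> snd (MN l) = {}" by (rule exE)
  then have MN: "infinite (fst (MN l))" "infinite (snd (MN l))" "fst (MN l) \<subseteq> supp A l"
      "snd (MN l) \<subseteq> supp A l" "fst (MN l) \<inter> snd (MN l) = {}" if "l \<in> L" for l
    using that by simp_all
  define C where "C N l n = (if l \<in> L \<and> n \<in> N l then blk A l n else {})"
    for N :: "'l \<Rightarrow> nat set" and l n
  have asm: "(\<Union>l. \<Union>n. C N l n) \<in> \<G> \<and> (\<forall>l n. blk (\<Union>l. \<Union>n. C N l n) l n = C N l n)"
    if inf: "\<And>l. l \<in> L \<Longrightarrow> infinite (N l)" and sub: "\<And>l. l \<in> L \<Longrightarrow> N l \<subseteq> supp A l" for N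
  proof -
    have 1: "C N l n = {} \<or> C N l n \<in> F l n" for l n
      using \<G>_cells[OF A, of l n] by (simp add: C_def)
    have 2: "C N l n \<subseteq> blk X l n" for l n using blk_mono[OF \<G>_sub[OF A]] by (simp add: C_def)
    have "{n. C N l n \<noteq> {}} = N l" if "l \<in> L" for l
      using sub[OF that] that by (auto simp: C_def supp_def)
    then have 3: "infinite {n. C N l n \<noteq> {}}" if "l \<in> L" for l using inf[OF that] that by simp
    show ?thesis using assemble[of "C N", OF 1 2 3] by simp
  qed
  let ?M = "\<lambda>l. fst (MN l)" and ?N = "\<lambda>l. snd (MN l)"
  define M where "M = (\<Union>l. \<Union>n. C ?M l n)"
  define N where "N = (\<Union>l. \<Union>n. C ?N l n)"
  have M: "M \<in> \<G>" "blk M l n = C ?M l n" for l n using asm[of ?M] MN by (simp_all add: M_def)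
  have N: "N \<in> \<G>" "blk N l n = C ?N l n" for l n using asm[of ?N] MN by (simp_all add: N_def)
  have sub: "M \<subseteq> A" "N \<subseteq> A" by (auto simp: M_def N_def C_def cell_def split: if_splits)
  have "\<not> compatible (by_inclusion \<G>) M N"
  proof
    assume "compatible (by_inclusion \<G>) M N"
    then obtain B where B: "B \<in> \<G>" "B \<subseteq> M" "B \<subseteq> N"
      unfolding compatible_def by_inclusion_simps by metis
    obtain l where l: "l \<in> L" using L by auto
    obtain n where "n \<in> supp B l" using infinite_nonempty[OF \<G>_infinite[OF B(1) l]] by auto
    then have "blk B l n \<noteq> {}" by (simp add: supp_def)
    moreover have "blk B l n \<subseteq> C ?M l n" "blk B l n \<subseteq> C ?N l n"
      using blk_mono[OF B(2), of l n] blk_mono[OF B(3), of l n] by (simp_all add: M(2) N(2))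
    ultimately have "C ?M l n \<noteq> {}" "C ?N l n \<noteq> {}" by auto
    then have "n \<in> fst (MN l) \<inter> snd (MN l)" unfolding C_def by (auto split: if_splits)
    then show False using MN(5)[OF l] by simp
  qed
  with M(1) N(1) A sub show "\<exists>q r. (q, A) \<in> brel (by_inclusion \<G>) \<and> (r, A) \<in> brel (by_inclusion \<G>) \<and>
      \<not> compatible (by_inclusion \<G>) q r"
    by (intro exI[of _ M] exI[of _ N]) simp
qed

text \<open>The relation \<open>\<le>\<^sup>*\<close> of the poset of permitted traces on one block, with \<open>B'\<close> not necessarily permitted;
  in particular \<open>B'\<close> may be empty.\<close>

definition below :: "'l \<Rightarrow> nat \<Rightarrow> 'a set \<Rightarrow> 'a set \<Rightarrow> bool" where
  "below l n B B' \<longleftrightarrow> (\<forall>C\<in>F l n. C \<subseteq> B \<longrightarrow> (\<exists>D\<in>F l n. D \<subseteq> C \<inter> B'))"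

definition failing :: "'a set \<Rightarrow> 'a set \<Rightarrow> 'l \<Rightarrow> nat set" where
  "failing A B l = {n. blk A l n \<noteq> {} \<and> \<not> below l n (blk A l n) (blk B l n)}"

text \<open>A set \<open>C\<close> below \<open>A\<close> meets infinitely many blocks of each row that are not exceptional, and on each of
  these its trace contains a permitted set inside \<open>B\<close>.\<close>

lemma le_star_if_finite_failing:
  assumes A: "A \<in> \<G>" and B: "B \<in> \<G>" and fin: "\<And>l. l \<in> L \<Longrightarrow> finite (failing A B l)"
  shows "(A, B) \<in> le_star (by_inclusion \<G>)"
  unfolding le_star_by_inclusion
proof (intro conjI A B ballI impI)
  fix C assume C: "C \<in> \<G>" "C \<subseteq> A"
  define good where "good l = (if l \<in> L then supp C l - failing A B l else {})" for l
  define D where "D l n = (SOME D. D \<in> F l n \<and> D \<subseteq> blk C l n \<inter> blk B l n)" for l n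
  have D: "D l n \<in> F l n \<and> D l n \<subseteq> blk C l n \<inter> blk B l n" if "n \<in> good l" for l n
  proof -
    have n: "n \<in> supp C l" "n \<notin> failing A B l" using that by (auto simp: good_def split: if_splits)
    then have ne: "blk C l n \<noteq> {}" by (simp add: supp_def)
    have sub: "blk C l n \<subseteq> blk A l n" using blk_mono[OF C(2)] .
    have "below l n (blk A l n) (blk B l n)" using n(2) ne sub unfolding failing_def by auto
    then have "\<exists>D. D \<in> F l n \<and> D \<subseteq> blk C l n \<inter> blk B l n"
      using \<G>_cell[OF C(1) ne] sub unfolding below_def by metis
    then show ?thesis unfolding D_def by (rule someI_ex)
  qed
  define E where "E l n = (if n \<in> good l then D l n else {})" for l n
  have E: "E l n \<subseteq> blk C l n \<inter> blk B l n" "E l n = {} \<or> E l n \<in> F l n" for l n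
    using D[of n l] by (simp_all add: E_def)
  have "D l n \<noteq> {}" if "n \<in> good l" for l n using D[OF that] F[of l n] by metis
  then have "{n. E l n \<noteq> {}} = good l" for l by (auto simp: E_def)
  then have inf: "infinite {n. E l n \<noteq> {}}" if "l \<in> L" for l
    using that \<G>_infinite[OF C(1) that] fin[OF that] by (simp add: good_def)
  have "E l n \<subseteq> blk X l n" for l n using E(1)[of l n] blk_mono[OF \<G>_sub[OF C(1)], of l n] by auto
  then have "(\<Union>l. \<Union>n. E l n) \<in> \<G>" using assemble(1)[of E] E(2) inf by simp
  moreover have "(\<Union>l. \<Union>n. E l n) \<subseteq> C" "(\<Union>l. \<Union>n. E l n) \<subseteq> B"
    using E(1) unfolding cell_def by fastforce+
  ultimately show "\<exists>D\<in>\<G>. D \<subseteq> C \<and> D \<subseteq> B" by metis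
qed

text \<open>If some row had infinitely many exceptional blocks, a set below \<open>A\<close> that, in this row, consists of
  witnesses for the exceptions only would be incompatible with \<open>B\<close>.\<close>

lemma finite_failing_if_le_star:
  assumes le: "(A, B) \<in> le_star (by_inclusion \<G>)" and l: "l \<in> L"
  shows "finite (failing A B l)"
proof (rule ccontr)
  assume inf: "infinite (failing A B l)"
  have A: "A \<in> \<G>" using le by (simp add: le_star_by_inclusion)
  define C where "C n = (SOME C. C \<in> F l n \<and> C \<subseteq> blk A l n \<and> (\<forall>D\<in>F l n. \<not> D \<subseteq> C \<inter> blk B l n))" for n
  have C: "C n \<in> F l n \<and> C n \<subseteq> blk A l n \<and> (\<forall>D\<in>F l n. \<not> D \<subseteq> C n \<inter> blk B l n)"
    if "n \<in> failing A B l" for n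
  proof -
    have "\<exists>C. C \<in> F l n \<and> C \<subseteq> blk A l n \<and> (\<forall>D\<in>F l n. \<not> D \<subseteq> C \<inter> blk B l n)"
      using that unfolding failing_def below_def by auto
    then show ?thesis unfolding C_def by (rule someI_ex)
  qed
  define E where "E l' n = (if l' = l then if n \<in> failing A B l then C n else {} else blk A l' n)" for l' n
  have E: "E l' n \<subseteq> blk A l' n" for l' n using C[of n] by (simp add: E_def)
  have EF: "E l' n = {} \<or> E l' n \<in> F l' n" for l' n
    using C[of n] \<G>_cells[OF A, of l' n] by (simp add: E_def)
  have inf': "infinite {n. E l' n \<noteq> {}}" if "l' \<in> L" for l'
  proof (cases "l' = l")
    case True
    have "C n \<noteq> {}" if "n \<in> failing A B l" for n using C[OF that] F[of l n] by metis
    then have "{n. E l' n \<noteq> {}} = failing A B l" using True by (auto simp: E_def)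
    then show ?thesis using inf by simp
  next
    case False
    then have "{n. E l' n \<noteq> {}} = supp A l'" by (simp add: E_def supp_def)
    then show ?thesis using \<G>_infinite[OF A that] by simp
  qed
  have EX: "E l' n \<subseteq> blk X l' n" for l' n
    using subset_trans[OF E blk_mono[OF \<G>_sub[OF A]]] .
  define U where "U = (\<Union>l. \<Union>n. E l n)"
  have U: "U \<in> \<G>" "blk U l' n = E l' n" for l' n
    using assemble[of E, OF EF EX inf'] by (simp_all add: U_def)
  have "U \<subseteq> A" using E unfolding U_def cell_def by fastforce
  then obtain D where D: "D \<in> \<G>" "D \<subseteq> U" "D \<subseteq> B"
    using le U(1) unfolding le_star_by_inclusion by metis
  obtain n where "n \<in> supp D l" using infinite_nonempty[OF \<G>_infinite[OF D(1) l]] by auto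
  then have ne: "blk D l n \<noteq> {}" by (simp add: supp_def)
  then have DF: "blk D l n \<in> F l n" by (rule \<G>_cell[OF D(1)])
  have DE: "blk D l n \<subseteq> E l n" "blk D l n \<subseteq> blk B l n"
    using blk_mono[OF D(2), of l n] blk_mono[OF D(3), of l n] U(2) by auto
  then have "n \<in> failing A B l" "E l n = C n" using ne by (auto simp: E_def split: if_splits)
  then show False using C[of n] DF DE by simp
qed

text \<open>From the \<open>k\<close>-th set of the sequence, one block is taken in each row, further to the right than those
  before and outside the finitely many blocks where the set fails to be below one of its predecessors.
  On the blocks chosen from the \<open>m\<close>-th one onwards the result is below the \<open>m\<close>-th set.\<close>

lemma star_closed_\<G>: "star_closed (by_inclusion \<G>)"
  unfolding star_closed_def
proof (intro allI impI)
  fix p :: "nat \<Rightarrow> 'a set"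
  assume p: "\<forall>n. p n \<in> carr (by_inclusion \<G>)"
    and dec: "\<forall>m n. m \<le> n \<longrightarrow> (p n, p m) \<in> le_star (by_inclusion \<G>)"
  have p\<G>: "p n \<in> \<G>" for n using p by simp
  define S where "S l k = supp (p k) l - (\<Union>m\<in>{..k}. failing (p k) (p m) l)" for l k
  define i where "i l = (SOME i. strict_mono i \<and> (\<forall>k. i k \<in> S l k))" for l
  have i: "strict_mono (i l) \<and> (\<forall>k. i l k \<in> S l k)" if l: "l \<in> L" for l
  proof -
    have "finite (failing (p k) (p m) l)" if "m \<le> k" for k m
      using finite_failing_if_le_star[OF _ l] dec that by simp
    then have "infinite (S l k)" for k unfolding S_def using \<G>_infinite[OF p\<G> l, of k] by simp
    then have "\<exists>i. strict_mono i \<and> (\<forall>k. i k \<in> S l k)" by (rule increasing_choice)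
    then show ?thesis unfolding i_def by (rule someI_ex)
  qed
  have inj: "inj (i l)" if "l \<in> L" for l using i[OF that] by (simp add: strict_mono_imp_inj_on)
  define E where "E l n = (if l \<in> L \<and> n \<in> range (i l) then blk (p (inv (i l) n)) l n else {})" for l n
  have Ei: "E l (i l k) = blk (p k) l (i l k)" if "l \<in> L" for l k
    using that inv_f_f[OF inj[OF that]] by (simp add: E_def)
  have ne: "blk (p k) l (i l k) \<noteq> {}" if "l \<in> L" for l k
    using i[OF that] unfolding S_def supp_def by simp
  have Ecase: "E l n = {} \<or> (\<exists>k. E l n = blk (p k) l n)" for l n by (auto simp: E_def)
  have 1: "E l n = {} \<or> E l n \<in> F l n" for l n
    using Ecase[of l n] \<G>_cells[OF p\<G>] by metis
  have 2: "E l n \<subseteq> blk X l n" for l n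
    using Ecase[of l n] blk_mono[OF \<G>_sub[OF p\<G>]] by (metis empty_subsetI)
  have 3: "infinite {n. E l n \<noteq> {}}" if l: "l \<in> L" for l
  proof -
    have "range (i l) \<subseteq> {n. E l n \<noteq> {}}" using Ei[OF l] ne[OF l] by auto
    moreover have "infinite (range (i l))" using inj[OF l] by (rule range_inj_infinite)
    ultimately show ?thesis using infinite_super by auto
  qed
  define U where "U = (\<Union>l. \<Union>n. E l n)"
  have U: "U \<in> \<G>" "blk U l n = E l n" for l n
    using assemble[of E, OF 1 2 3] by (simp_all add: U_def)
  have "(U, p m) \<in> le_star (by_inclusion \<G>)" for m
  proof (rule le_star_if_finite_failing[OF U(1) p\<G>])
    fix l assume l: "l \<in> L"
    note il = i[OF l]
    have "failing U (p m) l \<subseteq> i l ` {..<m}"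
    proof
      fix n assume n: "n \<in> failing U (p m) l"
      then have n': "E l n \<noteq> {}" "\<not> below l n (E l n) (blk (p m) l n)"
        by (simp_all add: failing_def U(2))
      then obtain k where k: "n = i l k" by (auto simp: E_def split: if_splits)
      have "k < m"
      proof (rule ccontr)
        assume "\<not> k < m"
        then have "n \<notin> failing (p k) (p m) l" using il k unfolding S_def by simp
        then show False using n' ne[OF l, of k] by (simp add: failing_def k Ei[OF l])
      qed
      then show "n \<in> i l ` {..<m}" using k by simp
    qed
    then show "finite (failing U (p m) l)" by (rule finite_subset) simp
  qed
  then show "\<exists>q\<in>carr (by_inclusion \<G>). \<forall>n. (q, p n) \<in> le_star (by_inclusion \<G>)"
    using U(1) by (intro bexI[of _ U]) simp_all
qed

end

text \<open>If \<open>A - B\<close> is infinite, it is itself an infinite subset of \<open>A\<close> without a common part with \<open>B\<close>.\<close>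

lemma le_star_infinite:
  "(A, B) \<in> le_star (by_inclusion {A :: nat set. infinite A}) \<longleftrightarrow>
     infinite A \<and> infinite B \<and> finite (A - B)"
proof -
  have "finite (A - B)" if *: "\<forall>C\<in>{A. infinite A}. C \<subseteq> A \<longrightarrow> (\<exists>D\<in>{A. infinite A}. D \<subseteq> C \<and> D \<subseteq> B)"
  proof (rule ccontr)
    assume "infinite (A - B)"
    then obtain D where "infinite D" "D \<subseteq> A - B" "D \<subseteq> B"
      using *[rule_format, of "A - B"] by auto
    then have "D = {}" by auto
    then show False using \<open>infinite D\<close> by simp
  qed
  moreover have "\<exists>D\<in>{A. infinite A}. D \<subseteq> C \<and> D \<subseteq> B" if "finite (A - B)" "infinite C" "C \<subseteq> A" for C
  proof -
    have "C - B \<subseteq> A - B" using that(3) by auto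
    then have "finite (C - B)" using that(1) by (rule finite_subset)
    moreover have "C = (C - B) \<union> (C \<inter> B)" by auto
    ultimately have "infinite (C \<inter> B)" using that(2) by (metis finite_Un)
    then show ?thesis by (intro bexI[of _ "C \<inter> B"]) simp_all
  qed
  ultimately show ?thesis unfolding le_star_by_inclusion by (metis mem_Collect_eq)
qed

text \<open>The two posets are literally equal: the sets that are \<open>=\<^sup>*\<close> to an infinite set are those that differ
  from it by a finite set, and these are infinite too.\<close>

lemma Pomega_Fin_plus_eq: "Pomega_Fin_plus = sq (by_inclusion {A. infinite A})"
proof -
  let ?P = "by_inclusion {A :: nat set. infinite A}"
  have eq: "eq_star ?P `` {A} = eq_mod_fin `` {A}" if "infinite A" for A
  proof (rule set_eqI)
    fix B
    have "infinite B" if "finite (A - B)"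
      using \<open>infinite A\<close> that by (metis finite_Diff2)
    then show "B \<in> eq_star ?P `` {A} \<longleftrightarrow> B \<in> eq_mod_fin `` {A}"
      using \<open>infinite A\<close> unfolding eq_star_def eq_mod_fin_def by (auto simp: le_star_infinite)
  qed
  have null: "eq_mod_fin `` {A} = eq_mod_fin `` {{}} \<longleftrightarrow> finite A" for A
  proof
    assume "eq_mod_fin `` {A} = eq_mod_fin `` {{}}"
    moreover have "A \<in> eq_mod_fin `` {A}" by (simp add: eq_mod_fin_def)
    ultimately have "A \<in> eq_mod_fin `` {{}}" by simp
    then show "finite A" by (simp add: eq_mod_fin_def)
  next
    assume A: "finite A"
    have "finite ((A - B) \<union> (B - A)) \<longleftrightarrow> finite (({} - B) \<union> (B - {}))" for B
      using A by (simp add: finite_Diff2)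
    then show "eq_mod_fin `` {A} = eq_mod_fin `` {{}}" unfolding eq_mod_fin_def by simp
  qed
  have C: "UNIV // eq_mod_fin - {eq_mod_fin `` {{}}} = (\<lambda>A. eq_mod_fin `` {A}) ` {A. infinite A}"
    (is "?C = ?R")
  proof (rule set_eqI)
    fix a
    have "a \<in> ?C \<longleftrightarrow> (\<exists>A. a = eq_mod_fin `` {A} \<and> a \<noteq> eq_mod_fin `` {{}})"
      unfolding quotient_def by simp
    also have "\<dots> \<longleftrightarrow> (\<exists>A. a = eq_mod_fin `` {A} \<and> infinite A)" using null by metis
    also have "\<dots> \<longleftrightarrow> a \<in> ?R" unfolding image_iff Bex_def mem_Collect_eq by (simp only: conj_commute)
    finally show "a \<in> ?C \<longleftrightarrow> a \<in> ?R" .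
  qed
  have carr: "carr (sq ?P) = ?C"
    unfolding sq_carr[OF poset_by_inclusion] C using eq by simp
  have "(a, b) \<in> brel (sq ?P) \<longleftrightarrow> a \<in> ?C \<and> b \<in> ?C \<and> (\<exists>A\<in>a. \<exists>B\<in>b. finite (A - B))" for a b
  proof
    assume "(a, b) \<in> brel (sq ?P)"
    then obtain A B where AB: "(A, B) \<in> le_star ?P" and a: "a = eq_star ?P `` {A}" "b = eq_star ?P `` {B}"
      unfolding sq_def by auto
    then have i: "infinite A" "infinite B" "finite (A - B)" by (simp_all add: le_star_infinite)
    have a': "a = eq_mod_fin `` {A}" "b = eq_mod_fin `` {B}" using a eq i by simp_all
    then have "A \<in> a" "B \<in> b" by (simp_all add: eq_mod_fin_def)
    moreover have "a \<in> ?C" "b \<in> ?C" unfolding C using i a' by simp_all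
    ultimately show "a \<in> ?C \<and> b \<in> ?C \<and> (\<exists>A\<in>a. \<exists>B\<in>b. finite (A - B))" using i(3) by blast
  next
    assume *: "a \<in> ?C \<and> b \<in> ?C \<and> (\<exists>A\<in>a. \<exists>B\<in>b. finite (A - B))"
    then obtain A B where a: "a = eq_mod_fin `` {A}" "infinite A" and b: "b = eq_mod_fin `` {B}" "infinite B"
      unfolding C by auto
    obtain A' B' where "A' \<in> a" "B' \<in> b" and f: "finite (A' - B')" using * by auto
    then have "finite (A - A')" "finite (B' - B)" using a b by (simp_all add: eq_mod_fin_def)
    then have "finite ((A - A') \<union> (A' - B') \<union> (B' - B))" using f by simp
    moreover have "A - B \<subseteq> (A - A') \<union> (A' - B') \<union> (B' - B)" by auto
    ultimately have "finite (A - B)" by (rule rev_finite_subset)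
    then have "(A, B) \<in> le_star ?P" using a b by (simp add: le_star_infinite)
    then show "(a, b) \<in> brel (sq ?P)"
      using sq_le[OF poset_by_inclusion, of A "{A. infinite A}" B] a b eq by simp
  qed
  then have "brel (sq ?P) = {(a, b). a \<in> ?C \<and> b \<in> ?C \<and> (\<exists>A\<in>a. \<exists>B\<in>b. finite (A - B))}" by auto
  with carr show ?thesis
    unfolding Pomega_Fin_plus_def Let_def by (metis prod.collapse)
qed

lemma sq_size:
  assumes CH: continuum_hypothesis and X: "countable X" and F: "F \<subseteq> Pow X"
  shows "|carr (sq (by_inclusion F))| \<le>o omega1"
proof -
  obtain f :: "'a \<Rightarrow> nat" where f: "inj_on f X" using X by (rule countableE)
  have "|carr (sq (by_inclusion F))| \<le>o |F|"
    unfolding sq_carr[OF poset_by_inclusion] by_inclusion_simps by (rule card_of_image)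
  moreover have "|F| \<le>o |Pow X|" using F by (rule card_of_mono1)
  moreover have "|Pow X| \<le>o |UNIV :: nat set set|"
    unfolding card_of_ordLeq[symmetric]
    using inj_on_image_Pow[OF f] by (intro exI[of _ "image f"]) simp
  moreover have "|UNIV :: nat set set| \<le>o omega1"
    using CH unfolding continuum_hypothesis_def by (rule ordIso_imp_ordLeq)
  ultimately show ?thesis by (metis ordLeq_transitive)
qed

lemma (in blocks) sq_\<G>:
  assumes ne: "\<G> \<noteq> {}"
  shows "poset (sq (by_inclusion \<G>))" "carr (sq (by_inclusion \<G>)) \<noteq> {}"
    "countably_closed (sq (by_inclusion \<G>))" "splitting (sq (by_inclusion \<G>))"
  using sq_poset[OF poset_by_inclusion] sq_carr[OF poset_by_inclusion, of \<G>] ne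
    countably_closed_sq[OF poset_by_inclusion star_closed_\<G>]
    splitting_sq[OF poset_by_inclusion splitting_\<G>]
  by simp_all

lemma Pomega_Fin_plus_facts:
  shows "poset Pomega_Fin_plus" "carr Pomega_Fin_plus \<noteq> {}"
    "countably_closed Pomega_Fin_plus" "splitting Pomega_Fin_plus"
    "continuum_hypothesis \<Longrightarrow> |carr Pomega_Fin_plus| \<le>o omega1"
proof -
  interpret blocks UNIV "\<lambda>n :: nat. ()" "\<lambda>n. n" "{()}" "\<lambda>_ n. {{n}}"
    by unfold_locales auto
  have "\<G> = {A. infinite A}" by (auto simp: block_family_def cell_def)
  then have "Pomega_Fin_plus = sq (by_inclusion \<G>)" by (simp add: Pomega_Fin_plus_eq)
  moreover have "(UNIV :: nat set) \<in> \<G>" using \<open>\<G> = {A. infinite A}\<close> by simp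
  then have "\<G> \<noteq> {}" by (metis empty_iff)
  ultimately show "poset Pomega_Fin_plus" "carr Pomega_Fin_plus \<noteq> {}"
    "countably_closed Pomega_Fin_plus" "splitting Pomega_Fin_plus"
    "continuum_hypothesis \<Longrightarrow> |carr Pomega_Fin_plus| \<le>o omega1"
    using sq_\<G> sq_size[of "UNIV :: nat set" \<G>] by simp_all
qed

lemma (in blocks) sq_\<G>_forcing:
  assumes ne: "\<G> \<noteq> {}" and X: "countable X"
  shows "poset (sq (by_inclusion \<G>)) \<and> atomless (sq (by_inclusion \<G>)) \<and>
    omega1_closed (sq (by_inclusion \<G>)) \<and>
    (continuum_hypothesis \<longrightarrow> forcing_equivalent (sq (by_inclusion \<G>)) Pomega_Fin_plus)"
proof (intro conjI impI)
  note P = sq_\<G>[OF ne]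
  show "poset (sq (by_inclusion \<G>))" by (rule P(1))
  show "atomless (sq (by_inclusion \<G>))" by (rule atomless_if_splitting[OF P(1,4)])
  show "omega1_closed (sq (by_inclusion \<G>))" by (rule omega1_closed_if_countably_closed[OF P(1-3)])
  assume CH: continuum_hypothesis
  have "\<G> \<subseteq> Pow X" using \<G>_sub by (metis PowI subsetI)
  then show "forcing_equivalent (sq (by_inclusion \<G>)) Pomega_Fin_plus"
    using forcing_equivalent_if_countably_closed[OF CH P sq_size[OF CH X] Pomega_Fin_plus_facts] CH
    by simp
qed

section \<open>Infinitely many blocks\<close>

lemma countable_card_of_infinite:
  assumes "countable I" "infinite I" "D \<subseteq> I"
  shows "|D| =o |I| \<longleftrightarrow> infinite D"
proof
  assume "|D| =o |I|"
  then show "infinite D" using card_of_ordIso_finite assms(2) by auto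
next
  assume "infinite D"
  moreover have "countable D" using assms by (metis countable_subset)
  ultimately have "bij_betw (from_nat_into I \<circ> to_nat_on D) D I"
    using bij_betw_trans[OF to_nat_on_infinite bij_betw_from_nat_into] assms by metis
  then show "|D| =o |I|" using card_of_ordIso by blast
qed

lemma slice_image: "(\<lambda>x. snd (f x)) ` {x \<in> A. fst (f x) = i} = (f ` A) `` {i}"
proof (rule set_eqI)
  fix y
  have "y \<in> (\<lambda>x. snd (f x)) ` {x \<in> A. fst (f x) = i} \<longleftrightarrow> (\<exists>x\<in>A. (i, y) = f x)"
    unfolding image_iff Bex_def mem_Collect_eq by (metis fst_conv snd_conv prod.collapse)
  then show "y \<in> (\<lambda>x. snd (f x)) ` {x \<in> A. fst (f x) = i} \<longleftrightarrow> y \<in> (f ` A) `` {i}"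
    by (simp add: image_iff)
qed

lemma slice_image2:
  "(\<lambda>x. snd (snd (f x))) ` {x \<in> A. fst (f x) = i \<and> fst (snd (f x)) = C} = ((f ` A) `` {i}) `` {C}"
proof (rule set_eqI)
  fix z
  have "z \<in> (\<lambda>x. snd (snd (f x))) ` {x \<in> A. fst (f x) = i \<and> fst (snd (f x)) = C} \<longleftrightarrow>
      (\<exists>x\<in>A. (i, (C, z)) = f x)"
    unfolding image_iff Bex_def mem_Collect_eq by (metis fst_conv snd_conv prod.collapse)
  then show "z \<in> (\<lambda>x. snd (snd (f x))) ` {x \<in> A. fst (f x) = i \<and> fst (snd (f x)) = C} \<longleftrightarrow>
      z \<in> ((f ` A) `` {i}) `` {C}"
    by (simp add: image_iff)
qed

text \<open>The trace on a block is compared by means of \<open>val\<close>, which sends the points of a block to a fixed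
  structure with the set \<open>S\<close> of permitted traces.\<close>

lemma infinite_blocks:
  assumes X: "countable (carr X)" and L: "L \<noteq> {}" and S: "{} \<notin> S"
    and cop: "\<And>A. A \<subseteq> carr X \<Longrightarrow> A \<in> copies X \<longleftrightarrow>
      (\<forall>l n. cell row col A l n = {} \<or> val ` cell row col A l n \<in> S) \<and>
      (\<forall>l\<in>L. infinite {n. cell row col A l n \<noteq> {}})"
  shows "poset (sq (\<P> X)) \<and> atomless (sq (\<P> X)) \<and> omega1_closed (sq (\<P> X)) \<and>
    (continuum_hypothesis \<longrightarrow> forcing_equivalent (sq (\<P> X)) Pomega_Fin_plus)"
proof -
  interpret blocks "carr X" row col L "\<lambda>l n. {B. val ` B \<in> S}"
    by unfold_locales (use L S in auto)
  have "A \<in> copies X \<longleftrightarrow> A \<in> \<G>" for A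
    using cop[of A] unfolding block_family_def mem_Collect_eq copies_def by metis
  then have "\<P> X = by_inclusion \<G>" unfolding copies_poset_eq by (metis set_eqI)
  moreover have "\<G> \<noteq> {}" using carr_in_copies[of X] \<open>\<And>A. A \<in> copies X \<longleftrightarrow> A \<in> \<G>\<close> by auto
  ultimately show ?thesis using sq_\<G>_forcing X by simp
qed

text \<open>If \<open>\<kappa>\<close> is infinite, there is one row, whose blocks are the copies of \<open>Y\<close>: a subset of a countably
  infinite set has full cardinality iff it is infinite. If \<open>\<kappa>\<close> is finite, every \<open>i\<close> in \<open>\<kappa>\<close> has to be
  met and gives a row of its own, with one block for each of the infinitely many components of \<open>Y\<close>.\<close>

lemma sq_copies_poset_infinite_case:
  fixes Y :: "'b bstruct"
  assumes X: "represents Y \<kappa> X" and cnt: "countable (carr X)"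
    and ne: "carr X \<noteq> {}" and inf: "infinite (Field \<kappa>) \<or> infinite (bs_components Y)"
  shows "poset (sq (\<P> X)) \<and> atomless (sq (\<P> X)) \<and> omega1_closed (sq (\<P> X)) \<and>
    (continuum_hypothesis \<longrightarrow> forcing_equivalent (sq (\<P> X)) Pomega_Fin_plus)"
proof -
  have dY: "digraph Y" and uY: "ultrahomogeneous Y" using X by (simp_all add: represents_def)
  obtain f where f: "bij_betw f (carr X) (Field \<kappa> \<times> carr Y)"
    and cop: "\<And>A. A \<subseteq> carr X \<Longrightarrow> A \<in> copies X \<longleftrightarrow> f ` A \<in> copies (copies_union \<kappa> (enlargement Y))"
    using represents_copies[OF X] by auto
  have prod: "f ` carr X = Field \<kappa> \<times> carr Y" using f by (simp add: bij_betw_def)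
  have Fne: "Field \<kappa> \<noteq> {}" and Yne: "carr Y \<noteq> {}" using prod ne by auto
  have "countable (Field \<kappa> \<times> carr Y)" using cnt by (metis prod countable_image)
  then have cF: "countable (Field \<kappa>)" and cY: "countable (carr Y)"
    using Fne Yne countable_image[of _ fst] countable_image[of _ snd]
    by (metis fst_image_times, metis snd_image_times)
  show ?thesis
  proof (cases "finite (Field \<kappa>)")
    case False
    let ?e = "to_nat_on (Field \<kappa>)"
    let ?row = "\<lambda>_ :: 'c. ()" and ?col = "\<lambda>x. ?e (fst (f x))" and ?val = "\<lambda>x. snd (f x)"
    have e: "bij_betw ?e (Field \<kappa>) UNIV" by (rule to_nat_on_infinite[OF cF False])
    have e_inj: "?e i = ?e j \<longleftrightarrow> i = j" if "i \<in> Field \<kappa>" "j \<in> Field \<kappa>" for i j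
      using e that by (metis bij_betw_inv_into_left)
    show ?thesis
    proof (rule infinite_blocks[OF cnt])
      show "{()} \<noteq> {}" by simp
      show "{} \<notin> copies Y" using copy_nonempty[OF Yne] by auto
      fix A assume A: "A \<subseteq> carr X"
      let ?B = "f ` A"
      have B: "?B \<subseteq> Field \<kappa> \<times> carr Y" using A prod by auto
      have cell: "?val ` cell ?row ?col A l (?e i) = ?B `` {i}" if i: "i \<in> Field \<kappa>" for l i
      proof -
        have "fst (f x) \<in> Field \<kappa>" if "x \<in> A" for x using subsetD[OF B imageI[OF that]] by (simp add: mem_Times_iff)
        then have "cell ?row ?col A l (?e i) = {x \<in> A. fst (f x) = i}"
          using e_inj[OF _ i] by (auto simp: cell_def)
        then show ?thesis by (simp add: slice_image)
      qed
      have all_n: "(\<forall>n. P n) \<longleftrightarrow> (\<forall>i\<in>Field \<kappa>. P (?e i))" for P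
        using e unfolding bij_betw_def by (metis UNIV_I imageE)
      have c0: "A \<in> copies X \<longleftrightarrow> |Domain ?B| =o |Field \<kappa>| \<and> (\<forall>i\<in>Domain ?B. ?B `` {i} \<in> copies Y)"
        unfolding cop[OF A] using copies_enlargement_union[OF dY Yne, of ?B \<kappa>] B by simp
      have DB: "Domain ?B \<subseteq> Field \<kappa>" using B by auto
      have c1: "|Domain ?B| =o |Field \<kappa>| \<longleftrightarrow> infinite (Domain ?B)"
        by (rule countable_card_of_infinite[OF cF False DB])
      have c2: "infinite (Domain ?B) \<longleftrightarrow> infinite {n. cell ?row ?col A () n \<noteq> {}}"
      proof -
        have "n \<in> ?e ` Domain ?B \<longleftrightarrow> n \<in> {n. cell ?row ?col A () n \<noteq> {}}" for n
        proof -
          have "n \<in> ?e ` Field \<kappa>" unfolding bij_betw_imp_surj_on[OF e] by simp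
          then obtain i where i: "i \<in> Field \<kappa>" "n = ?e i" by auto
          have "n \<in> ?e ` Domain ?B \<longleftrightarrow> i \<in> Domain ?B"
            unfolding i(2) by (rule inj_on_image_mem_iff[OF bij_betw_imp_inj_on[OF e] i(1) DB])
          also have "\<dots> \<longleftrightarrow> ?B `` {i} \<noteq> {}" by auto
          also have "\<dots> \<longleftrightarrow> cell ?row ?col A () n \<noteq> {}"
            unfolding i(2) cell[OF i(1), of "()", symmetric] image_is_empty ..
          finally show ?thesis by simp
        qed
        then have "?e ` Domain ?B = {n. cell ?row ?col A () n \<noteq> {}}" by (rule set_eqI)
        moreover have "inj_on ?e (Domain ?B)"
          by (rule inj_on_subset[OF bij_betw_imp_inj_on[OF e]]) (use B in auto)
        ultimately show ?thesis using finite_image_iff by metis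
      qed
      have c3: "(\<forall>i\<in>Domain ?B. ?B `` {i} \<in> copies Y) \<longleftrightarrow>
          (\<forall>l n. cell ?row ?col A l n = {} \<or> ?val ` cell ?row ?col A l n \<in> copies Y)"
      proof -
        have "(\<forall>n. cell ?row ?col A l n = {} \<or> ?val ` cell ?row ?col A l n \<in> copies Y) \<longleftrightarrow>
            (\<forall>i\<in>Field \<kappa>. ?B `` {i} = {} \<or> ?B `` {i} \<in> copies Y)" for l
        proof -
          have "cell ?row ?col A l (?e i) = {} \<longleftrightarrow> ?B `` {i} = {}" if "i \<in> Field \<kappa>" for i
            unfolding cell[OF that, of l, symmetric] by simp
          then show ?thesis unfolding all_n using cell[of _ l] by simp
        qed
        moreover have "(\<forall>i\<in>Field \<kappa>. ?B `` {i} = {} \<or> ?B `` {i} \<in> copies Y) \<longleftrightarrow>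
            (\<forall>i\<in>Domain ?B. ?B `` {i} \<in> copies Y)"
        proof -
          have "i \<in> Domain ?B \<longleftrightarrow> ?B `` {i} \<noteq> {}" for i by auto
          moreover have "Domain ?B \<subseteq> Field \<kappa>" using B by auto
          ultimately show ?thesis by (metis subsetD)
        qed
        ultimately show ?thesis by simp
      qed
      show "A \<in> copies X \<longleftrightarrow>
        (\<forall>l n. cell ?row ?col A l n = {} \<or> ?val ` cell ?row ?col A l n \<in> copies Y) \<and>
        (\<forall>l\<in>{()}. infinite {n. cell ?row ?col A l n \<noteq> {}})"
        unfolding c0 c1 c2 c3 by (simp add: conj_commute)
    qed
  next
    case fin: True
    let ?K = "bs_components Y"
    have infK: "infinite ?K" using inf fin by simp
    obtain C0 where C0: "C0 \<in> ?K" using infK by (metis all_not_in_conv finite.emptyI)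
    have "?K \<subseteq> (\<lambda>x. rst Y `` {x}) ` carr Y" by (auto simp: in_bs_components)
    then have cK: "countable ?K" using cY by (meson countable_image countable_subset)
    let ?Z = "substructure Y C0"
    have ne0: "carr ?Z \<noteq> {}" using component_nonempty[OF C0] by auto
    obtain f where f: "bij_betw f (carr X) (Field \<kappa> \<times> (?K \<times> C0))"
      and cop: "\<And>A. A \<subseteq> carr X \<Longrightarrow> A \<in> copies X \<longleftrightarrow> |Domain (f ` A)| =o |Field \<kappa>| \<and>
        (\<forall>i\<in>Domain (f ` A). |Domain ((f ` A) `` {i})| =o |?K| \<and>
          (\<forall>C\<in>Domain ((f ` A) `` {i}). ((f ` A) `` {i}) `` {C} \<in> copies ?Z))"
      using copies_two_level[OF X Yne C0] by auto
    let ?e = "to_nat_on ?K"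
    let ?row = "\<lambda>x. fst (f x)" and ?col = "\<lambda>x. ?e (fst (snd (f x)))" and ?val = "\<lambda>x. snd (snd (f x))"
    have e: "bij_betw ?e ?K UNIV" by (rule to_nat_on_infinite[OF cK infK])
    have e_inj: "?e i = ?e j \<longleftrightarrow> i = j" if "i \<in> ?K" "j \<in> ?K" for i j
      using e that by (metis bij_betw_inv_into_left)
    show ?thesis
    proof (rule infinite_blocks[OF cnt])
      show "Field \<kappa> \<noteq> {}" by (rule Fne)
      show "{} \<notin> copies ?Z" using copy_nonempty[OF ne0] by auto
      fix A assume A: "A \<subseteq> carr X"
      let ?B = "f ` A"
      have B: "?B \<subseteq> Field \<kappa> \<times> (?K \<times> C0)"
        using image_mono[OF A, of f] unfolding bij_betw_imp_surj_on[OF f] .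
      have cell: "?val ` cell ?row ?col A i (?e C) = (?B `` {i}) `` {C}" if C: "C \<in> ?K" for i C
      proof -
        have "fst (snd (f x)) \<in> ?K" if "x \<in> A" for x using subsetD[OF B imageI[OF that]] by (simp add: mem_Times_iff)
        then have "cell ?row ?col A i (?e C) = {x \<in> A. fst (f x) = i \<and> fst (snd (f x)) = C}"
          using e_inj[OF _ C] by (auto simp: cell_def)
        then show ?thesis by (simp add: slice_image2)
      qed
      have cell_empty: "cell ?row ?col A i (?e C) = {} \<longleftrightarrow> (?B `` {i}) `` {C} = {}" if "C \<in> ?K" for i C
        unfolding cell[OF that, of i, symmetric] by simp
      have all_n: "(\<forall>n. P n) \<longleftrightarrow> (\<forall>C\<in>?K. P (?e C))" for P
        using ball_simps(9)[of ?e ?K P] unfolding bij_betw_imp_surj_on[OF e] by simp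
      have inf_iff: "infinite {n. cell ?row ?col A i n \<noteq> {}} \<longleftrightarrow> infinite (Domain (?B `` {i}))" for i
      proof -
        have "n \<in> ?e ` Domain (?B `` {i}) \<longleftrightarrow> n \<in> {n. cell ?row ?col A i n \<noteq> {}}" for n
        proof -
          have "n \<in> ?e ` ?K" unfolding bij_betw_imp_surj_on[OF e] by simp
          then obtain C where C: "C \<in> ?K" "n = ?e C" by auto
          have "Domain (?B `` {i}) \<subseteq> ?K" using B by auto
          then have "n \<in> ?e ` Domain (?B `` {i}) \<longleftrightarrow> C \<in> Domain (?B `` {i})"
            unfolding C(2) by (rule inj_on_image_mem_iff[OF bij_betw_imp_inj_on[OF e] C(1)])
          also have "\<dots> \<longleftrightarrow> (?B `` {i}) `` {C} \<noteq> {}" by auto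
          also have "\<dots> \<longleftrightarrow> cell ?row ?col A i n \<noteq> {}" unfolding C(2) cell_empty[OF C(1)] by simp
          finally show ?thesis by simp
        qed
        then have "?e ` Domain (?B `` {i}) = {n. cell ?row ?col A i n \<noteq> {}}" by (rule set_eqI)
        moreover have "inj_on ?e (Domain (?B `` {i}))"
          by (rule inj_on_subset[OF bij_betw_imp_inj_on[OF e]]) (use B in auto)
        ultimately show ?thesis using finite_image_iff by metis
      qed
      have D1: "|Domain ?B| =o |Field \<kappa>| \<longleftrightarrow> Domain ?B = Field \<kappa>"
        by (rule card_of_Domain_finite[OF fin]) (use B in auto)
      have D2: "|Domain (?B `` {i})| =o |?K| \<longleftrightarrow> infinite (Domain (?B `` {i}))" for i
        by (rule countable_card_of_infinite[OF cK infK]) (use B in auto)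
      have dom: "C \<in> Domain (?B `` {i}) \<longleftrightarrow> C \<in> ?K \<and> (?B `` {i}) `` {C} \<noteq> {}" for i C using B by auto
      have row_out: "(?B `` {i}) `` {C} = {}" if "i \<notin> Field \<kappa>" for i C using B that by auto
      have c0: "A \<in> copies X \<longleftrightarrow> Domain ?B = Field \<kappa> \<and> (\<forall>i\<in>Domain ?B. infinite (Domain (?B `` {i}))) \<and>
          (\<forall>i\<in>Domain ?B. \<forall>C\<in>Domain (?B `` {i}). (?B `` {i}) `` {C} \<in> copies ?Z)"
        unfolding cop[OF A] D1 D2 ball_conj_distrib ..
      have c1: "A \<in> copies X \<longleftrightarrow> (\<forall>i\<in>Field \<kappa>. infinite (Domain (?B `` {i}))) \<and>
          (\<forall>i\<in>Field \<kappa>. \<forall>C\<in>Domain (?B `` {i}). (?B `` {i}) `` {C} \<in> copies ?Z)"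
      proof -
        have "Domain ?B = Field \<kappa>" if *: "\<forall>i\<in>Field \<kappa>. infinite (Domain (?B `` {i}))"
        proof
          show "Domain ?B \<subseteq> Field \<kappa>" using B by auto
          show "Field \<kappa> \<subseteq> Domain ?B"
          proof
            fix i assume "i \<in> Field \<kappa>"
            then have "Domain (?B `` {i}) \<noteq> {}" using * by (metis finite.emptyI)
            then show "i \<in> Domain ?B" by auto
          qed
        qed
        then show ?thesis unfolding c0 by metis
      qed
      have c2: "(\<forall>i\<in>Field \<kappa>. \<forall>C\<in>Domain (?B `` {i}). (?B `` {i}) `` {C} \<in> copies ?Z) \<longleftrightarrow>
          (\<forall>i n. cell ?row ?col A i n = {} \<or> ?val ` cell ?row ?col A i n \<in> copies ?Z)"
      proof -
        have "(\<forall>n. cell ?row ?col A i n = {} \<or> ?val ` cell ?row ?col A i n \<in> copies ?Z) \<longleftrightarrow>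
            (\<forall>C\<in>Domain (?B `` {i}). (?B `` {i}) `` {C} \<in> copies ?Z)" for i
          unfolding all_n using cell[of _ i] cell_empty[of _ i] dom[of _ i] by simp metis
        moreover have "\<forall>C\<in>Domain (?B `` {i}). (?B `` {i}) `` {C} \<in> copies ?Z" if "i \<notin> Field \<kappa>" for i
          using dom row_out[OF that] by simp
        ultimately show ?thesis by metis
      qed
      show "A \<in> copies X \<longleftrightarrow>
        (\<forall>l n. cell ?row ?col A l n = {} \<or> ?val ` cell ?row ?col A l n \<in> copies ?Z) \<and>
        (\<forall>l\<in>Field \<kappa>. infinite {n. cell ?row ?col A l n \<noteq> {}})"
        unfolding c1 c2 inf_iff by (rule conj_commute)
    qed
  qed
qed

theorem theorem5p2:
  fixes X :: "'a bstruct"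
  assumes "binary_structure X"
    and "countable (carr X)" and "carr X \<noteq> {}"
    and "reflexive_bs X \<or> irreflexive_bs X"
    and "ultrahomogeneous X"
    and "\<not> biconnected X"
  shows "(\<exists>(Y :: 'a bstruct) (\<kappa> :: nat rel). represents Y \<kappa> X) \<and>
    (\<forall>(Y :: 'b bstruct) (\<kappa> :: 'i rel). represents Y \<kappa> X \<longrightarrow>
       (\<kappa> <o natLeq \<and> finite (bs_components Y) \<longrightarrow>
          (\<exists>(Z :: 'b bstruct) n. digraph Z \<and> ultrahomogeneous Z \<and> biconnected Z \<and> n \<ge> 2 \<and>
             \<P> X \<cong>\<^sub>b poset_power (\<P> Z) n)) \<and>
       (\<kappa> =o natLeq \<or> infinite (bs_components Y) \<longrightarrow>
          poset (sq (\<P> X)) \<and> atomless (sq (\<P> X)) \<and> omega1_closed (sq (\<P> X)) \<and>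
          (continuum_hypothesis \<longrightarrow> forcing_equivalent (sq (\<P> X)) Pomega_Fin_plus)))"
proof (intro conjI allI impI)
  show "\<exists>(Y :: 'a bstruct) (\<kappa> :: nat rel). represents Y \<kappa> X"
    using representation_exists assms by metis
next
  fix Y :: "'b bstruct" and \<kappa> :: "'i rel"
  assume X: "represents Y \<kappa> X"
  have ck: "|Field \<kappa>| =o \<kappa>"
    using X card_of_Field_ordIso by (auto simp: represents_def)
  {
    assume k: "\<kappa> <o natLeq \<and> finite (bs_components Y)"
    have "|Field \<kappa>| <o natLeq" by (rule ordIso_ordLess_trans[OF ck conjunct1[OF k]])
    then have fk: "finite (Field \<kappa>)" unfolding finite_iff_ordLess_natLeq .
    have Yne: "carr Y \<noteq> {}"
      using represents_copies[OF X] assms(3) by (auto simp: bij_betw_def)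
    show "\<exists>(Z :: 'b bstruct) n. digraph Z \<and> ultrahomogeneous Z \<and> biconnected Z \<and> n \<ge> 2 \<and>
        \<P> X \<cong>\<^sub>b poset_power (\<P> Z) n"
      by (rule copies_poset_finite_case[OF X Yne fk conjunct2[OF k]])
  next
    assume k: "\<kappa> =o natLeq \<or> infinite (bs_components Y)"
    have "infinite (Field \<kappa>)" if "\<kappa> =o natLeq"
      unfolding finite_iff_ordLess_natLeq
      using ordIso_transitive[OF ck that] not_ordLess_ordIso by blast
    then have "infinite (Field \<kappa>) \<or> infinite (bs_components Y)" using k by auto
    note sq_copies_poset_infinite_case[OF X assms(2,3) this]
    then show "poset (sq (\<P> X))" "atomless (sq (\<P> X))" "omega1_closed (sq (\<P> X))"
      "continuum_hypothesis \<Longrightarrow> forcing_equivalent (sq (\<P> X)) Pomega_Fin_plus" by simp_all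
  }
qed

end
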